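(* For $\alpha\in[0,1]$ put $F(\alpha)=\big\{x\in[0,1)\colon\liminf_{n\to\infty}\frac{R_n(x)}{n}=\alpha\big\}$. Then for every $\alpha\in[0,1]$, $$\dim_HF(\alpha)=\begin{cases}s\big(4\alpha(1-\alpha),\frac{\sqrt5+1}{2}\big),&\text{if }0\le\alpha\le\frac12,\\ 0,&\text{otherwise.}\end{cases}$$
   Context: $\dim_H$ denotes Hausdorff dimension. Each irrational $x\in[0,1)$ has a unique infinite continued fraction expansion $x=[a_1(x),a_2(x),\ldots]$ with $a_n(x)\in\mathbb{N}=\{1,2,\ldots\}$. The $n$-th maximal run-length function is $$R_n(x)=\max\{l\ge1\colon a_{j+1}(x)=\cdots=a_{j+l}(x)\text{ for some }0\le j\le n-l\}.$$ In the definition of $F(\alpha)$ only irrational $x$ are considered. For positive integers $a_1,\ldots,a_n$, $q_n(a_1,\ldots,a_n)$ is the denominator of the convergent $[a_1,\ldots,a_n]$, given by $q_{-1}=0$, $q_0=1$, $q_k=a_kq_{k-1}+q_{k-2}$. Put $\tau=\frac{\sqrt5+1}{2}$. For $0<\gamma<1$, $s(\gamma,\tau)$ is the limit (known to exist) $$s(\gamma,\tau)=\lim_{n\to\infty}\inf\Big\{\rho\ge0\colon \sum_{a_1,\ldots,a_n\in\mathbb{N}}\Big(\frac{1}{\tau^{\frac{n\gamma}{1-\gamma}}\,q_n(a_1,\ldots,a_n)}\Big)^{2\rho}\le1\Big\},$$ and one sets $s(0,\tau)=1$, $s(1,\tau)=\frac12$. *)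

theory Defs
  imports "HOL-Analysis.Analysis"
begin

subsection \<open>Hausdorff dimension\<close>

text \<open>The summand $|U|^s$ of a cover, with the conventions $|\emptyset|^s = 0$ for all $s$ and
  $|U|^0 = 1$ for nonempty \<open>U\<close>. The latter is spelled out because \<open>0 powr 0 = 0\<close>.\<close>

definition hausdorff_gauge :: "real \<Rightarrow> 'a::metric_space set \<Rightarrow> ennreal" where
  "hausdorff_gauge s U =
     (if U = {} then 0 else if s = 0 then 1 else ennreal (diameter U powr s))"

text \<open>Boundedness is required explicitly since \<open>diameter\<close> is real-valued and unspecified on
  unbounded sets. Finite covers are included by padding with the empty set.\<close>

definition hausdorff_premeasure :: "real \<Rightarrow> real \<Rightarrow> 'a::metric_space set \<Rightarrow> ennreal" where
  "hausdorff_premeasure \<delta> s A =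
     (INF U \<in> {U :: nat \<Rightarrow> 'a set. A \<subseteq> (\<Union>i. U i) \<and> (\<forall>i. bounded (U i) \<and> diameter (U i) \<le> \<delta>)}.
        \<Sum>i. hausdorff_gauge s (U i))"

definition hausdorff_measure :: "real \<Rightarrow> 'a::metric_space set \<Rightarrow> ennreal" where
  "hausdorff_measure s A = (SUP \<delta> \<in> {0<..}. hausdorff_premeasure \<delta> s A)"

definition hausdorff_dim :: "'a::metric_space set \<Rightarrow> ereal" where
  "hausdorff_dim A = (INF s \<in> {s. 0 \<le> s \<and> hausdorff_measure s A = 0}. ereal s)"


subsection \<open>Continued fractions\<close>

definition gauss_map :: "real \<Rightarrow> real" where
  "gauss_map x = frac (1 / x)"

text \<open>The partial quotient $a_n(x)$, for $n \geq 1$ and irrational \<open>x\<close>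
  (the value at \<open>n = 0\<close> is irrelevant).\<close>

definition cf_digit :: "nat \<Rightarrow> real \<Rightarrow> nat" where
  "cf_digit n x = nat \<lfloor>1 / (gauss_map ^^ (n - 1)) x\<rfloor>"

text \<open>The finite continued fraction $[a_1,\dots,a_n]$.\<close>

fun cf_value :: "(nat \<Rightarrow> nat) \<Rightarrow> nat \<Rightarrow> real" where
  "cf_value a 0 = 0"
| "cf_value a (Suc n) = 1 / (real (a 1) + cf_value (\<lambda>k. a (Suc k)) n)"

text \<open>The denominator $q_n(a_1,\dots,a_n)$; the second equation is the general recursion
  with $q_{-1} = 0$.\<close>

fun cf_denom :: "(nat \<Rightarrow> nat) \<Rightarrow> nat \<Rightarrow> nat" where
  "cf_denom a 0 = 1"
| "cf_denom a (Suc 0) = a 1"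
| "cf_denom a (Suc (Suc k)) = a (Suc (Suc k)) * cf_denom a (Suc k) + cf_denom a k"

lemma gauss_map_irrational:
  assumes "x \<in> {0..<1}" "x \<notin> \<rat>"
  shows "gauss_map x \<in> {0..<1}" "gauss_map x \<notin> \<rat>"
    and "cf_digit 1 x \<ge> 1" "1 / (real (cf_digit 1 x) + gauss_map x) = x"
proof -
  have x: "0 < x" "x < 1"
    using assms by (auto simp: less_le)
  show "gauss_map x \<in> {0..<1}"
    by (simp add: gauss_map_def frac_lt_1)
  have fl: "1 \<le> \<lfloor>1 / x\<rfloor>" using x by (simp add: le_floor_iff)
  then have "1 \<le> nat \<lfloor>1 / x\<rfloor>" by linarith
  then show "cf_digit 1 x \<ge> 1" by (simp add: cf_digit_def)
  have eq: "real (cf_digit 1 x) + gauss_map x = 1 / x"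
  proof -
    have "real (nat \<lfloor>1 / x\<rfloor>) = of_int \<lfloor>1 / x\<rfloor>" using fl by linarith
    then show ?thesis by (simp add: cf_digit_def gauss_map_def frac_def)
  qed
  then show 1: "1 / (real (cf_digit 1 x) + gauss_map x) = x" by simp
  show "gauss_map x \<notin> \<rat>"
  proof
    assume "gauss_map x \<in> \<rat>"
    then have "1 / (real (cf_digit 1 x) + gauss_map x) \<in> \<rat>" by simp
    with 1 assms(2) show False by simp
  qed
qed

lemma cf_digit_Suc: "n \<ge> 1 \<Longrightarrow> cf_digit (Suc n) x = cf_digit n (gauss_map x)"
  by (cases n) (simp_all add: cf_digit_def funpow_swap1)

lemma cf_value_cong:
  assumes "\<And>k. k \<ge> 1 \<Longrightarrow> a k = b k"
  shows "cf_value a n = cf_value b n"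
  using assms
proof (induction n arbitrary: a b)
  case (Suc n)
  have "cf_value (\<lambda>k. a (Suc k)) n = cf_value (\<lambda>k. b (Suc k)) n"
    by (rule Suc.IH) (simp add: Suc.prems)
  then show ?case using Suc.prems[of 1] by simp
qed simp

lemma cf_value_bounds:
  assumes "\<And>k. k \<ge> 1 \<Longrightarrow> a k \<ge> 1"
  shows "0 \<le> cf_value a n \<and> cf_value a n \<le> 1"
  using assms
proof (induction n arbitrary: a)
  case (Suc n)
  have "0 \<le> cf_value (\<lambda>k. a (Suc k)) n"
    using Suc.IH[of "\<lambda>k. a (Suc k)"] Suc.prems by simp
  moreover have "real (a 1) \<ge> 1" using Suc.prems[of 1] by simp
  ultimately show ?case by simp
qed simp

lemma cf_digit_ge_1:
  assumes "x \<in> {0..<1}" "x \<notin> \<rat>" "n \<ge> 1"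
  shows "cf_digit n x \<ge> 1"
  using assms(3,1,2)
proof (induction n arbitrary: x rule: dec_induct)
  case base then show ?case by (rule gauss_map_irrational(3))
next
  case (step n)
  then show ?case using gauss_map_irrational[of x] cf_digit_Suc[of n x] by simp
qed

lemma cf_value_error:
  assumes "x \<in> {0..<1}" "x \<notin> \<rat>"
  shows "\<bar>cf_value (\<lambda>k. cf_digit k x) n - x\<bar> \<le> 1 / real (Suc n)"
  using assms
proof (induction n arbitrary: x)
  case (Suc n)
  note g = gauss_map_irrational[OF Suc.prems]
  define u where "u = cf_value (\<lambda>k. cf_digit k (gauss_map x)) n"
  define v where "v = gauss_map x"
  define c where "c = real (cf_digit 1 x)"
  define d where "d = \<bar>u - v\<bar>"
  have u0: "0 \<le> u" using cf_value_bounds cf_digit_ge_1[OF g(1,2)] by (simp add: u_def)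
  have v0: "0 \<le> v" using g(1) by (simp add: v_def)
  have c1: "1 \<le> c" using g(3) by (simp add: c_def)
  have dn: "d \<le> 1 / real (Suc n)" using Suc.IH[OF g(1,2)] by (simp add: d_def u_def v_def)
  have "cf_value (\<lambda>k. cf_digit (Suc k) x) n = u"
    unfolding u_def by (rule cf_value_cong) (simp add: cf_digit_Suc)
  then have e: "cf_value (\<lambda>k. cf_digit k x) (Suc n) = 1 / (c + u)" by (simp add: c_def)
  have x: "x = 1 / (c + v)" using g(4) by (simp add: c_def v_def)
  have "1 + d \<le> (1 + u) * (1 + v)" using u0 v0 by (simp add: d_def algebra_simps abs_if)
  also have "\<dots> \<le> (c + u) * (c + v)" using u0 v0 c1 by (intro mult_mono) auto
  finally have p: "1 + d \<le> (c + u) * (c + v)" .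
  have d0: "0 \<le> d" by (simp add: d_def)
  have "1 / (c + u) - 1 / (c + v) = (v - u) / ((c + u) * (c + v))"
    using u0 v0 c1 by (simp add: field_simps)
  then have "\<bar>1 / (c + u) - 1 / (c + v)\<bar> = d / ((c + u) * (c + v))"
    using u0 v0 c1 by (simp add: d_def abs_divide abs_mult abs_minus_commute)
  also have "\<dots> \<le> d / (1 + d)" using p d0 u0 v0 c1 by (intro divide_left_mono mult_pos_pos) auto
  also have "\<dots> \<le> 1 / real (Suc (Suc n))"
    using dn d0 by (simp add: field_simps)
  finally show ?case using e x by simp
qed auto

lemma cf_limit_shift:
  assumes "\<And>n. n \<ge> 1 \<Longrightarrow> a n \<ge> 1" and lim: "cf_value a \<longlonglongrightarrow> x"
    and x: "x \<in> {0..<1}" "x \<notin> \<rat>"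
  shows "a 1 = cf_digit 1 x" and "cf_value (\<lambda>k. a (Suc k)) \<longlonglongrightarrow> gauss_map x"
proof -
  let ?s = "cf_value (\<lambda>k. a (Suc k))"
  have x0: "x \<noteq> 0" using x by auto
  have b: "0 \<le> ?s n \<and> ?s n \<le> 1" for n
    using assms(1) by (intro cf_value_bounds) auto
  have "(\<lambda>n. 1 / cf_value a (Suc n) - a 1) \<longlonglongrightarrow> 1 / x - a 1"
    using x0 by (intro tendsto_intros LIMSEQ_Suc[OF lim]) auto
  then have s: "?s \<longlonglongrightarrow> 1 / x - a 1" by simp
  have "0 \<le> 1 / x - a 1" by (rule LIMSEQ_le_const[OF s]) (use b in auto)
  moreover have "1 / x - a 1 \<le> 1" by (rule LIMSEQ_le_const2[OF s]) (use b in auto)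
  moreover have "1 / x - a 1 \<noteq> 1"
  proof
    assume "1 / x - a 1 = 1"
    then have "x = 1 / (1 + a 1)" using x0 by (simp add: field_simps)
    then have "x \<in> \<rat>" by simp
    then show False using x by simp
  qed
  ultimately have fl: "\<lfloor>1 / x\<rfloor> = int (a 1)" by (intro floor_unique) auto
  then show "a 1 = cf_digit 1 x" by (simp add: cf_digit_def)
  show "?s \<longlonglongrightarrow> gauss_map x"
    using s fl by (simp add: gauss_map_def frac_def)
qed

text \<open>The infinite continued fraction expansion of an irrational \<open>x\<close> in the unit interval
  exists, is unique, and consists of the digits \<open>cf_digit n x\<close>.\<close>

lemma cf_expansion_iff:
  assumes "x \<in> {0..<1}" "x \<notin> \<rat>"
  shows "((\<forall>n\<ge>1. a n \<ge> 1) \<and> cf_value a \<longlonglongrightarrow> x) \<longleftrightarrow> (\<forall>n\<ge>1. a n = cf_digit n x)"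
    (is "?L \<longleftrightarrow> ?R")
proof
  assume R: ?R
  have "(\<lambda>n. cf_value (\<lambda>k. cf_digit k x) n - x) \<longlonglongrightarrow> 0"
    using cf_value_error[OF assms]
    by (intro Lim_null_comparison[OF _ LIMSEQ_Suc[OF lim_1_over_n]]) auto
  then have "cf_value (\<lambda>k. cf_digit k x) \<longlonglongrightarrow> x" by (simp add: LIM_zero_iff)
  moreover have "cf_value a = cf_value (\<lambda>k. cf_digit k x)"
    using R by (intro ext cf_value_cong) auto
  ultimately show ?L using R cf_digit_ge_1[OF assms] by simp
next
  assume L: ?L
  have "a n = cf_digit n x" if "n \<ge> 1" for n
    using that L assms
  proof (induction n arbitrary: a x rule: dec_induct)
    case (base a x)
    then show ?case by (intro cf_limit_shift(1)) auto
  next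
    case (step n a x)
    have "cf_value (\<lambda>k. a (Suc k)) \<longlonglongrightarrow> gauss_map x"
      using step.prems by (intro cf_limit_shift(2)) auto
    then have "a (Suc n) = cf_digit n (gauss_map x)"
      using step.prems gauss_map_irrational[of x] by (intro step.IH) auto
    then show ?case using step.hyps by (simp add: cf_digit_Suc)
  qed
  then show ?R by blast
qed


subsection \<open>Run lengths and the dimensional number\<close>

text \<open>The constraint $0 \leq j \leq n - l$ is written \<open>j + l \<le> n\<close> to avoid truncated
  subtraction. \<open>run_length 0 x\<close> is an unspecified junk value.\<close>

definition run_length :: "nat \<Rightarrow> real \<Rightarrow> nat" where
  "run_length n x =
     Max {l. l \<ge> 1 \<and> (\<exists>j. j + l \<le> n \<and> (\<forall>i\<in>{1..l}. cf_digit (j + i) x = cf_digit (j + 1) x))}"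

definition F_set :: "real \<Rightarrow> real set" where
  "F_set \<alpha> =
     {x \<in> {0..<1}. x \<notin> \<rat> \<and> liminf (\<lambda>n. ereal (real (run_length n x) / real n)) = ereal \<alpha>}"

text \<open>Tuples $(a_1,\dots,a_n)$ of positive integers are the extensional functions on \<open>{1..n}\<close>.
  The sum is taken in \<open>ennreal\<close>, so a divergent series has value \<open>\<infinity>\<close>.\<close>

definition s_pre :: "nat \<Rightarrow> real \<Rightarrow> real \<Rightarrow> real" where
  "s_pre n \<gamma> \<tau> = Inf {\<rho>. 0 \<le> \<rho> \<and>
     (\<Sum>\<^sub>\<infinity> a \<in> {1..n} \<rightarrow>\<^sub>E {1..}.
        ennreal ((1 / (\<tau> powr (real n * \<gamma> / (1 - \<gamma>)) * real (cf_denom a n))) powr (2 * \<rho>))) \<le> 1}"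

definition s_dim :: "real \<Rightarrow> real \<Rightarrow> real" where
  "s_dim \<gamma> \<tau> = (if \<gamma> = 0 then 1 else if \<gamma> = 1 then 1 / 2 else lim (\<lambda>n. s_pre n \<gamma> \<tau>))"

end

theory Submission
  imports Defs
begin

text \<open>
  Let the record runs of \<open>x\<close> have lengths \<open>l\<^sub>k\<close> and start after \<open>m\<^sub>k\<close> digits, and put
  \<open>L\<^sub>k = l\<^sub>1 + \<dots> + l\<^sub>k\<close>, \<open>f\<^sub>k = m\<^sub>k - L\<^sub>k\<^sub>-\<^sub>1\<close> and \<open>\<beta> = (1 - \<alpha>) / \<alpha>\<close>. Just before a new record is reached,
  \<open>R\<^sub>n / n\<close> is about \<open>l\<^sub>k / (m\<^sub>k\<^sub>+\<^sub>1 + l\<^sub>k)\<close>, so \<open>liminf R\<^sub>n / n = \<alpha>\<close> means that \<open>m\<^sub>k\<^sub>+\<^sub>1\<close> is asymptotically at most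
  \<open>\<beta> l\<^sub>k\<close>, that is, \<open>f\<^sub>k\<^sub>+\<^sub>1 \<le> (\<beta> - 1) L\<^sub>k - \<beta> L\<^sub>k\<^sub>-\<^sub>1\<close>. For \<open>\<beta> < 1\<close> this is impossible because \<open>m\<^sub>k\<^sub>+\<^sub>1 \<ge> l\<^sub>k\<close>, and the
  digits of \<open>x\<close> are eventually constant. Otherwise \<open>g f\<^sub>k > L\<^sub>k\<close> for all late \<open>k\<close> would give
  \<open>y\<^sub>k\<^sub>+\<^sub>1 + g \<beta> / y\<^sub>k < g (\<beta> - 1)\<close> for \<open>y\<^sub>k = L\<^sub>k / L\<^sub>k\<^sub>-\<^sub>1\<close>, which has no positive solutions as soon as
  \<open>g < 4 \<beta> / (\<beta> - 1)\<^sup>2\<close>; the threshold is \<open>\<gamma> / (1 - \<gamma>)\<close> for \<open>\<gamma> = 4 \<alpha> (1 - \<alpha>)\<close>. Hence infinitely often at least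
  \<open>g f\<close> digits lie in runs, and since a run of length \<open>l\<close> contributes at least a constant times \<open>\<tau>\<^sup>l\<close> to the
  denominator, the cylinders of these prefixes form a cover with small \<open>\<rho>\<close>-sum whenever the sum that defines \<open>s(\<gamma>, \<tau>)\<close>
  drops below \<open>1\<close> at \<open>\<rho>\<close>. There are only few records, so the number of run patterns does not matter.

  Conversely, runs of ones whose lengths grow geometrically with the critical ratio, separated by
  free blocks over a finite alphabet, form a Cantor set inside \<open>F(\<alpha>)\<close> that carries a product
  measure with the required decay on cylinders. For \<open>\<alpha> = 1/2\<close> the growth has to be
  superexponential and the alphabets have to grow.
\<close>

subsection \<open>Words and continued fractions\<close>

text \<open>The critical \<open>g\<close> is a discriminant: for positive \<open>g\<close>,
  \<open>y\<^sup>2 - g * (b - 1) * y + g * b\<close> has no real root exactly if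
  \<open>g * (b - 1)\<^sup>2 < 4 * b\<close>. Because
  \<open>1 - \<gamma> = (1 - 2 * \<alpha>)\<^sup>2\<close>, equality at \<open>b = \<beta>\<close>
  means \<open>g = \<gamma> / (1 - \<gamma>)\<close>. Run patterns are harmless because record
  lengths increase strictly: a prefix with \<open>k\<close> records has length of order at least
  \<open>k * k\<close>, so a weight that decays exponentially in the length pays for any constant
  factor per record. This slack exists for every exponent above the limit, since submultiplicativity
  turns one sum below 1 into geometric decay. A part of the slack goes into lowering
  \<open>g\<close> and raising \<open>b\<close>: the liminf bounds the quotients from below only by
  numbers smaller than \<alpha>. In the Cantor set, cutting a word into blocks costs a bounded
  factor per block. It is absorbed by long blocks: passing from an exponent \<rho>' to a smaller
  \<rho> enlarges the sum over words of length \<open>N\<close> by a factor exponential in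
  \<open>N\<close>.\<close>

text \<open>For \<open>w = [a\<^sub>1, \<dots>, a\<^sub>n]\<close> these are the numerator and denominator of the continued fraction
  with last partial quotient \<open>a\<^sub>n + y\<close>; thus \<open>cden w y = q\<^sub>n + y q\<^sub>n\<^sub>-\<^sub>1\<close>. Recursion from the left makes
  \<open>cden\<close> the square root of the inverse derivative of the branch \<open>cfm w\<close>.\<close>

fun cnum :: "nat list \<Rightarrow> real \<Rightarrow> real" and cden :: "nat list \<Rightarrow> real \<Rightarrow> real" where
  "cnum [] y = y"
| "cnum (a # w) y = cden w y"
| "cden [] y = 1"
| "cden (a # w) y = real a * cden w y + cnum w y"

abbreviation "qw w \<equiv> cden w 0"

definition cfm :: "nat list \<Rightarrow> real \<Rightarrow> real" where
  "cfm w y = foldr (\<lambda>a z. 1 / (real a + z)) w y"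

lemma cfm_simps [simp]:
  "cfm [] y = y" "cfm (a # w) y = 1 / (real a + cfm w y)"
  by (simp_all add: cfm_def)

lemma cfm_append: "cfm (u @ w) y = cfm u (cfm w y)"
  by (simp add: cfm_def)

lemma cnum_cden_ge:
  assumes "0 \<notin> set w" "0 \<le> y"
  shows "1 \<le> cden w y" "0 \<le> cnum w y"
proof -
  have "1 \<le> cden w y \<and> 0 \<le> cnum w y" using assms
  proof (induction w)
    case (Cons a w)
    then have "1 * 1 \<le> real a * cden w y" by (intro mult_mono) auto
    with Cons show ?case by auto
  qed simp
  then show "1 \<le> cden w y" "0 \<le> cnum w y" by auto
qed

lemma cden_pos: "0 \<notin> set w \<Longrightarrow> 0 \<le> y \<Longrightarrow> 0 < cden w y"
  using cnum_cden_ge(1)[of w y] by linarith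

lemma cfm_eq:
  assumes "0 \<notin> set w" "0 \<le> y"
  shows "cfm w y = cnum w y / cden w y"
  using assms
proof (induction w)
  case (Cons a w)
  then have w: "cfm w y = cnum w y / cden w y" "0 < cden w y" using cden_pos[of w y] by auto
  have "1 / (real a + cnum w y / cden w y) = 1 / ((real a * cden w y + cnum w y) / cden w y)"
    using w(2) by (simp add: add_divide_distrib)
  then show ?case by (simp add: w(1))
qed simp

lemma cfm_nonneg: "0 \<le> y \<Longrightarrow> 0 \<le> cfm w y"
  by (induction w) auto

lemma cfm_le_1:
  assumes "0 \<notin> set w" "0 \<le> y" "y \<le> 1"
  shows "cfm w y \<le> 1"
  using assms
proof (cases w)
  case (Cons a v)
  have "real a \<ge> 1" "cfm v y \<ge> 0" using assms Cons cfm_nonneg[of y v] by auto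
  then show ?thesis using Cons by simp
qed simp

text \<open>The chain rule for branches: the derivative of \<open>cfm w\<close> is
  \<open>cden w y\<close> to the power -2 up to sign, so \<open>cden\<close> is multiplicative along
  compositions.\<close>

lemma cnum_cden_append:
  assumes "0 \<notin> set w" "0 \<le> y"
  shows "cden (u @ w) y = cden u (cfm w y) * cden w y"
    and "cnum (u @ w) y = cnum u (cfm w y) * cden w y"
proof -
  have "cden (u @ w) y = cden u (cfm w y) * cden w y \<and>
      cnum (u @ w) y = cnum u (cfm w y) * cden w y"
  proof (induction u)
    case Nil
    then show ?case using cfm_eq[OF assms] cden_pos[OF assms] by simp
  qed (auto simp: algebra_simps)
  then show "cden (u @ w) y = cden u (cfm w y) * cden w y"
    "cnum (u @ w) y = cnum u (cfm w y) * cden w y" by auto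
qed

text \<open>The slope \<open>cden w 1 - qw w\<close> stands for the previous denominator
  \<open>q\<^sub>n\<^sub>-\<^sub>1\<close>, which the recursion from the left does not provide
  directly.\<close>

lemma cnum_cden_affine:
  "cden w y = qw w + y * (cden w 1 - qw w) \<and> cnum w y = cnum w 0 + y * (cnum w 1 - cnum w 0)"
proof (induction w)
  case (Cons a w)
  then have 1: "cden w y = qw w + y * (cden w 1 - qw w)"
    and 2: "cnum w y = cnum w 0 + y * (cnum w 1 - cnum w 0)" by auto
  show ?case by (simp only: cden.simps cnum.simps 1 2) (auto simp: algebra_simps)
qed auto

lemma cden_1_le:
  assumes "0 \<notin> set w"
  shows "qw w \<le> cden w 1" "cden w 1 \<le> 2 * qw w"
proof -
  \<comment> \<open>The numerators have to be carried along. Their doubling bound fails for the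
    empty word, where \<open>cnum [] 0 = 0\<close>; words of one letter therefore use
    \<open>real a \<ge> 1\<close> instead.\<close>
  have "qw w \<le> cden w 1 \<and> cnum w 0 \<le> cnum w 1 \<and> cden w 1 \<le> 2 * qw w \<and>
      (w \<noteq> [] \<longrightarrow> cnum w 1 \<le> 2 * cnum w 0)" using assms
  proof (induction w)
    case (Cons a w)
    have a: "real a \<ge> 1" using Cons.prems by auto
    have IH: "qw w \<le> cden w 1" "cnum w 0 \<le> cnum w 1" "cden w 1 \<le> 2 * qw w"
      "w \<noteq> [] \<Longrightarrow> cnum w 1 \<le> 2 * cnum w 0" using Cons by auto
    have m: "real a * qw w \<le> real a * cden w 1" using IH(1) by (intro mult_left_mono) auto
    have m2: "real a * cden w 1 \<le> 2 * (real a * qw w)" using mult_left_mono[OF IH(3), of "real a"] by simp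
    have "qw (a # w) \<le> cden (a # w) 1" using m IH(2) by (simp only: cden.simps)
    moreover have "cden (a # w) 1 \<le> 2 * qw (a # w)"
    proof (cases "w = []")
      case False
      then show ?thesis using m2 IH(4) by (simp add: algebra_simps)
    qed (use a in simp)
    ultimately show ?case using IH(1,3) by (simp only: cnum.simps) simp
  qed simp
  then show "qw w \<le> cden w 1" "cden w 1 \<le> 2 * qw w" by auto
qed

lemma cden_bounds:
  assumes "0 \<notin> set w" "0 \<le> y" "y \<le> 1"
  shows "qw w \<le> cden w y" "cden w y \<le> 2 * qw w"
proof -
  have e: "cden w y = qw w + y * (cden w 1 - qw w)" using cnum_cden_affine by blast
  have "y * (cden w 1 - qw w) \<le> 1 * (cden w 1 - qw w)"
    using assms cden_1_le[OF assms(1)] by (intro mult_right_mono) auto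
  moreover have "0 \<le> y * (cden w 1 - qw w)" using assms cden_1_le[OF assms(1)] by simp
  ultimately show "qw w \<le> cden w y" "cden w y \<le> 2 * qw w"
    using e cden_1_le[OF assms(1)] by auto
qed

text \<open>Quasi-multiplicativity: by the chain rule the quotient by \<open>qw w\<close> is
  \<open>cden u\<close> at a point of the unit interval, where \<open>cden u\<close> varies by a
  factor of at most 2. The lower bound makes sums over words submultiplicative; the upper bound
  limits the loss at each junction of the Cantor construction.\<close>

lemma qw_append:
  assumes "0 \<notin> set u" "0 \<notin> set w"
  shows "qw u * qw w \<le> qw (u @ w)" "qw (u @ w) \<le> 2 * qw u * qw w"
proof -
  have e: "qw (u @ w) = cden u (cfm w 0) * qw w" using cnum_cden_append(1)[OF assms(2)] by simp
  have c: "0 \<le> cfm w 0" "cfm w 0 \<le> 1" using cfm_nonneg cfm_le_1[OF assms(2)] by auto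
  have "0 < qw w" using cden_pos assms by simp
  then show "qw u * qw w \<le> qw (u @ w)" "qw (u @ w) \<le> 2 * qw u * qw w"
    unfolding e using cden_bounds[OF assms(1) c] by (auto intro: mult_right_mono)
qed

text \<open>An exact form of the mean value theorem, available because branches are Moebius maps of
  determinant 1 or -1.\<close>

lemma cfm_diff:
  assumes "0 \<notin> set w" "0 \<le> y" "0 \<le> z"
  shows "\<bar>cfm w y - cfm w z\<bar> = \<bar>y - z\<bar> / (cden w y * cden w z)"
  using assms
proof (induction w)
  case (Cons a w)
  define s where "s = real a + cfm w y"
  define t where "t = real a + cfm w z"
  have a: "real a \<ge> 1" and w: "0 \<notin> set w" using Cons.prems by auto
  have s0: "0 < s" "0 < t" using a cfm_nonneg[of y w] cfm_nonneg[of z w] Cons.prems by (auto simp: s_def t_def)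
  have d: "cden (a # w) y = s * cden w y" "cden (a # w) z = t * cden w z"
    using cfm_eq[OF w, of y] cfm_eq[OF w, of z] cden_pos[OF w, of y] cden_pos[OF w, of z] Cons.prems
    by (auto simp: s_def t_def field_simps)
  have "cfm (a # w) y - cfm (a # w) z = (t - s) / (s * t)"
    using s0 by (simp add: s_def t_def field_simps)
  then have "\<bar>cfm (a # w) y - cfm (a # w) z\<bar> = \<bar>t - s\<bar> / (s * t)"
    using s0 by (simp add: abs_mult)
  also have "\<bar>t - s\<bar> = \<bar>y - z\<bar> / (cden w y * cden w z)"
    using Cons by (simp add: s_def t_def abs_minus_commute)
  finally show ?case unfolding d by (simp add: field_simps)
qed simp

lemma cfm_diff_le:
  assumes "0 \<notin> set w" "0 \<le> y" "y \<le> 1" "0 \<le> z" "z \<le> 1"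
  shows "\<bar>cfm w y - cfm w z\<bar> \<le> 1 / qw w ^ 2"
    and "\<bar>y - z\<bar> / (4 * qw w ^ 2) \<le> \<bar>cfm w y - cfm w z\<bar>"
proof -
  have p: "0 < qw w" using cden_pos assms by simp
  have b: "qw w * qw w \<le> cden w y * cden w z" "cden w y * cden w z \<le> (2 * qw w) * (2 * qw w)"
    using cden_bounds[OF assms(1-3)] cden_bounds[OF assms(1,4,5)] p by (intro mult_mono; simp)+
  have "0 < cden w y * cden w z" using assms cden_pos by simp
  then show "\<bar>cfm w y - cfm w z\<bar> \<le> 1 / qw w ^ 2" 
    unfolding cfm_diff[OF assms(1,2,4)] using b p assms
    by (intro frac_le) (auto simp: power2_eq_square)
  show "\<bar>y - z\<bar> / (4 * qw w ^ 2) \<le> \<bar>cfm w y - cfm w z\<bar>"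
    unfolding cfm_diff[OF assms(1,2,4)] using b p \<open>0 < cden w y * cden w z\<close>
    by (intro frac_le) (auto simp: power2_eq_square)
qed

section \<open>Growth of denominators and the golden ratio\<close>

definition golden :: real where "golden = (sqrt 5 + 1) / 2"

lemma golden_gt_1: "1 < golden" and golden_sq: "golden ^ 2 = golden + 1"
proof -
  have "1 < sqrt (5::real)" by simp
  then show "1 < golden" by (simp add: golden_def)
  show "golden ^ 2 = golden + 1" by (simp add: golden_def power2_eq_square field_simps)
qed

lemma golden_powr_add: "golden powr (t + 2) = golden powr (t + 1) + golden powr t"
proof -
  have "golden powr (t + 2) = golden powr t * golden ^ 2"
    using golden_gt_1 by (simp add: powr_add)
  also have "\<dots> = golden powr (t + 1) + golden powr t"
    using golden_gt_1 unfolding golden_sq by (simp add: powr_add algebra_simps)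
  finally show ?thesis .
qed

text \<open>Powers of \<open>golden\<close> satisfy the Fibonacci recursion, and denominators grow
  at least that fast. The shift by 1 makes both base cases true; \<open>powr\<close> is used because
  the exponent is -1 for the empty word.\<close>

lemma qw_ge_golden:
  assumes "0 \<notin> set w"
  shows "golden powr (real (length w) - 1) \<le> qw w"
  using assms
proof (induction w rule: induct_list012)
  case 1
  have "golden powr (-1) \<le> golden powr 0" using golden_gt_1 by (intro powr_mono) auto
  then show ?case using golden_gt_1 by simp
next
  case (2 a)
  then show ?case using golden_gt_1 by auto
next
  case (3 a b w)
  have a: "real a \<ge> 1" using 3 by auto
  have "golden powr (real (length (a # b # w)) - 1) = golden powr ((real (length w) - 1) + 2)"
    by (simp add: algebra_simps)
  also have "\<dots> = golden powr (real (length (b # w)) - 1) + golden powr (real (length w) - 1)"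
    unfolding golden_powr_add by (simp add: algebra_simps)
  also have "\<dots> \<le> qw (b # w) + qw w" using 3 by (intro add_mono) auto
  also have "qw (b # w) \<le> real a * qw (b # w)"
    using a mult_right_mono[of 1 "real a" "qw (b # w)"] cnum_cden_ge(1)[of "b # w" 0] 3 by auto
  finally show ?case by simp
qed

text \<open>Splitting off one letter keeps the factor \<open>d\<close> at the cost of one power of
  \<open>golden\<close>. Without that factor the sum over the possible digits of a run would
  diverge.\<close>

lemma qw_replicate_ge:
  assumes "1 \<le> d" "1 \<le> l"
  shows "real d * golden powr (real l - 2) \<le> qw (replicate l d)"
proof -
  obtain m where m: "l = Suc m" using assms by (cases l) auto
  have "real d * golden powr (real l - 2) \<le> qw [d] * qw (replicate m d)"
    using qw_ge_golden[of "replicate m d"] assms m by (auto intro!: mult_left_mono)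
  also have "\<dots> \<le> qw ([d] @ replicate m d)" using assms by (intro qw_append) auto
  finally show ?thesis by (simp add: m)
qed

text \<open>Ones attain the minimal growth rate of \<open>qw_ge_golden\<close>, hence they are the
  digits to use for the long runs of the Cantor set.\<close>

lemma qw_ones_le: "qw (replicate l 1) \<le> golden ^ l"
proof (induction l rule: induct_nat_012)
  case 1
  then show ?case using golden_gt_1 by simp
next
  case (ge2 n)
  have "qw (replicate (Suc (Suc n)) 1) = qw (replicate (Suc n) 1) + qw (replicate n 1)" by simp
  also have "\<dots> \<le> golden ^ Suc n + golden ^ n" using ge2 by (intro add_mono)
  also have "\<dots> = golden ^ n * (golden + 1)" by (simp add: algebra_simps)
  also have "\<dots> = golden ^ n * golden ^ 2" by (simp only: golden_sq)
  also have "\<dots> = golden ^ Suc (Suc n)" by (simp add: power2_eq_square)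
  finally show ?case .
qed simp

lemma qw_le:
  assumes "0 \<notin> set w" "\<And>a. a \<in> set w \<Longrightarrow> a \<le> M"
  shows "qw w \<le> (real M + 1) ^ length w"
  using assms
proof (induction w)
  case (Cons a w)
  have w: "0 \<notin> set w" using Cons by auto
  have "cnum w 0 \<le> qw w"
    using cfm_eq[OF w, of 0] cfm_le_1[OF w, of 0] cden_pos[OF w, of 0] by (simp add: field_simps)
  moreover have "real a * qw w \<le> real M * qw w"
    using Cons.prems cden_pos[OF w, of 0] by (intro mult_right_mono) auto
  ultimately have "qw (a # w) \<le> (real M + 1) * qw w" by (simp add: algebra_simps)
  also have "\<dots> \<le> (real M + 1) * (real M + 1) ^ length w" using Cons by (intro mult_left_mono) auto
  finally show ?case by simp
qed simp

text \<open>\<open>cf_denom\<close> recurses from the right and \<open>cden\<close> from the left.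
  The affine form in the last letter (\<open>snoc\<close>) translates between them; the induction
  carries the previous denominator as \<open>cden w 1 - qw w\<close>.\<close>

lemma cf_denom_eq:
  assumes "\<And>k. k \<ge> 1 \<Longrightarrow> k \<le> n \<Longrightarrow> a k \<ge> 1"
  shows "real (cf_denom a n) = qw (map a [1..<Suc n])"
proof -
  have snoc: "cden (w @ [b]) y = (real b + y) * qw w + (cden w 1 - qw w)"
    if "1 \<le> b" "0 \<le> y" for w b y
  proof -
    have "cden (w @ [b]) y = cden w (1 / (real b + y)) * (real b + y)"
      using cnum_cden_append(1)[of "[b]" y w] that by simp
    then show ?thesis using cnum_cden_affine[of w "1 / (real b + y)"] that by (simp add: field_simps)
  qed
  have "real (cf_denom a n) = qw (map a [1..<Suc n]) \<and>
      (n \<ge> 1 \<longrightarrow> real (cf_denom a (n - 1)) = cden (map a [1..<Suc n]) 1 - qw (map a [1..<Suc n]))"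
    using assms
  proof (induction a n rule: cf_denom.induct)
    case (3 a k)
    have u: "map a [1..<Suc (Suc (Suc k))] = map a [1..<Suc (Suc k)] @ [a (Suc (Suc k))]"
      by simp
    have IH: "real (cf_denom a (Suc k)) = qw (map a [1..<Suc (Suc k)])"
       "real (cf_denom a k) = cden (map a [1..<Suc (Suc k)]) 1 - qw (map a [1..<Suc (Suc k)])"
      using 3 by auto
    have "1 \<le> a (Suc (Suc k))" using 3 by simp
    then show ?case unfolding u using IH by (simp add: snoc del: upt_Suc) (simp add: algebra_simps)
  qed auto
  then show ?thesis by blast
qed

section \<open>Digits of irrational numbers as words\<close>

definition cf_prefix :: "nat \<Rightarrow> real \<Rightarrow> nat list" where
  "cf_prefix n x = map (\<lambda>i. cf_digit (Suc i) x) [0..<n]"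

lemma length_cf_prefix [simp]: "length (cf_prefix n x) = n"
  by (simp add: cf_prefix_def)

lemma nth_cf_prefix: "i < n \<Longrightarrow> cf_prefix n x ! i = cf_digit (Suc i) x"
  by (simp add: cf_prefix_def)

lemma gauss_funpow_irrational:
  assumes "x \<in> {0..<1}" "x \<notin> \<rat>"
  shows "(gauss_map ^^ n) x \<in> {0..<1}" "(gauss_map ^^ n) x \<notin> \<rat>"
proof -
  have "(gauss_map ^^ n) x \<in> {0..<1} \<and> (gauss_map ^^ n) x \<notin> \<rat>"
    using assms gauss_map_irrational by (induction n) auto
  then show "(gauss_map ^^ n) x \<in> {0..<1}" "(gauss_map ^^ n) x \<notin> \<rat>" by auto
qed

lemma cf_prefix_pos:
  assumes "x \<in> {0..<1}" "x \<notin> \<rat>"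
  shows "0 \<notin> set (cf_prefix n x)"
proof
  assume "0 \<in> set (cf_prefix n x)"
  then obtain i where "cf_digit (Suc i) x = 0" by (auto simp: cf_prefix_def)
  then show False using cf_digit_ge_1[OF assms, of "Suc i"] by simp
qed

lemma cf_prefix_cfm:
  assumes "x \<in> {0..<1}" "x \<notin> \<rat>"
  shows "x = cfm (cf_prefix n x) ((gauss_map ^^ n) x)"
  using assms
proof (induction n arbitrary: x)
  case (Suc n)
  note g = gauss_map_irrational[OF Suc.prems]
  have "cf_prefix (Suc n) x = cf_digit 1 x # cf_prefix n (gauss_map x)"
    unfolding cf_prefix_def by (simp only: upt_conv_Cons[OF zero_less_Suc] map_Suc_upt[symmetric] list.map map_map) (simp add: o_def cf_digit_Suc)
  then show ?case using Suc.IH[OF g(1,2)] g(4) by (simp add: funpow_swap1)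
qed (simp add: cf_prefix_def)

lemma cf_prefix_dist:
  assumes "x \<in> {0..<1}" "x \<notin> \<rat>" "y \<in> {0..<1}" "y \<notin> \<rat>"
    and "cf_prefix n x = w" "cf_prefix n y = w"
  shows "\<bar>x - y\<bar> \<le> 1 / qw w ^ 2"
proof -
  let ?u = "(gauss_map ^^ n) x" and ?v = "(gauss_map ^^ n) y"
  have "\<bar>cfm w ?u - cfm w ?v\<bar> \<le> 1 / qw w ^ 2"
    using gauss_funpow_irrational[OF assms(1,2), of n] gauss_funpow_irrational[OF assms(3,4), of n]
      cf_prefix_pos[OF assms(1,2), of n] assms(5) by (intro cfm_diff_le) auto
  then show ?thesis
    using cf_prefix_cfm[OF assms(1,2), of n] cf_prefix_cfm[OF assms(3,4), of n] assms(5,6) by simp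
qed

lemma cf_digits_inj:
  assumes "x \<in> {0..<1}" "x \<notin> \<rat>" "y \<in> {0..<1}" "y \<notin> \<rat>"
    and "\<And>n. n \<ge> 1 \<Longrightarrow> cf_digit n x = cf_digit n y"
  shows "x = y"
proof -
  have "cf_value (\<lambda>k. cf_digit k x) \<longlonglongrightarrow> x" "cf_value (\<lambda>k. cf_digit k x) \<longlonglongrightarrow> y"
    using cf_expansion_iff[OF assms(1,2), of "\<lambda>k. cf_digit k x"]
      cf_expansion_iff[OF assms(3,4), of "\<lambda>k. cf_digit k x"] assms(5) by auto
  then show ?thesis by (rule LIMSEQ_unique)
qed

text \<open>Infinite descent: on a fraction \<open>p / q\<close> the Gauss map performs a step of
  the Euclidean algorithm and gives \<open>(q mod p) / p\<close>, with a smaller denominator. A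
  rational orbit would thus hit 0.\<close>

lemma gauss_orbit_irrational:
  assumes "\<And>n. 0 < (gauss_map ^^ n) x" "x < 1"
  shows "x \<notin> \<rat>"
proof -
  have *: "\<not> (real p / real q = x \<and> 0 < q \<and> x < 1 \<and> (\<forall>n. 0 < (gauss_map ^^ n) x))" for p q x
  proof (induction q arbitrary: p x rule: less_induct)
    case (less q)
    show ?case
    proof
      assume A: "real p / real q = x \<and> 0 < q \<and> x < 1 \<and> (\<forall>n. 0 < (gauss_map ^^ n) x)"
      then have p: "p < q" "0 < p"
        using spec[OF conjunct2[OF conjunct2[OF conjunct2[OF A]]], of 0] by (auto simp: field_simps zero_less_divide_iff)
      have "gauss_map x = frac (real q / real p)" using A by (auto simp: gauss_map_def)
      also have "\<dots> = real (q mod p) / real p"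
      proof -
        have e: "real (q mod p) + real p * real (q div p) = real q"
          using arg_cong[OF mod_mult_div_eq[of q p], of real] by (simp only: of_nat_add of_nat_mult)
        have "real (q mod p) / real p + real (q div p) = (real (q mod p) + real p * real (q div p)) / real p"
          using p by (simp add: add_divide_distrib)
        then have "real q / real p = real (q mod p) / real p + real (q div p)"
          by (simp only: e)
        moreover have "\<lfloor>real q / real p\<rfloor> = int (q div p)" by (rule floor_divide_of_nat_eq)
        ultimately show ?thesis by (simp add: frac_def)
      qed
      finally have e: "real (q mod p) / real p = gauss_map x" by simp
      have "0 < (gauss_map ^^ n) (gauss_map x)" for n
        using A by (metis funpow_swap1 funpow_simps_right(2) o_apply)
      moreover have "gauss_map x < 1" by (simp add: gauss_map_def frac_lt_1)
      ultimately show False using less[OF p(1), of "q mod p" "gauss_map x"] e p by auto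
    qed
  qed
  show ?thesis
  proof
    assume "x \<in> \<rat>"
    then obtain a b :: int where ab: "x = of_int a / of_int b" "0 < b"
      by (metis Rats_cases')
    have "0 < x" using assms(1)[of 0] by simp
    then have "0 < a" using ab by (simp add: zero_less_divide_iff)
    then have "x = real (nat a) / real (nat b)" using ab by simp
    moreover have "0 < nat b" using ab(2) by simp
    ultimately show False using *[of "nat a" "nat b" x] assms by metis
  qed
qed

text \<open>The values \<open>X j\<close> of all shifted expansions are constructed at once. The
  relation \<open>rec\<close> between consecutive ones shows that they form the Gauss orbit of
  \<open>X 0\<close>, so digits and irrationality can be read off.\<close>

lemma cf_exists:
  assumes pos: "\<And>n. n \<ge> 1 \<Longrightarrow> a n \<ge> 1"
  obtains x where "x \<in> {0..<1}" "x \<notin> \<rat>" "\<And>n. n \<ge> 1 \<Longrightarrow> cf_digit n x = a n"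
proof -
  define sh where "sh j = (\<lambda>k. a (j + k))" for j
  have sp: "sh j n \<ge> 1" if "n \<ge> 1" for j n using pos that by (simp add: sh_def)
  have cv: "cf_value b n = cfm (map b [1..<Suc n]) 0" for b n
  proof (induction n arbitrary: b)
    case (Suc n)
    have "map b [1..<Suc (Suc n)] = b 1 # map (\<lambda>k. b (Suc k)) [1..<Suc n]"
      by (simp only: map_Suc_upt[symmetric] upt_conv_Cons list.map map_map) (simp add: o_def map_Suc_upt[symmetric] del: upt_Suc)
    then show ?case using Suc[of "\<lambda>k. b (Suc k)"] by simp
  qed simp
  have conv: "convergent (cf_value (sh j))" for j
  proof -
    have d: "dist (cf_value (sh j) n) (cf_value (sh j) m) \<le> 1 / (golden powr (real n - 1)) ^ 2" if "n \<le> m" for n m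
    proof -
      let ?w = "map (sh j) [1..<Suc n]" and ?v = "map (sh j) [Suc n..<Suc m]"
      have nz: "0 = sh j k \<longleftrightarrow> False" if "Suc 0 \<le> k" for k using sp[of k j] that by simp
      have w: "0 \<notin> set ?w" "0 \<notin> set ?v" using nz by (auto simp del: upt_Suc simp: image_iff)
      have "map (sh j) [1..<Suc m] = ?w @ ?v"
        using that upt_add_eq_append[of 1 "Suc n" "m - n"] by (simp del: upt_Suc)
      then have "dist (cf_value (sh j) n) (cf_value (sh j) m) = \<bar>cfm ?w 0 - cfm ?w (cfm ?v 0)\<bar>"
        by (simp add: cv cfm_append dist_real_def del: upt_Suc)
      also have "\<dots> \<le> 1 / qw ?w ^ 2"
        using w cfm_le_1[OF w(2), of 0] cfm_nonneg[of 0 ?v] by (intro cfm_diff_le(1)) auto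
      also have "\<dots> \<le> 1 / (golden powr (real n - 1)) ^ 2"
        using qw_ge_golden[OF w(1)] golden_gt_1
        by (intro frac_le power_mono) (simp_all del: upt_Suc)
      finally show ?thesis .
    qed
    have "(\<lambda>n. 1 / (golden powr (real n - 1)) ^ 2) = (\<lambda>n. golden ^ 2 * (1 / golden ^ 2) ^ n)"
      using golden_gt_1 by (intro ext) (simp add: powr_diff powr_realpow field_simps flip: power_mult)
    moreover have "(\<lambda>n. golden ^ 2 * (1 / golden ^ 2) ^ n) \<longlonglongrightarrow> 0"
      using golden_gt_1 by (intro tendsto_mult_right_zero LIMSEQ_power_zero) (simp add: golden_sq)
    ultimately have lim: "(\<lambda>n. 1 / (golden powr (real n - 1)) ^ 2) \<longlonglongrightarrow> 0" by simp
    have "Cauchy (cf_value (sh j))"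
    proof (rule metric_CauchyI)
      fix e :: real assume "0 < e"
      then obtain N where N: "1 / (golden powr (real N - 1)) ^ 2 < e / 2"
        using order_tendstoD(2)[OF lim, of "e / 2"] by (auto simp: eventually_sequentially)
      have "dist (cf_value (sh j) m) (cf_value (sh j) n) < e" if "m \<ge> N" "n \<ge> N" for m n
        using d[OF that(1)] d[OF that(2)] N dist_triangle_half_r[of "cf_value (sh j) N"]
        by (meson le_less_trans)
      then show "\<exists>M. \<forall>m\<ge>M. \<forall>n\<ge>M. dist (cf_value (sh j) m) (cf_value (sh j) n) < e" by blast
    qed
    then show ?thesis by (rule Cauchy_convergent)
  qed
  define X where "X j = lim (cf_value (sh j))" for j
  have X: "cf_value (sh j) \<longlonglongrightarrow> X j" for j using conv by (simp add: X_def convergent_LIMSEQ_iff)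
  have X01: "0 \<le> X j" "X j \<le> 1" for j
    using cf_value_bounds[of "sh j"] sp[of _ j]
    by (auto intro!: LIMSEQ_le_const[OF X[of j]] LIMSEQ_le_const2[OF X[of j]])
  have rec: "X j = 1 / (real (a (Suc j)) + X (Suc j))" for j
  proof -
    have a1: "real (a (Suc j)) \<ge> 1" using pos[of "Suc j"] by simp
    have "(\<lambda>n. cf_value (sh j) (Suc n)) = (\<lambda>n. 1 / (real (a (Suc j)) + cf_value (sh (Suc j)) n))"
      by (simp add: sh_def)
    moreover have "\<dots> \<longlonglongrightarrow> 1 / (real (a (Suc j)) + X (Suc j))"
      using a1 X01(1)[of "Suc j"] by (intro tendsto_intros X) auto
    ultimately show ?thesis using LIMSEQ_unique[OF LIMSEQ_Suc[OF X[of j]]] by simp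
  qed
  have X0: "0 < X j" for j unfolding rec[of j] using pos[of "Suc j"] X01(1)[of "Suc j"] by (simp add: add_pos_nonneg)
  have X1: "X j < 1" for j
  proof -
    have "real (a (Suc j)) \<ge> 1" using pos[of "Suc j"] by simp
    then show ?thesis unfolding rec[of j] using X0[of "Suc j"] by simp
  qed
  have inv: "1 / X j = real (a (Suc j)) + X (Suc j)" for j using rec[of j] by simp
  have fl: "\<lfloor>1 / X j\<rfloor> = int (a (Suc j))" for j
    unfolding inv using X01(1)[of "Suc j"] X1[of "Suc j"] by (intro floor_unique) auto
  have g: "gauss_map (X j) = X (Suc j)" for j
    using fl[of j] inv[of j] by (simp add: gauss_map_def frac_def)
  have gn: "(gauss_map ^^ n) (X 0) = X n" for n by (induction n) (simp_all add: g)
  have "X 0 \<notin> \<rat>" using X0 X1 by (intro gauss_orbit_irrational) (auto simp: gn)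
  moreover have "cf_digit n (X 0) = a n" if "n \<ge> 1" for n
    using that fl[of "n - 1"] by (simp add: cf_digit_def gn)
  ultimately show ?thesis using X0[of 0] X1[of 0] by (intro that[of "X 0"]) auto
qed

subsection \<open>Sums over words and Hausdorff measure\<close>

lemma nn_integral_count_space_point:
  "f x \<le> (\<integral>\<^sup>+ y. f y \<partial>count_space UNIV)"
proof -
  have "f x = (\<integral>\<^sup>+ y. f x * indicator {x} y \<partial>count_space UNIV)"
    by (subst nn_integral_cmult_indicator) (auto simp: emeasure_count_space)
  also have "\<dots> \<le> (\<integral>\<^sup>+ y. f y \<partial>count_space UNIV)"
    by (intro nn_integral_mono) (auto simp: indicator_def)
  finally show ?thesis .
qed

text \<open>Covers in the definition of Hausdorff measure are indexed by \<open>nat\<close>, those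
  of the proof by words. Numbers that encode no word contribute 0.\<close>

lemma nn_integral_count_space_countable:
  fixes f :: "'i::countable \<Rightarrow> ennreal"
  shows "(\<integral>\<^sup>+ x. f x \<partial>count_space UNIV) =
    (\<Sum>n. if n \<in> range (to_nat :: 'i \<Rightarrow> nat) then f (from_nat n) else 0)"
proof -
  have "(\<integral>\<^sup>+ x. f x \<partial>count_space UNIV) = (\<integral>\<^sup>+ x. f (from_nat (to_nat x)) \<partial>count_space (UNIV :: 'i set))"
    by simp
  also have "\<dots> = (\<integral>\<^sup>+ n. f (from_nat n) \<partial>count_space (range (to_nat :: 'i \<Rightarrow> nat)))"
    by (rule nn_integral_bij_count_space[where f = "\<lambda>n. f (from_nat n)"])
       (simp add: bij_betw_def)
  also have "\<dots> = (\<integral>\<^sup>+ n. (if n \<in> range (to_nat :: 'i \<Rightarrow> nat) then f (from_nat n) else 0) \<partial>count_space UNIV)"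
    by (subst nn_integral_count_space_indicator) (auto intro!: nn_integral_cong simp: indicator_def)
  also have "\<dots> = (\<Sum>n. if n \<in> range (to_nat :: 'i \<Rightarrow> nat) then f (from_nat n) else 0)"
    by (rule nn_integral_count_space_nat)
  finally show ?thesis .
qed

text \<open>Integrals against counting measure give access to Fubini and to monotone convergence for
  the sums in \<open>s_pre\<close>.\<close>

lemma infsum_ennreal_eq_nn_integral:
  fixes f :: "'i::countable \<Rightarrow> ennreal"
  shows "infsum f UNIV = (\<integral>\<^sup>+ x. f x \<partial>count_space UNIV)"
proof (rule antisym)
  have S: "infsum f UNIV = (SUP F\<in>{F. finite F \<and> F \<subseteq> UNIV}. sum f F)"
    by (rule nonneg_infsum_complete) simp
  show "infsum f UNIV \<le> (\<integral>\<^sup>+ x. f x \<partial>count_space UNIV)"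
    unfolding S
  proof (rule SUP_least)
    fix F :: "'i set" assume "F \<in> {F. finite F \<and> F \<subseteq> UNIV}"
    then have F: "finite F" by simp
    have "sum f F = (\<integral>\<^sup>+ x. f x \<partial>count_space F)" using F by (simp add: nn_integral_count_space_finite)
    also have "\<dots> \<le> (\<integral>\<^sup>+ x. f x \<partial>count_space UNIV)"
      by (subst nn_integral_count_space_indicator)
         (auto intro!: nn_integral_mono simp: indicator_def)
    finally show "sum f F \<le> (\<integral>\<^sup>+ x. f x \<partial>count_space UNIV)" .
  qed
  let ?R = "range (to_nat :: 'i \<Rightarrow> nat)"
  show "(\<integral>\<^sup>+ x. f x \<partial>count_space UNIV) \<le> infsum f UNIV"
    unfolding nn_integral_count_space_countable suminf_eq_SUP S
  proof (rule SUP_least)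
    fix N :: nat
    have "(\<Sum>n<N. if n \<in> ?R then f (from_nat n) else 0) = (\<Sum>n\<in>{..<N} \<inter> ?R. f (from_nat n))"
      by (simp add: sum.inter_restrict)
    also have "\<dots> = sum f (from_nat ` ({..<N} \<inter> ?R))"
      by (subst sum.reindex) (auto simp: inj_on_def)
    also have "\<dots> \<le> (SUP F\<in>{F. finite F \<and> F \<subseteq> UNIV}. sum f F)"
      by (rule SUP_upper) auto
    finally show "(\<Sum>n<N. if n \<in> ?R then f (from_nat n) else 0) \<le> (SUP F\<in>{F. finite F \<and> F \<subseteq> UNIV}. sum f F)" .
  qed
qed

lemma nn_integral_list_Cons:
  fixes f :: "'a list \<Rightarrow> ennreal"
  shows "(\<integral>\<^sup>+ D. f D \<partial>count_space UNIV) =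
    f [] + (\<integral>\<^sup>+ x. \<integral>\<^sup>+ D. f (x # D) \<partial>count_space UNIV \<partial>count_space UNIV)"
proof -
  have bij: "bij_betw (\<lambda>(x, D). x # D) UNIV (- {[] :: 'a list})"
  proof (rule bij_betwI')
    fix y :: "'a list" assume "y \<in> - {[]}"
    then show "\<exists>x\<in>UNIV. y = (case x of (x, D) \<Rightarrow> x # D)" by (cases y) auto
  qed auto
  have "(\<integral>\<^sup>+ D. f D \<partial>count_space UNIV) = (\<integral>\<^sup>+ D. f [] * indicator {[]} D + f D * indicator (- {[]}) D \<partial>count_space UNIV)"
    by (intro nn_integral_cong) (auto simp: indicator_def)
  also have "\<dots> = (\<integral>\<^sup>+ D. f [] * indicator {[] :: 'a list} D \<partial>count_space UNIV) + (\<integral>\<^sup>+ D. f D * indicator (- {[]}) D \<partial>count_space UNIV)"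
    by (rule nn_integral_add) auto
  also have "(\<integral>\<^sup>+ D. f [] * indicator {[] :: 'a list} D \<partial>count_space UNIV) = f []"
    by (subst nn_integral_cmult_indicator) (auto simp: emeasure_count_space)
  also have "(\<integral>\<^sup>+ D. f D * indicator (- {[]}) D \<partial>count_space UNIV) = (\<integral>\<^sup>+ D. f D \<partial>count_space (- {[]}))"
    by (simp add: nn_integral_count_space_indicator)
  also have "\<dots> = (\<integral>\<^sup>+ z. f (case z of (x, D) \<Rightarrow> x # D) \<partial>count_space UNIV)"
    by (rule nn_integral_bij_count_space[OF bij, symmetric])
  also have "\<dots> = (\<integral>\<^sup>+ x. \<integral>\<^sup>+ D. f (x # D) \<partial>count_space UNIV \<partial>count_space UNIV)"
    using nn_integral_fst_count_space[of "\<lambda>z. f (case z of (x, D) \<Rightarrow> x # D)"] by simp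
  finally show ?thesis .
qed

lemma nn_integral_list_append:
  fixes f :: "'a list \<Rightarrow> ennreal"
  shows "(\<integral>\<^sup>+ D. (if length D = m + n then f D else 0) \<partial>count_space UNIV) =
    (\<integral>\<^sup>+ u. (\<integral>\<^sup>+ v. (if length u = m \<and> length v = n then f (u @ v) else 0) \<partial>count_space UNIV) \<partial>count_space UNIV)"
proof (induction m arbitrary: f)
  case 0
  have "(\<integral>\<^sup>+ u. (\<integral>\<^sup>+ v. (if length u = 0 \<and> length v = n then f (u @ v) else 0) \<partial>count_space UNIV) \<partial>count_space UNIV)
    = (\<integral>\<^sup>+ u. (\<integral>\<^sup>+ v. (if length v = n then f v else 0) \<partial>count_space UNIV) * indicator {[] :: 'a list} u \<partial>count_space UNIV)"
    by (intro nn_integral_cong) (auto simp: indicator_def cong: if_cong)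
  also have "\<dots> = (\<integral>\<^sup>+ v. (if length v = n then f v else 0) \<partial>count_space UNIV)"
    by (subst nn_integral_cmult_indicator) (auto simp: emeasure_count_space)
  finally show ?case by simp
next
  case (Suc m)
  show ?case
    by (subst nn_integral_list_Cons, subst (2) nn_integral_list_Cons) (simp add: Suc[of "\<lambda>D. f (_ # D)"] cong: if_cong)
qed

lemma nn_integral_prod_list_length:
  fixes w :: "'a \<Rightarrow> ennreal"
  shows "(\<integral>\<^sup>+ D. (if length D = n then prod_list (map w D) else 0) \<partial>count_space UNIV) =
    (\<integral>\<^sup>+ x. w x \<partial>count_space UNIV) ^ n"
proof (induction n)
  case 0
  have "(\<integral>\<^sup>+ D. (if length D = 0 then prod_list (map w D) else 0) \<partial>count_space UNIV) =
     (\<integral>\<^sup>+ D. 1 * indicator {[] :: 'a list} D \<partial>count_space UNIV)"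
    by (intro nn_integral_cong) (auto simp: indicator_def)
  then show ?case by (subst (asm) nn_integral_cmult_indicator) (auto simp: emeasure_count_space)
next
  case (Suc n)
  have "(\<integral>\<^sup>+ D. (if length D = Suc n then prod_list (map w D) else 0) \<partial>count_space UNIV) =
    (\<integral>\<^sup>+ x. (\<integral>\<^sup>+ D. w x * (if length D = n then prod_list (map w D) else 0) \<partial>count_space UNIV) \<partial>count_space UNIV)"
    by (subst nn_integral_list_Cons) (auto intro!: nn_integral_cong)
  also have "\<dots> = (\<integral>\<^sup>+ x. w x \<partial>count_space UNIV) ^ Suc n"
    by (simp add: nn_integral_cmult nn_integral_multc Suc)
  finally show ?case .
qed

lemma nn_integral_lists_by_length:
  fixes f :: "'a list \<Rightarrow> ennreal"
  shows "(\<integral>\<^sup>+ D. f D \<partial>count_space UNIV) =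
    (\<Sum>n. \<integral>\<^sup>+ D. (if length D = n then f D else 0) \<partial>count_space UNIV)"
proof -
  have "f D = (\<Sum>n. if length D = n then f D else 0)" for D
    using sums_single[of "length D" "\<lambda>_. f D"] by (simp add: sums_iff eq_commute)
  then have "(\<integral>\<^sup>+ D. f D \<partial>count_space UNIV) = (\<integral>\<^sup>+ D. (\<Sum>n. if length D = n then f D else 0) \<partial>count_space UNIV)"
    by (intro nn_integral_cong)
  then show ?thesis by (simp add: nn_integral_suminf)
qed

text \<open>Grouping by length gives a geometric series. This will sum over all sequences of free
  words and runs, given a bound for one pair.\<close>

lemma nn_integral_prod_list:
  fixes w :: "'a \<Rightarrow> ennreal"
  assumes "(\<integral>\<^sup>+ x. w x \<partial>count_space UNIV) \<le> ennreal c" "0 \<le> c" "c < 1"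
  shows "(\<integral>\<^sup>+ D. prod_list (map w D) \<partial>count_space UNIV) \<le> ennreal (1 / (1 - c))"
proof -
  have "(\<integral>\<^sup>+ D. prod_list (map w D) \<partial>count_space UNIV) = (\<Sum>n. (\<integral>\<^sup>+ x. w x \<partial>count_space UNIV) ^ n)"
    by (subst nn_integral_lists_by_length) (simp add: nn_integral_prod_list_length)
  also have "\<dots> \<le> (\<Sum>n. ennreal c ^ n)"
    using assms(1) by (intro suminf_le power_mono) auto
  also have "\<dots> = (\<Sum>n. ennreal (c ^ n))" using assms by (simp add: ennreal_power)
  also have "\<dots> = ennreal (\<Sum>n. c ^ n)"
    using assms by (intro suminf_ennreal2) auto
  also have "(\<Sum>n. c ^ n) = 1 / (1 - c)" using assms by (intro suminf_geometric) auto
  finally show ?thesis .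
qed

section \<open>Hausdorff measure and dimension\<close>

lemma hausdorff_gauge_empty [simp]: "hausdorff_gauge s {} = 0"
  by (simp add: hausdorff_gauge_def)

lemma hausdorff_premeasure_le_cover:
  fixes B :: "'i::countable \<Rightarrow> 'a::metric_space set"
  assumes "A \<subseteq> (\<Union>i. B i)" "\<And>i. bounded (B i)" "\<And>i. diameter (B i) \<le> \<delta>" "0 \<le> \<delta>"
  shows "hausdorff_premeasure \<delta> s A \<le> (\<integral>\<^sup>+ i. hausdorff_gauge s (B i) \<partial>count_space UNIV)"
proof -
  let ?U = "\<lambda>n. if n \<in> range (to_nat :: 'i \<Rightarrow> nat) then B (from_nat n) else {}"
  have "A \<subseteq> (\<Union>n. ?U n)"
  proof
    fix x assume "x \<in> A"
    then obtain i where "x \<in> B i" using assms(1) by auto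
    then have "x \<in> ?U (to_nat i)" by simp
    then show "x \<in> (\<Union>n. ?U n)" by blast
  qed
  then have "hausdorff_premeasure \<delta> s A \<le> (\<Sum>n. hausdorff_gauge s (?U n))"
    unfolding hausdorff_premeasure_def using assms by (intro INF_lower) auto
  also have "\<dots> = (\<Sum>n. if n \<in> range (to_nat :: 'i \<Rightarrow> nat) then hausdorff_gauge s (B (from_nat n)) else 0)"
    by (intro suminf_cong) auto
  also have "\<dots> = (\<integral>\<^sup>+ i. hausdorff_gauge s (B i) \<partial>count_space UNIV)"
    by (rule nn_integral_count_space_countable[symmetric])
  finally show ?thesis .
qed

text \<open>Diameters need no separate control: if the whole sum is at most
  \<open>\<delta> powr s\<close> with positive \<open>s\<close>, every single diameter is at most
  \<delta>.\<close>

lemma hausdorff_measure_zeroI: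
  fixes A :: "'a::metric_space set"
  assumes s: "0 < s" and cov: "\<And>e :: real. 0 < e \<Longrightarrow> \<exists>B :: 'i::countable \<Rightarrow> 'a set.
      A \<subseteq> (\<Union>i. B i) \<and> (\<forall>i. bounded (B i)) \<and>
      (\<integral>\<^sup>+ i. hausdorff_gauge s (B i) \<partial>count_space UNIV) \<le> ennreal e"
  shows "hausdorff_measure s A = 0"
proof -
  have "hausdorff_premeasure \<delta> s A \<le> ennreal e" if "0 < \<delta>" "0 < e" for \<delta> e
  proof -
    have "0 < min e (\<delta> powr s)" using that by simp
    from cov[OF this] obtain B :: "'i \<Rightarrow> 'a set" where B: "A \<subseteq> (\<Union>i. B i)" "\<And>i. bounded (B i)"
      "(\<integral>\<^sup>+ i. hausdorff_gauge s (B i) \<partial>count_space UNIV) \<le> ennreal (min e (\<delta> powr s))" by blast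
    have "diameter (B i) \<le> \<delta>" for i
    proof (cases "B i = {}")
      case False
      have "ennreal (diameter (B i) powr s) \<le> ennreal (min e (\<delta> powr s))"
        using order_trans[OF nn_integral_count_space_point[of "\<lambda>i. hausdorff_gauge s (B i)" i] B(3)] False s
        by (simp add: hausdorff_gauge_def)
      then have "diameter (B i) powr s \<le> \<delta> powr s"
        using that by (simp add: ennreal_le_iff)
      then show ?thesis using powr_less_mono2[OF s, of \<delta> "diameter (B i)"] that by fastforce
    qed (use that in simp)
    then have "hausdorff_premeasure \<delta> s A \<le> (\<integral>\<^sup>+ i. hausdorff_gauge s (B i) \<partial>count_space UNIV)"
      using that by (intro hausdorff_premeasure_le_cover B) auto
    also have "\<dots> \<le> ennreal (min e (\<delta> powr s))" by (rule B(3))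
    also have "\<dots> \<le> ennreal e" by (intro ennreal_leI) simp
    finally show ?thesis .
  qed
  then have "hausdorff_premeasure \<delta> s A = 0" if "0 < \<delta>" for \<delta>
    using that ennreal_le_epsilon[of 0 "hausdorff_premeasure \<delta> s A"] by (metis add.left_neutral le_zero_eq)
  then show ?thesis by (simp add: hausdorff_measure_def)
qed

lemma hausdorff_dim_nonneg: "0 \<le> hausdorff_dim A"
  unfolding hausdorff_dim_def by (intro INF_greatest) auto

lemma hausdorff_dim_le: "0 \<le> s \<Longrightarrow> hausdorff_measure s A = 0 \<Longrightarrow> hausdorff_dim A \<le> ereal s"
  unfolding hausdorff_dim_def by (intro INF_lower) auto

lemma hausdorff_gauge_antimono:
  assumes "0 \<le> s" "s \<le> t" "bounded U" "diameter U \<le> 1"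
  shows "hausdorff_gauge t U \<le> hausdorff_gauge s U"
proof -
  have d: "0 \<le> diameter U" using assms by (intro diameter_ge_0)
  have "diameter U powr t \<le> diameter U powr s" if "0 < s"
    using powr_mono'[of s t "diameter U"] assms d that by simp
  moreover have "diameter U powr t \<le> 1" using powr_le1[of t "diameter U"] assms d by simp
  ultimately show ?thesis using assms by (auto simp: hausdorff_gauge_def intro: ennreal_leI)
qed

lemma hausdorff_measure_antimono:
  assumes "0 \<le> s" "s \<le> t"
  shows "hausdorff_measure t A \<le> hausdorff_measure s A"
  unfolding hausdorff_measure_def
proof (rule SUP_least)
  fix \<delta> :: real assume "\<delta> \<in> {0<..}"
  then have \<delta>: "0 < \<delta>" by simp
  have "hausdorff_premeasure \<delta> t A \<le> hausdorff_premeasure (min 1 \<delta>) s A"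
    unfolding hausdorff_premeasure_def
  proof (rule INF_greatest)
    fix U :: "nat \<Rightarrow> 'a set"
    assume U: "U \<in> {U. A \<subseteq> (\<Union>i. U i) \<and> (\<forall>i. bounded (U i) \<and> diameter (U i) \<le> min 1 \<delta>)}"
    have "(INF U\<in>{U. A \<subseteq> (\<Union>i. U i) \<and> (\<forall>i. bounded (U i) \<and> diameter (U i) \<le> \<delta>)}.
        \<Sum>i. hausdorff_gauge t (U i)) \<le> (\<Sum>i. hausdorff_gauge t (U i))"
      using U by (intro INF_lower) auto
    also have "\<dots> \<le> (\<Sum>i. hausdorff_gauge s (U i))"
      using U assms by (intro suminf_le hausdorff_gauge_antimono) auto
    finally show "(INF U\<in>{U. A \<subseteq> (\<Union>i. U i) \<and> (\<forall>i. bounded (U i) \<and> diameter (U i) \<le> \<delta>)}.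
        \<Sum>i. hausdorff_gauge t (U i)) \<le> (\<Sum>i. hausdorff_gauge s (U i))" .
  qed
  also have "\<dots> \<le> (SUP \<delta>\<in>{0<..}. hausdorff_premeasure \<delta> s A)"
    using \<delta> by (intro SUP_upper) auto
  finally show "hausdorff_premeasure \<delta> t A \<le> (SUP \<delta>\<in>{0<..}. hausdorff_premeasure \<delta> s A)" .
qed

lemma hausdorff_dim_ge:
  assumes "0 \<le> s" "hausdorff_measure s A \<noteq> 0"
  shows "ereal s \<le> hausdorff_dim A"
  unfolding hausdorff_dim_def
proof (rule INF_greatest)
  fix t assume t: "t \<in> {t. 0 \<le> t \<and> hausdorff_measure t A = 0}"
  show "ereal s \<le> ereal t"
  proof (rule ccontr)
    assume "\<not> ereal s \<le> ereal t"
    then have "t \<le> s" by simp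
    then show False using hausdorff_measure_antimono[of t s A] t assms by auto
  qed
qed

lemma hausdorff_dim_le_eps:
  assumes "0 \<le> d" "\<And>s. d < s \<Longrightarrow> hausdorff_measure s A = 0"
  shows "hausdorff_dim A \<le> ereal d"
proof (rule ereal_le_epsilon2)
  fix e :: real assume "0 < e"
  then show "hausdorff_dim A \<le> ereal d + ereal e"
    using hausdorff_dim_le[of "d + e" A] assms by simp
qed

lemma hausdorff_dim_countable:
  fixes A :: "'a::metric_space set"
  assumes "countable A"
  shows "hausdorff_dim A = 0"
proof -
  have "hausdorff_measure s A = 0" if s: "0 < s" for s
  proof (rule hausdorff_measure_zeroI[OF s, where 'i = nat])
    fix e :: real assume "0 < e"
    show "\<exists>B :: nat \<Rightarrow> 'a set. A \<subseteq> (\<Union>i. B i) \<and> (\<forall>i. bounded (B i)) \<and>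
      (\<integral>\<^sup>+ i. hausdorff_gauge s (B i) \<partial>count_space UNIV) \<le> ennreal e"
    proof (intro exI conjI allI)
      show "A \<subseteq> (\<Union>i. {from_nat_into A i})"
        using from_nat_into_surj[OF assms] by fastforce
      have "(\<integral>\<^sup>+ i. hausdorff_gauge s {from_nat_into A i} \<partial>count_space UNIV) = (\<integral>\<^sup>+ i. 0 \<partial>count_space (UNIV :: nat set))"
        using s by (intro nn_integral_cong) (simp add: hausdorff_gauge_def)
      then show "(\<integral>\<^sup>+ i. hausdorff_gauge s {from_nat_into A i} \<partial>count_space UNIV) \<le> ennreal e" by simp
    qed auto
  qed
  then have "hausdorff_dim A \<le> ereal 0" by (intro hausdorff_dim_le_eps) auto
  then show ?thesis using hausdorff_dim_nonneg[of A] by (intro antisym) (simp_all add: zero_ereal_def)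
qed

lemma hausdorff_dim_unit_interval:
  fixes A :: "real set"
  assumes "A \<subseteq> {0..<1}"
  shows "hausdorff_dim A \<le> 1"
proof -
  have "hausdorff_measure s A = 0" if s: "1 < s" for s
  proof (rule hausdorff_measure_zeroI[where 'i = nat])
    fix e :: real assume e: "0 < e"
    have "(\<lambda>n. real n powr (1 - s)) \<longlonglongrightarrow> 0"
      using s by (intro tendsto_neg_powr filterlim_real_sequentially) auto
    then have "eventually (\<lambda>n. real n powr (1 - s) < e) sequentially" using e by (rule order_tendstoD)
    then have "eventually (\<lambda>n. real n powr (1 - s) < e \<and> 0 < n) sequentially"
      using eventually_gt_at_top[of 0] by (rule eventually_conj)
    then obtain n where n: "real n powr (1 - s) < e" "0 < n"
      using eventually_happens'[OF sequentially_bot] by blast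
    let ?B = "\<lambda>i. if i < n then {real i / n .. (real i + 1) / n} else {}"
    show "\<exists>B :: nat \<Rightarrow> real set. A \<subseteq> (\<Union>i. B i) \<and> (\<forall>i. bounded (B i)) \<and>
      (\<integral>\<^sup>+ i. hausdorff_gauge s (B i) \<partial>count_space UNIV) \<le> ennreal e"
    proof (intro exI conjI allI)
      show "A \<subseteq> (\<Union>i. ?B i)"
      proof
        fix x assume "x \<in> A"
        then have x: "0 \<le> x" "x < 1" using assms by auto
        let ?i = "nat \<lfloor>x * n\<rfloor>"
        have fl: "0 \<le> \<lfloor>x * n\<rfloor>" "of_int \<lfloor>x * n\<rfloor> \<le> x * n" "x * n < of_int \<lfloor>x * n\<rfloor> + 1" "x * n < n"
          using x n by auto
        then have i: "real ?i \<le> x * n" "x * n < real ?i + 1" by auto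
        then have "?i < n" using fl(4) by linarith
        moreover have "x \<in> {real ?i / n .. (real ?i + 1) / n}" using i n by (auto simp: field_simps)
        ultimately show "x \<in> (\<Union>i. ?B i)" by auto
      qed
      show "bounded (?B i)" for i by auto
      have "(\<integral>\<^sup>+ i. hausdorff_gauge s (?B i) \<partial>count_space UNIV) = (\<Sum>i<n. hausdorff_gauge s (?B i))"
        by (subst nn_integral_count_space'[where A = "{..<n}"]) auto
      also have "\<dots> = (\<Sum>i<n. ennreal ((1 / real n) powr s))"
      proof (intro sum.cong refl)
        fix i assume "i \<in> {..<n}"
        moreover have "real i / n \<le> (real i + 1) / n" by (intro divide_right_mono) auto
        moreover have "(real i + 1) / n - real i / n = 1 / n" by (simp add: diff_divide_distrib[symmetric])
        ultimately show "hausdorff_gauge s (?B i) = ennreal ((1 / real n) powr s)"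
          using s by (auto simp: hausdorff_gauge_def)
      qed
      also have "\<dots> = ennreal (real n * (1 / real n) powr s)"
        by (simp add: ennreal_of_nat_eq_real_of_nat ennreal_mult)
      also have "real n * (1 / real n) powr s = real n powr (1 - s)"
        using n by (simp add: powr_diff powr_divide)
      finally show "(\<integral>\<^sup>+ i. hausdorff_gauge s (?B i) \<partial>count_space UNIV) \<le> ennreal e"
        using n by (simp add: ennreal_leI)
    qed
  qed (use s in simp)
  then have "hausdorff_dim A \<le> ereal 1" by (intro hausdorff_dim_le_eps) auto
  then show ?thesis by (simp add: one_ereal_def)
qed

section \<open>Lower bounds from mass distributions\<close>

lemma partition_of_weights:
  fixes p :: "'w \<Rightarrow> real"
  assumes "finite W" "\<And>w. w \<in> W \<Longrightarrow> 0 < p w"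
  shows "\<exists>c. \<forall>t. 0 \<le> t \<and> t < sum p W \<longrightarrow> (\<exists>w\<in>W. c w \<le> t \<and> t < c w + p w)"
  using assms
proof (induction W)
  case (insert v W)
  then obtain c where c: "\<And>t. 0 \<le> t \<Longrightarrow> t < sum p W \<Longrightarrow> \<exists>w\<in>W. c w \<le> t \<and> t < c w + p w" by auto
  have "\<exists>w\<in>insert v W. (c(v := sum p W)) w \<le> t \<and> t < (c(v := sum p W)) w + p w"
    if t: "0 \<le> t" "t < sum p (insert v W)" for t
  proof (cases "t < sum p W")
    case True
    then obtain w where "w \<in> W" "c w \<le> t \<and> t < c w + p w" using c t by blast
    then show ?thesis using insert.hyps by (intro bexI[of _ w]) auto
  next
    case False
    then show ?thesis using t insert.hyps by (intro bexI[of _ v]) (auto simp: add.commute)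
  qed
  then show ?case by blast
qed auto

text \<open>Expanding \<open>t \<in> [0,1)\<close> in the number system whose digits have weights \<open>p\<close> turns the
  product measure with these weights into Lebesgue measure, so that no measure on the
  sequence space is needed.\<close>

lemma mass_distribution:
  fixes W :: "nat \<Rightarrow> 'w set" and p :: "nat \<Rightarrow> 'w \<Rightarrow> real" and X :: "(nat \<Rightarrow> 'w) \<Rightarrow> real"
  assumes fin: "\<And>i. finite (W i)" and pos: "\<And>i w. w \<in> W i \<Longrightarrow> 0 < p i w"
    and sum1: "\<And>i. (\<Sum>w\<in>W i. p i w) = 1"
    and C: "0 < C" and s: "0 < s"
    and vanish: "\<And>\<omega>. \<forall>i. \<omega> i \<in> W i \<Longrightarrow> (\<lambda>i. \<Prod>j<i. p j (\<omega> j)) \<longlonglongrightarrow> 0"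
    and sep: "\<And>\<omega> \<omega>' i. \<forall>i. \<omega> i \<in> W i \<Longrightarrow> \<forall>i. \<omega>' i \<in> W i \<Longrightarrow> \<forall>j<i. \<omega> j = \<omega>' j \<Longrightarrow> \<omega> i \<noteq> \<omega>' i \<Longrightarrow>
      (\<Prod>j<i. p j (\<omega> j)) \<le> C * \<bar>X \<omega> - X \<omega>'\<bar> powr s"
    and E: "\<And>\<omega>. \<forall>i. \<omega> i \<in> W i \<Longrightarrow> X \<omega> \<in> E"
  shows "hausdorff_measure s E \<noteq> 0"
proof -
  have "\<exists>c. \<forall>t. 0 \<le> t \<and> t < 1 \<longrightarrow> (\<exists>w\<in>W i. c w \<le> t \<and> t < c w + p i w)" for i
    using partition_of_weights[OF fin[of i], of "p i"] pos[of _ i] unfolding sum1 by blast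
  then have "\<forall>i. \<exists>c. \<forall>t. 0 \<le> t \<and> t < 1 \<longrightarrow> (\<exists>w\<in>W i. c w \<le> t \<and> t < c w + p i w)" by blast
  from choice[OF this] obtain c where
    c: "\<And>i t. 0 \<le> t \<Longrightarrow> t < 1 \<Longrightarrow> \<exists>w\<in>W i. c i w \<le> t \<and> t < c i w + p i w"
    by blast
  define pick where "pick i t = (SOME w. w \<in> W i \<and> c i w \<le> t \<and> t < c i w + p i w)" for i t
  have pick: "pick i t \<in> W i" "c i (pick i t) \<le> t" "t < c i (pick i t) + p i (pick i t)"
    if "0 \<le> t" "t < 1" for i t
    using someI_ex[of "\<lambda>w. w \<in> W i \<and> c i w \<le> t \<and> t < c i w + p i w"] c[OF that, of i]
    unfolding pick_def by blast+
  \<comment> \<open>\<open>T t i\<close> is the remainder of \<open>t\<close> after \<open>i\<close>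
    digits, rescaled to the unit interval; \<open>om t\<close> is the digit sequence of
    \<open>t\<close>.\<close>
  define T where "T t = rec_nat t (\<lambda>i u. (u - c i (pick i u)) / p i (pick i u))" for t
  have T0: "T t 0 = t" and TS: "T t (Suc i) = (T t i - c i (pick i (T t i))) / p i (pick i (T t i))" for t i
    by (simp_all add: T_def)
  define om where "om t i = pick i (T t i)" for t i
  have T01: "0 \<le> T t i" "T t i < 1" if "0 \<le> t" "t < 1" for t i
  proof -
    have "0 \<le> T t i \<and> T t i < 1"
    proof (induction i)
      case (Suc i)
      then show ?case using pick[of "T t i" i] pos[of "pick i (T t i)" i] by (auto simp: TS field_simps)
    qed (use that in \<open>simp add: T0\<close>)
    then show "0 \<le> T t i" "T t i < 1" by auto
  qed
  have omW: "\<forall>i. om t i \<in> W i" if "0 \<le> t" "t < 1" for t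
    using pick(1) T01[OF that] by (simp add: om_def)
  have agree: "T t i - T u i = (t - u) / (\<Prod>j<i. p j (om t j))" if "\<forall>j<i. om t j = om u j" for t u i
    using that
  proof (induction i)
    case (Suc i)
    have "T t (Suc i) - T u (Suc i) = (T t i - T u i) / p i (om t i)"
      using Suc.prems[rule_format, of i] by (simp add: TS om_def diff_divide_distrib)
    then show ?case using Suc by simp
  qed (simp add: T0)
  have close: "\<bar>t - u\<bar> \<le> (\<Prod>j<i. p j (om t j))" if "0 \<le> t" "t < 1" "0 \<le> u" "u < 1" "\<forall>j<i. om t j = om u j" for t u i
  proof -
    have pp: "0 < (\<Prod>j<i. p j (om t j))" using omW[OF that(1,2)] pos by (intro prod_pos) auto
    have "\<bar>T t i - T u i\<bar> \<le> 1" using T01[OF that(1,2), of i] T01[OF that(3,4), of i] by auto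
    then show ?thesis using pp unfolding agree[OF that(5)] by (simp add: abs_divide)
  qed
  \<comment> \<open>The map from \<open>X (om t)\<close> back to \<open>t\<close> is Hoelder with
    exponent \<open>s\<close>. If all digits agree, \<open>vanish\<close> gives
    \<open>t = u\<close>; otherwise \<open>sep\<close> applies at the first difference.\<close>
  have hoelder: "\<bar>t - u\<bar> \<le> C * \<bar>X (om t) - X (om u)\<bar> powr s" if tu: "0 \<le> t" "t < 1" "0 \<le> u" "u < 1" for t u
  proof (cases "om t = om u")
    case True
    have "(\<lambda>i. \<Prod>j<i. p j (om t j)) \<longlonglongrightarrow> 0" by (rule vanish[OF omW[OF tu(1,2)]])
    then have "\<bar>t - u\<bar> \<le> 0" by (rule LIMSEQ_le_const) (use close[OF tu] True in auto)
    then show ?thesis using C by simp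
  next
    case False
    define i where "i = (LEAST i. om t i \<noteq> om u i)"
    have "\<exists>i. om t i \<noteq> om u i" using False by (simp add: fun_eq_iff)
    then have "om t i \<noteq> om u i" unfolding i_def by (rule LeastI_ex)
    moreover have ag: "\<forall>j<i. om t j = om u j" unfolding i_def using not_less_Least by blast
    ultimately have "(\<Prod>j<i. p j (om t j)) \<le> C * \<bar>X (om t) - X (om u)\<bar> powr s"
      by (intro sep omW tu)
    then show ?thesis using close[OF tu ag] by linarith
  qed
  have "ennreal (1 / (2 * C)) \<le> hausdorff_premeasure 1 s E"
    unfolding hausdorff_premeasure_def
  proof (rule INF_greatest)
    fix U :: "nat \<Rightarrow> real set"
    assume "U \<in> {U. E \<subseteq> (\<Union>i. U i) \<and> (\<forall>i. bounded (U i) \<and> diameter (U i) \<le> 1)}"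
    then have U: "E \<subseteq> (\<Union>i. U i)" "\<And>i. bounded (U i)" by auto
    define P where "P i t \<longleftrightarrow> 0 \<le> t \<and> t < 1 \<and> X (om t) \<in> U i" for i t
    define r where "r i = C * diameter (U i) powr s" for i
    \<comment> \<open>The set of all \<open>t\<close> with \<open>X (om t) \<in> U i\<close> need
      not be measurable, so it is enclosed in an interval around an arbitrary one of its
      points.\<close>
    define J where "J i = (if \<exists>t. P i t then {(SOME t. P i t) - r i .. (SOME t. P i t) + r i} else {})" for i
    have "{0..<1} \<subseteq> (\<Union>i. J i)"
    proof
      fix t :: real assume "t \<in> {0..<1}"
      then have t: "0 \<le> t" "t < 1" by auto
      then obtain i where i: "P i t" using E[OF omW[OF t]] U(1) by (auto simp: P_def)
      define u where "u = (SOME t. P i t)"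
      have u: "P i u" unfolding u_def using i by (rule someI)
      have "\<bar>X (om t) - X (om u)\<bar> \<le> diameter (U i)"
        using diameter_bounded_bound[OF U(2)[of i], of "X (om t)" "X (om u)"] i u by (simp add: P_def dist_real_def)
      then have "\<bar>X (om t) - X (om u)\<bar> powr s \<le> diameter (U i) powr s"
        using s by (intro powr_mono2) auto
      then have "\<bar>t - u\<bar> \<le> r i"
        using hoelder[of t u] t u C unfolding r_def P_def by (smt (verit) mult_left_mono)
      then have "t \<in> J i" using i by (auto simp: J_def u_def[symmetric] abs_le_iff)
      then show "t \<in> (\<Union>i. J i)" by blast
    qed
    then have "emeasure lborel {0..<1::real} \<le> emeasure lborel (\<Union>i. J i)"
      by (intro emeasure_mono) (auto simp: J_def)
    also have "\<dots> \<le> (\<Sum>i. emeasure lborel (J i))"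
      by (intro emeasure_subadditive_countably) (auto simp: J_def)
    also have "\<dots> \<le> (\<Sum>i. ennreal (2 * C) * hausdorff_gauge s (U i))"
    proof (intro suminf_le)
      fix i
      show "emeasure lborel (J i) \<le> ennreal (2 * C) * hausdorff_gauge s (U i)"
      proof (cases "\<exists>t. P i t")
        case True
        then have "U i \<noteq> {}" by (auto simp: P_def)
        then show ?thesis using True s C by (simp add: J_def r_def hausdorff_gauge_def ennreal_mult[symmetric])
      qed (simp add: J_def)
    qed auto
    also have "\<dots> = ennreal (2 * C) * (\<Sum>i. hausdorff_gauge s (U i))" by simp
    finally have "1 \<le> ennreal (2 * C) * (\<Sum>i. hausdorff_gauge s (U i))" by simp
    then have "ennreal (1 / (2 * C)) * 1 \<le> ennreal (1 / (2 * C)) * (ennreal (2 * C) * (\<Sum>i. hausdorff_gauge s (U i)))"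
      by (rule mult_left_mono) simp
    also have "\<dots> = (\<Sum>i. hausdorff_gauge s (U i))"
      using C by (simp add: mult.assoc[symmetric] ennreal_mult[symmetric])
    finally show "ennreal (1 / (2 * C)) \<le> (\<Sum>i. hausdorff_gauge s (U i))" by simp
  qed
  also have "\<dots> \<le> hausdorff_measure s E"
    unfolding hausdorff_measure_def by (intro SUP_upper) auto
  finally have "ennreal (1 / (2 * C)) \<le> hausdorff_measure s E" .
  moreover have "0 < ennreal (1 / (2 * C))" using C by simp
  ultimately show ?thesis by auto
qed

subsection \<open>The dimensional number\<close>

text \<open>Lists with a letter 0 get weight 0, so that sums over tuples of positive integers become
  integrals over the whole type of lists.\<close>

definition qweight :: "real \<Rightarrow> nat list \<Rightarrow> ennreal" where
  "qweight \<rho> w = (if 0 \<in> set w then 0 else ennreal (qw w powr (- (2 * \<rho>))))"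

definition Zsum :: "nat \<Rightarrow> real \<Rightarrow> ennreal" where
  "Zsum n \<rho> = (\<integral>\<^sup>+ w. (if length w = n then qweight \<rho> w else 0) \<partial>count_space UNIV)"

text \<open>The sum in the definition of $s(\gamma, \tau)$, with $g = \gamma / (1 - \gamma)$.\<close>

definition Asum :: "nat \<Rightarrow> real \<Rightarrow> real \<Rightarrow> ennreal" where
  "Asum n g \<rho> = ennreal (golden powr (- (2 * \<rho> * g * real n))) * Zsum n \<rho>"

lemma qweight_append_le:
  assumes "0 \<le> \<rho>"
  shows "qweight \<rho> (u @ v) \<le> qweight \<rho> u * qweight \<rho> v"
proof (cases "0 \<in> set (u @ v)")
  case False
  then have z: "0 \<notin> set u" "0 \<notin> set v" by auto
  have "qw (u @ v) powr (- (2 * \<rho>)) \<le> (qw u * qw v) powr (- (2 * \<rho>))"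
    using qw_append(1)[OF z] cden_pos[OF z(1), of 0] cden_pos[OF z(2), of 0] assms
    by (intro powr_mono2') auto
  also have "\<dots> = qw u powr (- (2 * \<rho>)) * qw v powr (- (2 * \<rho>))" 
    by (rule powr_mult)
  finally show ?thesis using z by (simp add: qweight_def ennreal_mult[symmetric] ennreal_leI)
qed (simp add: qweight_def)

lemma Zsum_submult:
  assumes "0 \<le> \<rho>"
  shows "Zsum (m + n) \<rho> \<le> Zsum m \<rho> * Zsum n \<rho>"
proof -
  have "Zsum (m + n) \<rho> = (\<integral>\<^sup>+ u. (\<integral>\<^sup>+ v. (if length u = m \<and> length v = n then qweight \<rho> (u @ v) else 0) \<partial>count_space UNIV) \<partial>count_space UNIV)"
    unfolding Zsum_def by (rule nn_integral_list_append)
  also have "\<dots> \<le> (\<integral>\<^sup>+ u. (\<integral>\<^sup>+ v. (if length u = m then qweight \<rho> u else 0) * (if length v = n then qweight \<rho> v else 0) \<partial>count_space UNIV) \<partial>count_space UNIV)"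
    using qweight_append_le[OF assms] by (intro nn_integral_mono) auto
  also have "\<dots> = Zsum m \<rho> * Zsum n \<rho>"
    by (simp add: nn_integral_cmult nn_integral_multc Zsum_def)
  finally show ?thesis .
qed

lemma Zsum_0: "Zsum 0 \<rho> = 1"
proof -
  have "Zsum 0 \<rho> = (\<integral>\<^sup>+ w. 1 * indicator {[] :: nat list} w \<partial>count_space UNIV)"
    unfolding Zsum_def by (intro nn_integral_cong) (auto simp: indicator_def qweight_def)
  then show ?thesis by (subst (asm) nn_integral_cmult_indicator) (auto simp: emeasure_count_space)
qed

lemma Zsum_1: "Zsum 1 \<rho> = (\<Sum>n. ennreal (real (Suc n) powr (- (2 * \<rho>))))"
proof -
  have "Zsum 1 \<rho> = (\<integral>\<^sup>+ a. (\<integral>\<^sup>+ w. (if length w = 0 then qweight \<rho> (a # w) else 0) \<partial>count_space UNIV) \<partial>count_space UNIV)"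
    unfolding Zsum_def by (subst nn_integral_list_Cons) simp
  also have "\<dots> = (\<integral>\<^sup>+ a. (\<integral>\<^sup>+ w. qweight \<rho> [a] * indicator {[] :: nat list} w \<partial>count_space UNIV) \<partial>count_space UNIV)"
    by (intro nn_integral_cong) (auto simp: indicator_def)
  also have "\<dots> = (\<integral>\<^sup>+ a. qweight \<rho> [a] \<partial>count_space UNIV)"
    by (intro nn_integral_cong) (subst nn_integral_cmult_indicator, auto simp: emeasure_count_space)
  also have "\<dots> = (\<Sum>a. qweight \<rho> [a])" by (rule nn_integral_count_space_nat)
  also have "\<dots> = (\<Sum>n. qweight \<rho> [Suc n]) + qweight \<rho> [0]"
    using suminf_offset[of "\<lambda>a. qweight \<rho> [a]" 1] by simp
  finally show ?thesis by (simp add: qweight_def)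
qed

lemma Zsum_1_finite: "1 / 2 < \<rho> \<Longrightarrow> Zsum 1 \<rho> < \<infinity>"
proof -
  assume \<rho>: "1 / 2 < \<rho>"
  then have "summable (\<lambda>n. real n powr (- (2 * \<rho>)))"
    by (subst summable_real_powr_iff) simp
  then have "summable (\<lambda>n. real (Suc n) powr (- (2 * \<rho>)))"
    by (subst summable_Suc_iff)
  then show ?thesis unfolding Zsum_1
    by (subst suminf_ennreal2) auto
qed

lemma Zsum_finite: "1 / 2 < \<rho> \<Longrightarrow> Zsum n \<rho> < \<infinity>"
proof (induction n)
  case (Suc n)
  have "Zsum (1 + n) \<rho> \<le> Zsum 1 \<rho> * Zsum n \<rho>" using Suc by (intro Zsum_submult) auto
  also have "\<dots> < \<infinity>" using Suc Zsum_1_finite[of \<rho>] by (simp add: ennreal_mult_less_top)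
  finally show ?case by simp
qed (simp add: Zsum_0)

text \<open>Letting only the first letter vary, with ones behind it, already leaves a multiple of
  the series of \<open>k powr (- (2 * \<rho>))\<close>, which diverges up to 1/2.\<close>

lemma Zsum_infinite:
  assumes "1 \<le> n" "0 \<le> \<rho>" "\<rho> \<le> 1 / 2"
  shows "Zsum n \<rho> = \<infinity>"
proof -
  obtain m where n: "n = Suc m" using assms by (cases n) auto
  define v where "v = replicate m (1::nat)"
  have v: "0 \<notin> set v" by (simp add: v_def)
  have vp: "0 < qw v" using cden_pos[OF v] by simp
  define c where "c = (2 * qw v) powr (- (2 * \<rho>))"
  have c0: "0 < c" using vp by (simp add: c_def)
  have le: "ennreal c * ennreal (real (Suc k) powr (- (2 * \<rho>))) \<le> qweight \<rho> ((Suc k) # v)" for k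
  proof -
    have "c * real (Suc k) powr (- (2 * \<rho>)) = (2 * qw [Suc k] * qw v) powr (- (2 * \<rho>))"
    proof -
      have "2 * qw [Suc k] * qw v = (2 * qw v) * real (Suc k)" by simp
      then show ?thesis by (simp only: c_def powr_mult)
    qed
    also have "\<dots> \<le> qw ([Suc k] @ v) powr (- (2 * \<rho>))"
      using qw_append(2)[of "[Suc k]" v] v vp assms cden_pos[of "Suc k # v" 0] by (intro powr_mono2') auto
    finally show ?thesis using v c0 by (simp add: qweight_def ennreal_mult[symmetric] ennreal_leI)
  qed
  have "ennreal c * Zsum 1 \<rho> = (\<Sum>k. ennreal c * ennreal (real (Suc k) powr (- (2 * \<rho>))))"
    unfolding Zsum_1 by simp
  also have "\<dots> \<le> (\<Sum>k. qweight \<rho> ((Suc k) # v))" using le by (intro suminf_le) auto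
  also have "\<dots> = (\<integral>\<^sup>+ k. qweight \<rho> ((Suc k) # v) \<partial>count_space UNIV)"
    by (rule nn_integral_count_space_nat[symmetric])
  also have "\<dots> = (\<integral>\<^sup>+ w. qweight \<rho> w \<partial>count_space (range (\<lambda>k. Suc k # v)))"
    by (rule nn_integral_bij_count_space[where f = "\<lambda>w. qweight \<rho> w"]) (auto simp: bij_betw_def inj_on_def)
  also have "\<dots> \<le> Zsum n \<rho>"
    unfolding Zsum_def by (subst nn_integral_count_space_indicator) 
     (auto intro!: nn_integral_mono simp: indicator_def n v_def)
  finally have "ennreal c * Zsum 1 \<rho> \<le> Zsum n \<rho>" .
  moreover have "Zsum 1 \<rho> = \<infinity>"
  proof (rule ccontr)
    assume "Zsum 1 \<rho> \<noteq> \<infinity>"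
    then have "summable (\<lambda>n. real (Suc n) powr (- (2 * \<rho>)))"
      unfolding Zsum_1 by (intro summable_suminf_not_top) auto
    then have "summable (\<lambda>n. real n powr (- (2 * \<rho>)))" by (subst (asm) summable_Suc_iff)
    then show False using assms by (subst (asm) summable_real_powr_iff) simp
  qed
  ultimately show ?thesis using c0 by (simp add: ennreal_mult_top top_unique)
qed

text \<open>Raising the exponent multiplies each weight by a negative power of its denominator, and
  all denominators are at least \<open>golden powr (n - 1)\<close>. This is the source of all
  strictness in \<rho>.\<close>

lemma Zsum_decay:
  assumes "1 \<le> n" "\<rho> \<le> \<rho>'"
  shows "Zsum n \<rho>' \<le> ennreal (golden powr (- (2 * (\<rho>' - \<rho>) * (real n - 1)))) * Zsum n \<rho>"
proof -
  have "(if length w = n then qweight \<rho>' w else 0) \<le>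
      ennreal (golden powr (- (2 * (\<rho>' - \<rho>) * (real n - 1)))) * (if length w = n then qweight \<rho> w else 0)" for w
  proof (cases "length w = n \<and> 0 \<notin> set w")
    case True
    then have w: "0 \<notin> set w" "length w = n" by auto
    have "qw w powr (- (2 * \<rho>')) = qw w powr (- (2 * (\<rho>' - \<rho>))) * qw w powr (- (2 * \<rho>))"
      by (simp add: powr_add[symmetric] algebra_simps)
    also have "\<dots> \<le> (golden powr (real n - 1)) powr (- (2 * (\<rho>' - \<rho>))) * qw w powr (- (2 * \<rho>))"
      using qw_ge_golden[OF w(1)] w(2) assms golden_gt_1 by (intro mult_right_mono powr_mono2') auto
    also have "(golden powr (real n - 1)) powr (- (2 * (\<rho>' - \<rho>))) = golden powr (- (2 * (\<rho>' - \<rho>) * (real n - 1)))"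
      by (simp add: powr_powr algebra_simps)
    finally show ?thesis using w by (simp add: qweight_def ennreal_mult[symmetric] ennreal_leI)
  qed (auto simp: qweight_def)
  then have "Zsum n \<rho>' \<le> (\<integral>\<^sup>+ w. ennreal (golden powr (- (2 * (\<rho>' - \<rho>) * (real n - 1)))) * (if length w = n then qweight \<rho> w else 0) \<partial>count_space UNIV)"
    unfolding Zsum_def by (intro nn_integral_mono)
  then show ?thesis by (simp add: nn_integral_cmult Zsum_def)
qed

lemma Asum_decay:
  assumes "1 \<le> n" "\<rho> \<le> \<rho>'" "0 \<le> g"
  shows "Asum n g \<rho>' \<le> ennreal (golden powr (- (2 * (\<rho>' - \<rho>) * ((real n - 1) + g * n)))) * Asum n g \<rho>"
proof -
  let ?c = "golden powr (- (2 * (\<rho>' - \<rho>) * (real n - 1)))"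
  have "Asum n g \<rho>' \<le> ennreal (golden powr (- (2 * \<rho>' * g * real n))) * (ennreal ?c * Zsum n \<rho>)"
    unfolding Asum_def using assms by (intro mult_left_mono Zsum_decay) auto
  also have "\<dots> = ennreal (golden powr (- (2 * \<rho>' * g * real n)) * ?c) * Zsum n \<rho>"
    by (simp add: ennreal_mult mult.assoc)
  also have "golden powr (- (2 * \<rho>' * g * real n)) * ?c =
      golden powr (- (2 * (\<rho>' - \<rho>) * ((real n - 1) + g * n))) * golden powr (- (2 * \<rho> * g * real n))"
    unfolding powr_add[symmetric] by (simp add: algebra_simps)
  also have "ennreal \<dots> * Zsum n \<rho> = ennreal (golden powr (- (2 * (\<rho>' - \<rho>) * ((real n - 1) + g * n)))) * Asum n g \<rho>"
    by (simp add: ennreal_mult mult.assoc Asum_def)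
  finally show ?thesis .
qed

lemma Asum_antimono:
  assumes "1 \<le> n" "\<rho> \<le> \<rho>'" "0 \<le> g"
  shows "Asum n g \<rho>' \<le> Asum n g \<rho>"
proof -
  have "golden powr (- (2 * (\<rho>' - \<rho>) * ((real n - 1) + g * n))) \<le> golden powr 0"
    using golden_gt_1 assms by (intro powr_mono) auto
  then have "ennreal (golden powr (- (2 * (\<rho>' - \<rho>) * ((real n - 1) + g * n)))) * Asum n g \<rho> \<le> 1 * Asum n g \<rho>"
    using golden_gt_1 by (intro mult_right_mono) auto
  then show ?thesis using Asum_decay[OF assms] by simp
qed

text \<open>As in Fekete's lemma, split \<open>n\<close> into multiples of \<open>k\<close> and a
  remainder; finitely many remainders only affect the constant.\<close>

lemma submult_geometric:
  fixes f :: "nat \<Rightarrow> real"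
  assumes nn: "\<And>n. 0 \<le> f n" and sub: "\<And>m n. f (m + n) \<le> f m * f n"
    and k: "1 \<le> k" "f k < 1"
  shows "\<exists>C \<kappa>. 0 < C \<and> 0 < \<kappa> \<and> \<kappa> < 1 \<and> (\<forall>n. f n \<le> C * \<kappa> ^ n)"
proof -
  \<comment> \<open>Averaging with 1 keeps \<theta> positive even if \<open>f k = 0\<close>, so that
    its \<open>k\<close>-th root can serve as ratio.\<close>
  define \<theta> where "\<theta> = (f k + 1) / 2"
  have \<theta>: "0 < \<theta>" "\<theta> < 1" "f k \<le> \<theta>" using nn[of k] k by (auto simp: \<theta>_def)
  define M where "M = (\<Sum>r<k. f r) + 1"
  have M: "f r \<le> M" if "r < k" for r
    using member_le_sum[of r "{..<k}" f] that nn by (simp add: M_def)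
  have M0: "0 < M" using sum_nonneg[of "{..<k}" f] nn by (simp add: M_def add_nonneg_pos)
  define \<kappa> where "\<kappa> = \<theta> powr (1 / real k)"
  have \<kappa>: "0 < \<kappa>" "\<kappa> < 1"
    using \<theta> k powr_less_mono2[of "1 / real k" \<theta> 1] by (auto simp: \<kappa>_def)
  have mult: "f (j * k + r) \<le> \<theta> ^ j * f r" for j r
  proof (induction j)
    case (Suc j)
    have "f (Suc j * k + r) \<le> f k * f (j * k + r)" using sub[of k "j * k + r"] by (simp add: add.assoc)
    also have "\<dots> \<le> \<theta> * (\<theta> ^ j * f r)" using Suc \<theta> nn by (intro mult_mono) auto
    finally show ?case by (simp add: mult.assoc)
  qed simp
  have "f n \<le> M / \<theta> * \<kappa> ^ n" for n
  proof -
    have "f n \<le> \<theta> ^ (n div k) * f (n mod k)" using mult[of "n div k" "n mod k"] by simp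
    also have "\<dots> \<le> \<theta> ^ (n div k) * M" using M[of "n mod k"] \<theta> k by (intro mult_left_mono) auto
    also have "\<theta> ^ (n div k) = \<theta> powr real (n div k)" using \<theta> by (simp add: powr_realpow)
    also have "\<dots> \<le> \<theta> powr (real n / real k - 1)"
    proof (rule powr_mono')
      have "n < (n div k + 1) * k" using k by (metis Suc_eq_plus1 dividend_less_div_times mult.commute less_le_trans zero_less_one add.commute mult_Suc)
      then have "real n \<le> (real (n div k) + 1) * real k"
        by (metis less_imp_le of_nat_1 of_nat_add of_nat_le_iff of_nat_mult)
      then show "real n / real k - 1 \<le> real (n div k)" using k by (simp add: field_simps)
    qed (use \<theta> in auto)
    also have "\<dots> = \<kappa> ^ n / \<theta>"
      using \<theta> k by (simp add: \<kappa>_def powr_diff powr_powr powr_realpow[symmetric])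
    finally show ?thesis using M0 by (simp add: mult.commute mult_right_mono)
  qed
  then show ?thesis using M0 \<theta> \<kappa> by (intro exI[of _ "M / \<theta>"] exI[of _ \<kappa>]) auto
qed

lemma Asum_submult:
  assumes "0 \<le> \<rho>"
  shows "Asum (m + n) g \<rho> \<le> Asum m g \<rho> * Asum n g \<rho>"
proof -
  have "golden powr (- (2 * \<rho> * g * real (m + n))) =
      golden powr (- (2 * \<rho> * g * real m)) * golden powr (- (2 * \<rho> * g * real n))"
    unfolding powr_add[symmetric] by (simp add: algebra_simps)
  then have "Asum (m + n) g \<rho> \<le> ennreal (golden powr (- (2 * \<rho> * g * real m)) * golden powr (- (2 * \<rho> * g * real n))) * (Zsum m \<rho> * Zsum n \<rho>)"
    unfolding Asum_def using Zsum_submult[OF assms] by (simp add: mult_left_mono)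
  then show ?thesis by (simp add: Asum_def ennreal_mult mult_ac)
qed

lemma Asum_geometric:
  assumes "1 / 2 < \<rho>" "1 \<le> k" "Asum k g \<rho> < 1"
  shows "\<exists>C \<kappa>. 0 < C \<and> 0 < \<kappa> \<and> \<kappa> < 1 \<and> (\<forall>n. Asum n g \<rho> \<le> ennreal (C * \<kappa> ^ n))"
proof -
  define f where "f n = enn2real (Asum n g \<rho>)" for n
  have fin: "Asum n g \<rho> < \<infinity>" for n
    unfolding Asum_def using Zsum_finite[OF assms(1), of n] by (simp add: ennreal_mult_less_top)
  then have f: "Asum n g \<rho> = ennreal (f n)" for n by (simp add: f_def)
  have nn: "0 \<le> f n" for n by (simp add: f_def)
  have "f (m + n) \<le> f m * f n" for m n
  proof -
    have "ennreal (f (m + n)) \<le> ennreal (f m * f n)"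
      using Asum_submult[of \<rho> m n g] assms unfolding f ennreal_mult[OF nn nn, symmetric] by simp
    then show ?thesis by (subst (asm) ennreal_le_iff) (simp_all add: nn)
  qed
  moreover have "f k < 1" using assms nn[of k] unfolding f by (simp add: ennreal_less_one_iff)
  ultimately obtain C \<kappa> where "0 < C" "0 < \<kappa>" "\<kappa> < 1" "\<forall>n. f n \<le> C * \<kappa> ^ n"
    using submult_geometric[of f k] nn assms by blast
  then show ?thesis unfolding f by (intro exI[of _ C] exI[of _ \<kappa>]) (auto intro: ennreal_leI)
qed

lemma s_pre_eq:
  assumes "0 < \<gamma>" "\<gamma> < 1" "1 \<le> n"
  shows "s_pre n \<gamma> golden = Inf {\<rho>. 0 \<le> \<rho> \<and> Asum n (\<gamma> / (1 - \<gamma>)) \<rho> \<le> 1}"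
proof -
  define g where "g = \<gamma> / (1 - \<gamma>)"
  let ?L = "{w :: nat list. length w = n \<and> 0 \<notin> set w}"
  have bij: "bij_betw (\<lambda>a. map a [1..<Suc n]) ({1..n} \<rightarrow>\<^sub>E {1..}) ?L"
  proof (rule bij_betw_byWitness[where f' = "\<lambda>w. restrict (\<lambda>i. w ! (i - 1)) {1..n}"])
    show "\<forall>a\<in>{1..n} \<rightarrow>\<^sub>E {1 :: nat..}. restrict (\<lambda>i. map a [1..<Suc n] ! (i - 1)) {1..n} = a"
    proof
      fix a :: "nat \<Rightarrow> nat" assume a: "a \<in> {1..n} \<rightarrow>\<^sub>E {1..}"
      show "restrict (\<lambda>i. map a [1..<Suc n] ! (i - 1)) {1..n} = a"
        using a by (auto simp: fun_eq_iff restrict_def PiE_def extensional_def nth_append simp del: upt_Suc)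
    qed
    show "\<forall>w\<in>?L. map (restrict (\<lambda>i. w ! (i - 1)) {1..n}) [1..<Suc n] = w"
      by (auto intro!: nth_equalityI simp del: upt_Suc)
    show "(\<lambda>a. map a [1..<Suc n]) ` ({1..n} \<rightarrow>\<^sub>E {1..}) \<subseteq> ?L"
    proof (rule image_subsetI)
      fix a :: "nat \<Rightarrow> nat" assume a: "a \<in> {1..n} \<rightarrow>\<^sub>E {1..}"
      have "0 \<notin> set (map a [1..<Suc n])"
      proof
        assume "0 \<in> set (map a [1..<Suc n])"
        then obtain i where "i \<in> {1..<Suc n}" "0 = a i" unfolding set_map set_upt by (rule imageE) simp
        then show False using PiE_mem[OF a, of i] by simp
      qed
      then show "map a [1..<Suc n] \<in> ?L" by (simp del: upt_Suc)
    qed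
    show "(\<lambda>w. restrict (\<lambda>i. w ! (i - 1)) {1..n}) ` ?L \<subseteq> {1..n} \<rightarrow>\<^sub>E {1..}"
    proof (clarsimp simp: Suc_le_eq)
      fix w :: "nat list" and i assume "0 \<notin> set w" "n = length w" "0 < i" "i \<le> length w"
      moreover from this have "i - Suc 0 < length w" by linarith
      ultimately show "0 < w ! (i - Suc 0)" using nth_mem[of "i - Suc 0" w] by (intro gr0I) auto
    qed
  qed
  have "(\<Sum>\<^sub>\<infinity> a \<in> {1..n} \<rightarrow>\<^sub>E {1..}.
        ennreal ((1 / (golden powr (real n * \<gamma> / (1 - \<gamma>)) * real (cf_denom a n))) powr (2 * \<rho>))) = Asum n g \<rho>" for \<rho>
  proof -
    have "(\<Sum>\<^sub>\<infinity> a \<in> {1..n} \<rightarrow>\<^sub>E {1..}.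
        ennreal ((1 / (golden powr (real n * \<gamma> / (1 - \<gamma>)) * real (cf_denom a n))) powr (2 * \<rho>))) =
      (\<Sum>\<^sub>\<infinity> a \<in> {1..n} \<rightarrow>\<^sub>E {1..}. ennreal (golden powr (- (2 * \<rho> * g * real n))) * qweight \<rho> (map a [1..<Suc n]))"
    proof (rule infsum_cong)
      fix a :: "nat \<Rightarrow> nat" assume a: "a \<in> {1..n} \<rightarrow>\<^sub>E {1..}"
      let ?w = "map a [1..<Suc n]"
      have w: "0 \<notin> set ?w" using bij_betw_apply[OF bij a] by simp
      have d: "real (cf_denom a n) = qw ?w" 
      proof (rule cf_denom_eq)
        fix k assume "1 \<le> k" "k \<le> n"
        then show "1 \<le> a k" using PiE_mem[OF a, of k] by simp
      qed
      have "(1 / (golden powr (real n * \<gamma> / (1 - \<gamma>)) * qw ?w)) powr (2 * \<rho>) =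
        golden powr (- (2 * \<rho> * g * real n)) * qw ?w powr (- (2 * \<rho>))"
        using cden_pos[OF w, of 0] golden_gt_1
        by (simp add: powr_divide powr_mult powr_powr powr_minus_divide g_def mult_ac del: upt_Suc)
      then show "ennreal ((1 / (golden powr (real n * \<gamma> / (1 - \<gamma>)) * real (cf_denom a n))) powr (2 * \<rho>)) =
        ennreal (golden powr (- (2 * \<rho> * g * real n))) * qweight \<rho> ?w"
        using w unfolding d by (simp add: qweight_def ennreal_mult del: upt_Suc)
    qed
    also have "\<dots> = infsum (\<lambda>w. ennreal (golden powr (- (2 * \<rho> * g * real n))) * qweight \<rho> w) ?L"
      by (rule infsum_reindex_bij_betw[OF bij])
    also have "\<dots> = infsum (\<lambda>w. ennreal (golden powr (- (2 * \<rho> * g * real n))) * (if length w = n then qweight \<rho> w else 0)) UNIV"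
      by (intro infsum_cong_neutral) (auto simp: qweight_def)
    also have "\<dots> = Asum n g \<rho>"
      by (simp add: infsum_ennreal_eq_nn_integral nn_integral_cmult Asum_def Zsum_def)
    finally show ?thesis .
  qed
  then show ?thesis by (simp add: s_pre_def g_def)
qed

text \<open>The limit \<sigma> is the infimum of the exponents at which some sum falls below 1.
  Above \<sigma>, submultiplicativity pushes all late sums below 1; below \<sigma>, no sum falls
  below 1, and strict decay in \<rho> keeps the zero-level infima from lagging behind.\<close>

lemma s_pre_limit:
  assumes \<gamma>: "0 < \<gamma>" "\<gamma> < 1" and g: "g = \<gamma> / (1 - \<gamma>)"
  obtains \<sigma> where "(\<lambda>n. s_pre n \<gamma> golden) \<longlonglongrightarrow> \<sigma>" "1 / 2 \<le> \<sigma>"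
    "\<And>\<rho>. \<sigma> < \<rho> \<Longrightarrow> \<exists>n\<ge>1. Asum n g \<rho> < 1"
    "\<And>\<rho> n. 0 \<le> \<rho> \<Longrightarrow> \<rho> < \<sigma> \<Longrightarrow> 1 \<le> n \<Longrightarrow> 1 \<le> Asum n g \<rho>"
proof -
  have g0: "0 < g" using \<gamma> g by simp
  define S where "S = {\<rho>. 0 \<le> \<rho> \<and> (\<exists>n\<ge>1. Asum n g \<rho> < 1)}"
  define \<sigma> where "\<sigma> = Inf S"
  have half: "1 / 2 < \<rho>" if S: "\<rho> \<in> S" for \<rho>
  proof (rule ccontr)
    assume "\<not> 1 / 2 < \<rho>"
    moreover obtain n where n: "1 \<le> n" "Asum n g \<rho> < 1" "0 \<le> \<rho>" using S by (auto simp: S_def)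
    ultimately have "Zsum n \<rho> = \<infinity>" by (intro Zsum_infinite) auto
    then show False using n golden_gt_1 by (simp add: Asum_def ennreal_mult_top)
  qed
  have bdd: "bdd_below S" using half by (meson bdd_belowI less_imp_le)
  have "S \<noteq> {}"
  proof -
    have fin: "Asum 2 g 1 < \<infinity>"
      unfolding Asum_def using Zsum_finite[of 1 2] by (simp add: ennreal_mult_less_top)
    then obtain z where z: "Asum 2 g 1 = ennreal z" "0 \<le> z" by (cases "Asum 2 g 1") auto
    have "((\<lambda>n. (1 / golden ^ 2) ^ n * z) \<longlonglongrightarrow> 0 * z)"
      using golden_gt_1 by (intro tendsto_intros LIMSEQ_power_zero) (simp add: golden_sq)
    then have "eventually (\<lambda>n. (1 / golden ^ 2) ^ n * z < 1) sequentially"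
      by (intro order_tendstoD(2)) auto
    then obtain m where m: "(1 / golden ^ 2) ^ m * z < 1" by (auto simp: eventually_sequentially)
    \<comment> \<open>Words of length 2 make \<open>(n - 1) + g * n\<close> at least 1, so the decay
      rate does not depend on \<open>g\<close>.\<close>
    have "Asum 2 g (1 + real m) \<le> ennreal (golden powr (- (2 * (1 + real m - 1) * ((real 2 - 1) + g * real 2)))) * Asum 2 g 1"
      using g0 by (intro Asum_decay) auto
    also have "\<dots> \<le> ennreal ((1 / golden ^ 2) ^ m) * Asum 2 g 1"
    proof (intro mult_right_mono ennreal_leI)
      have "golden powr (- (2 * (1 + real m - 1) * ((real 2 - 1) + g * real 2))) \<le> golden powr (- (2 * real m))"
        using golden_gt_1 g0 by (intro powr_mono) (auto simp: algebra_simps)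
      also have "\<dots> = (1 / golden ^ 2) ^ m"
        using golden_gt_1 powr_realpow[of golden "2 * m"] by (simp add: powr_minus_divide power_mult power_one_over)
      finally show "golden powr (- (2 * (1 + real m - 1) * ((real 2 - 1) + g * real 2))) \<le> (1 / golden ^ 2) ^ m" .
    qed simp
    also have "\<dots> < 1" using m z golden_gt_1 by (simp add: ennreal_mult[symmetric] ennreal_less_one_iff)
    finally have "1 + real m \<in> S" by (auto simp: S_def intro!: exI[of _ 2])
    then show ?thesis by blast
  qed
  have half\<sigma>: "1 / 2 \<le> \<sigma>" unfolding \<sigma>_def using \<open>S \<noteq> {}\<close> half by (intro cInf_greatest) (auto intro: less_imp_le)
  have above: "\<exists>n\<ge>1. Asum n g \<rho> < 1" if \<rho>: "\<sigma> < \<rho>" for \<rho>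
  proof -
    obtain \<rho>1 where "\<rho>1 \<in> S" "\<rho>1 < \<rho>" using cInf_lessD[OF \<open>S \<noteq> {}\<close>, of \<rho>] \<rho> by (auto simp: \<sigma>_def)
    then show ?thesis using Asum_antimono[of _ \<rho>1 \<rho> g] g0 by (force simp: S_def)
  qed
  have below: "1 \<le> Asum n g \<rho>" if "0 \<le> \<rho>" "\<rho> < \<sigma>" "1 \<le> n" for \<rho> n
  proof (rule ccontr)
    assume "\<not> 1 \<le> Asum n g \<rho>"
    then have "\<rho> \<in> S" using that by (auto simp: S_def not_le)
    then have "\<sigma> \<le> \<rho>" unfolding \<sigma>_def using bdd by (intro cInf_lower)
    then show False using that by simp
  qed
  let ?Q = "\<lambda>n. {\<rho>. 0 \<le> \<rho> \<and> Asum n g \<rho> \<le> 1}"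
  have ev: "eventually (\<lambda>n. \<rho> \<in> ?Q n) sequentially" if \<rho>: "\<sigma> < \<rho>" for \<rho>
  proof -
    have h: "1 / 2 < \<rho>" using half\<sigma> \<rho> by simp
    obtain k where "1 \<le> k" "Asum k g \<rho> < 1" using above[OF \<rho>] by blast
    then obtain C \<kappa> where C: "0 < C" "0 < \<kappa>" "\<kappa> < 1" "\<And>n. Asum n g \<rho> \<le> ennreal (C * \<kappa> ^ n)"
      using Asum_geometric[OF h] by blast
    have "(\<lambda>n. C * \<kappa> ^ n) \<longlonglongrightarrow> C * 0" using C by (intro tendsto_intros LIMSEQ_power_zero) auto
    then have "eventually (\<lambda>n. C * \<kappa> ^ n < 1) sequentially" by (intro order_tendstoD(2)) auto
    then show ?thesis
    proof eventually_elim
      case (elim n)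
      then have "ennreal (C * \<kappa> ^ n) \<le> ennreal 1" by (intro ennreal_leI) simp
      then show ?case using C(4)[of n] h by (auto intro: order_trans)
    qed
  qed
  have bddQ: "bdd_below (?Q n)" for n by (rule bdd_belowI[of _ 0]) auto
  have "(\<lambda>n. s_pre n \<gamma> golden) \<longlonglongrightarrow> \<sigma>"
  proof (rule order_tendstoI)
    fix a assume "a < \<sigma>"
    define b where "b = (max a 0 + \<sigma>) / 2"
    have b: "a < b" "0 < b" "b < \<sigma>" using \<open>a < \<sigma>\<close> half\<sigma> by (auto simp: b_def)
    have "eventually (\<lambda>n. \<sigma> + 1 \<in> ?Q n) sequentially" by (rule ev) simp
    then show "eventually (\<lambda>n. a < s_pre n \<gamma> golden) sequentially"
      using eventually_ge_at_top[of 1]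
    proof eventually_elim
      case (elim n)
      have "b \<le> Inf (?Q n)"
      proof (rule cInf_greatest)
        show "?Q n \<noteq> {}" using elim by blast
        fix r assume r: "r \<in> ?Q n"
        show "b \<le> r"
        proof (rule ccontr)
          assume rb: "\<not> b \<le> r"
          \<comment> \<open>A sum of at most 1 at \<open>r\<close> would by strict decay be below 1
            at \<open>b\<close>, although \<open>b\<close> lies below \<sigma>.\<close>
          have "0 < 2 * (b - r) * ((real n - 1) + g * n)"
            using rb g0 elim by (intro mult_pos_pos add_nonneg_pos) auto
          then have lt: "golden powr (- (2 * (b - r) * ((real n - 1) + g * n))) < 1"
            using golden_gt_1 powr_less_mono[of "- (2 * (b - r) * ((real n - 1) + g * n))" 0 golden] by simp
          have "1 \<le> Asum n g b" using b elim by (intro below) auto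
          also have "\<dots> \<le> ennreal (golden powr (- (2 * (b - r) * ((real n - 1) + g * n)))) * Asum n g r"
            using rb g0 elim by (intro Asum_decay) auto
          also have "\<dots> \<le> ennreal (golden powr (- (2 * (b - r) * ((real n - 1) + g * n)))) * 1"
            using r by (intro mult_left_mono) auto
          also have "\<dots> < 1" using lt by (simp add: ennreal_less_one_iff)
          finally show False by simp
        qed
      qed
      then show ?case using s_pre_eq[OF \<gamma>, of n] elim b by (simp add: g)
    qed
  next
    fix a assume "\<sigma> < a"
    then obtain b where b: "\<sigma> < b" "b < a" using dense by blast
    show "eventually (\<lambda>n. s_pre n \<gamma> golden < a) sequentially"
      using ev[OF b(1)] eventually_ge_at_top[of 1]
    proof eventually_elim
      case (elim n)
      have "Inf (?Q n) \<le> b" using elim bddQ by (intro cInf_lower) auto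
      then show ?case using s_pre_eq[OF \<gamma>, of n] elim b by (simp add: g)
    qed
  qed
  then show ?thesis using that half\<sigma> above below by blast
qed

subsection \<open>Records of the run length\<close>

definition is_run :: "real \<Rightarrow> nat \<Rightarrow> nat \<Rightarrow> bool" where
  "is_run x j l \<longleftrightarrow> (\<forall>i\<in>{1..l}. cf_digit (j + i) x = cf_digit (j + 1) x)"

lemma is_runD: "is_run x j l \<Longrightarrow> 1 \<le> i \<Longrightarrow> i \<le> l \<Longrightarrow> cf_digit (j + i) x = cf_digit (j + 1) x"
  by (simp add: is_run_def)

lemma run_length_set:
  assumes "1 \<le> n"
  shows "finite {l. l \<ge> 1 \<and> (\<exists>j. j + l \<le> n \<and> is_run x j l)}"
    and "{l. l \<ge> 1 \<and> (\<exists>j. j + l \<le> n \<and> is_run x j l)} \<noteq> {}"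
proof -
  show "finite {l. l \<ge> 1 \<and> (\<exists>j. j + l \<le> n \<and> is_run x j l)}"
    by (rule finite_subset[of _ "{..n}"]) auto
  have "1 \<in> {l. l \<ge> 1 \<and> (\<exists>j. j + l \<le> n \<and> is_run x j l)}"
    using assms by (auto simp: is_run_def intro: exI[of _ 0])
  then show "{l. l \<ge> 1 \<and> (\<exists>j. j + l \<le> n \<and> is_run x j l)} \<noteq> {}" by blast
qed

lemma run_length_eq: "run_length n x = Max {l. l \<ge> 1 \<and> (\<exists>j. j + l \<le> n \<and> is_run x j l)}"
  by (simp add: run_length_def is_run_def)

lemma run_length_ge:
  assumes "is_run x j l" "j + l \<le> n" "1 \<le> n"
  shows "l \<le> run_length n x"
proof (cases "l = 0")
  case False
  then show ?thesis unfolding run_length_eq using assms run_length_set[OF assms(3), of x] by (intro Max_ge) auto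
qed simp

lemma run_length_attained:
  assumes "1 \<le> n"
  obtains j where "j + run_length n x \<le> n" "is_run x j (run_length n x)" "1 \<le> run_length n x"
  using Max_in[OF run_length_set[OF assms, of x]] that unfolding run_length_eq by auto

lemma is_run_sub:
  assumes "is_run x j l" "j \<le> j'" "j' + l' \<le> j + l"
  shows "is_run x j' l'"
  unfolding is_run_def
proof
  fix i assume i: "i \<in> {1..l'}"
  have "cf_digit (j + (j' - j + i)) x = cf_digit (j + 1) x"
    using assms(2,3) i by (intro is_runD[OF assms(1)]) auto
  moreover have "cf_digit (j + (j' - j + 1)) x = cf_digit (j + 1) x"
    using assms(2,3) i by (intro is_runD[OF assms(1)]) auto
  ultimately show "cf_digit (j' + i) x = cf_digit (j' + 1) x" using assms(2) by simp
qed

definition ev_const :: "real \<Rightarrow> bool" where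
  "ev_const x \<longleftrightarrow> (\<exists>n. \<forall>i\<ge>n. cf_digit (Suc i) x = cf_digit i x)"

text \<open>Take the first position \<open>N\<close> at which \<open>l + 1\<close> equal digits are
  completed and extend that run until the digit changes. One digit earlier, at \<open>m + l\<close>,
  the run length is still at most \<open>l\<close>, and \<open>R\<close> at that position is the
  bound on \<open>m\<close>. Minimality of \<open>N\<close> prevents longer runs from starting
  before \<open>m\<close>.\<close>

lemma record_step:
  assumes nc: "\<not> ev_const x" and R: "\<And>n. n0 \<le> n \<Longrightarrow> real n \<le> (1 + b) * real (run_length n x)"
    and n0: "1 \<le> n0" "n0 \<le> l" and b: "0 < b"
  obtains m L where "l < L" "is_run x m L" "cf_digit (m + L + 1) x \<noteq> cf_digit (m + L) x"
    "\<And>j. is_run x j (L + 1) \<Longrightarrow> m \<le> j" "real m \<le> b * real l"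
proof -
  define P where "P n \<longleftrightarrow> (\<exists>j. n = j + (l + 1) \<and> is_run x j (l + 1))" for n
  have ex: "\<exists>n'\<le>n. P n'" if n: "1 \<le> n" "l + 1 \<le> run_length n x" for n
  proof -
    obtain j where j: "j + run_length n x \<le> n" "is_run x j (run_length n x)"
      using run_length_attained[OF n(1)] by blast
    then have "is_run x j (l + 1)" using n by (intro is_run_sub[OF j(2)]) auto
    then have "P (j + (l + 1))" unfolding P_def by blast
    then show ?thesis using j n by (intro exI[of _ "j + (l + 1)"]) auto
  qed
  have "\<exists>n. P n"
  proof -
    \<comment> \<open>At this position \<open>R\<close> forces a run longer than
      \<open>l\<close>.\<close>
    define n where "n = max n0 (nat \<lceil>(1 + b) * (real l + 1)\<rceil>)"
    have "(1 + b) * (real l + 1) \<le> real n" unfolding n_def using b by linarith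
    also have "\<dots> \<le> (1 + b) * real (run_length n x)" by (rule R) (simp add: n_def)
    finally have "l + 1 \<le> run_length n x" using b by simp
    moreover have "1 \<le> n" using n0 by (simp add: n_def)
    ultimately show ?thesis using ex[of n] by blast
  qed
  define N where "N = (LEAST n. P n)"
  have PN: "P N" unfolding N_def using \<open>\<exists>n. P n\<close> by (rule LeastI_ex)
  have Nmin: "N \<le> n" if "P n" for n unfolding N_def using that by (rule Least_le)
  obtain m where m: "N = m + (l + 1)" "is_run x m (l + 1)" using PN unfolding P_def by blast
  define Q where "Q e \<longleftrightarrow> N \<le> e \<and> cf_digit (Suc e) x \<noteq> cf_digit e x" for e
  have "\<exists>e. Q e" using nc by (auto simp: ev_const_def Q_def)
  define e where "e = (LEAST e. Q e)"
  have Qe: "Q e" unfolding e_def using \<open>\<exists>e. Q e\<close> by (rule LeastI_ex)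
  have Qmin: "\<not> Q t" if "t < e" for t using that unfolding e_def by (rule not_less_Least)
  define L where "L = e - m"
  have e: "e = m + L" "l < L" using Qe m by (auto simp: L_def Q_def)
  have "cf_digit (m + i) x = cf_digit (m + 1) x" if "1 \<le> i" "i \<le> L" for i
    using that
  proof (induction i)
    case (Suc i)
    show ?case
    proof (cases "Suc i \<le> l + 1")
      case True
      then show ?thesis by (intro is_runD[OF m(2)]) auto
    next
      case False
      then have "\<not> Q (m + i)" using Suc.prems e by (intro Qmin) auto
      then show ?thesis using False Suc m by (auto simp: Q_def)
    qed
  qed simp
  then have run: "is_run x m L" unfolding is_run_def by auto
  have "real m \<le> b * real l"
  proof -
    have "run_length (m + l) x \<le> l"
    proof (rule ccontr)
      assume "\<not> run_length (m + l) x \<le> l"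
      then obtain n' where "n' \<le> m + l" "P n'" using ex[of "m + l"] n0 by auto
      then show False using Nmin[of n'] m by simp
    qed
    then have "(1 + b) * real (run_length (m + l) x) \<le> (1 + b) * real l"
      using b by (intro mult_left_mono) auto
    then have "real (m + l) \<le> (1 + b) * real l" using R[of "m + l"] n0 by simp
    then show ?thesis by (simp add: algebra_simps)
  qed
  moreover have "m \<le> j" if "is_run x j (L + 1)" for j
  proof -
    have "is_run x j (l + 1)" using e by (intro is_run_sub[OF that]) auto
    then have "P (j + (l + 1))" unfolding P_def by blast
    then show ?thesis using Nmin[of "j + (l + 1)"] m by simp
  qed
  ultimately show ?thesis using that[OF e(2) run] Qe e by (auto simp: Q_def)
qed

text \<open>Iterates \<open>record_step\<close>, each time with the full length of the run just
  found. Taking runs in full extent is what makes consecutive ones disjoint.\<close>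

lemma record_runs:
  assumes nc: "\<not> ev_const x" and R: "\<And>n. n0 \<le> n \<Longrightarrow> real n \<le> (1 + b) * real (run_length n x)"
    and b: "0 < b"
  obtains M \<Lambda> :: "nat \<Rightarrow> nat" where "\<And>k. is_run x (M k) (\<Lambda> k)" "\<And>k. M k + \<Lambda> k \<le> M (Suc k)"
    "\<And>k. real (M (Suc k)) \<le> b * real (\<Lambda> k)" "\<And>k. \<Lambda> k < \<Lambda> (Suc k)" "1 \<le> \<Lambda> 0"
proof -
  define n1 where "n1 = max 1 n0"
  have "\<forall>l. \<exists>m L. n1 \<le> l \<longrightarrow> l < L \<and> is_run x m L \<and> cf_digit (m + L + 1) x \<noteq> cf_digit (m + L) x \<and>
    (\<forall>j. is_run x j (L + 1) \<longrightarrow> m \<le> j) \<and> real m \<le> b * real l"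
  proof
    fix l
    show "\<exists>m L. n1 \<le> l \<longrightarrow> l < L \<and> is_run x m L \<and> cf_digit (m + L + 1) x \<noteq> cf_digit (m + L) x \<and>
    (\<forall>j. is_run x j (L + 1) \<longrightarrow> m \<le> j) \<and> real m \<le> b * real l"
    proof (cases "n1 \<le> l")
      case True
      have R': "real n \<le> (1 + b) * real (run_length n x)" if "n1 \<le> n" for n
        using that by (intro R) (simp add: n1_def)
      obtain m L where "l < L" "is_run x m L" "cf_digit (m + L + 1) x \<noteq> cf_digit (m + L) x"
        "\<And>j. is_run x j (L + 1) \<Longrightarrow> m \<le> j" "real m \<le> b * real l"
        by (rule record_step[OF nc R' _ True b]) (auto simp: n1_def)
      then show ?thesis by blast
    qed auto
  qed
  then obtain mm LL where S: "\<And>l. n1 \<le> l \<Longrightarrow> l < LL l" "\<And>l. n1 \<le> l \<Longrightarrow> is_run x (mm l) (LL l)"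
    "\<And>l. n1 \<le> l \<Longrightarrow> cf_digit (mm l + LL l + 1) x \<noteq> cf_digit (mm l + LL l) x"
    "\<And>l j. n1 \<le> l \<Longrightarrow> is_run x j (LL l + 1) \<Longrightarrow> mm l \<le> j" "\<And>l. n1 \<le> l \<Longrightarrow> real (mm l) \<le> b * real l"
    by metis
  define \<Lambda> where "\<Lambda> k = (LL ^^ (Suc k)) n1" for k
  define M where "M k = mm ((LL ^^ k) n1)" for k
  have ge: "n1 \<le> (LL ^^ k) n1" for k
  proof (induction k)
    case (Suc k)
    then show ?case using S(1)[of "(LL ^^ k) n1"] by simp
  qed simp
  have l: "(LL ^^ k) n1 < \<Lambda> k" for k using S(1)[OF ge[of k]] by (simp add: \<Lambda>_def)
  have run: "is_run x (M k) (\<Lambda> k)" for k using S(2)[OF ge[of k]] by (simp add: \<Lambda>_def M_def)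
  have disj: "M k + \<Lambda> k \<le> M (Suc k)" for k
  proof (rule ccontr)
    \<comment> \<open>The next record starts no earlier than \<open>M k\<close>. If it started
      before the end of the current one, it would contain the change of digit there.\<close>
    assume A: "\<not> M k + \<Lambda> k \<le> M (Suc k)"
    have ll: "\<Lambda> k < \<Lambda> (Suc k)" using l[of "Suc k"] by (simp add: \<Lambda>_def)
    have "is_run x (M (Suc k)) (\<Lambda> k + 1)"
      using ll by (intro is_run_sub[OF run[of "Suc k"]]) auto
    moreover from this have "M k \<le> M (Suc k)"
      using S(4)[OF ge[of k], of "M (Suc k)"] by (simp add: \<Lambda>_def M_def)
    ultimately have r: "is_run x (M (Suc k)) (\<Lambda> k + 1)" "M k \<le> M (Suc k)" .
    define i where "i = M k + \<Lambda> k - M (Suc k)"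
    have i: "M (Suc k) + i = M k + \<Lambda> k" "1 \<le> i" "i + 1 \<le> \<Lambda> k + 1" using A r(2) by (auto simp: i_def)
    have "cf_digit (M (Suc k) + (i + 1)) x = cf_digit (M (Suc k) + i) x"
      using is_runD[OF r(1), of i] is_runD[OF r(1), of "i + 1"] i(2,3) by simp
    moreover have "M (Suc k) + (i + 1) = M k + \<Lambda> k + 1" using i(1) by simp
    ultimately show False
      using S(3)[OF ge[of k]] i(1) by (simp add: \<Lambda>_def M_def)
  qed
  have bb: "real (M (Suc k)) \<le> b * real (\<Lambda> k)" for k using S(5)[OF ge[of "Suc k"]] by (simp add: M_def \<Lambda>_def)
  have ll: "\<Lambda> k < \<Lambda> (Suc k)" for k using l[of "Suc k"] by (simp add: \<Lambda>_def)
  have "1 \<le> \<Lambda> 0" using l[of 0] by (simp add: n1_def)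
  then show ?thesis using that run disj bb ll by blast
qed

text \<open>If \<open>L\<close> grows too slowly compared with the free positions at all late stages, then the
  ratios \<open>y = L (k+1) / L k\<close> satisfy \<open>y' \<le> y - \<delta>\<close>, since \<open>y + g b / y\<close> exceeds
  \<open>g (b - 1)\<close> by a fixed amount.\<close>

lemma ratio_infinitely_often:
  fixes L :: "nat \<Rightarrow> real" and M :: "nat \<Rightarrow> real"
  assumes L: "\<And>k. 0 < L k" and M: "\<And>k. M (Suc (Suc k)) \<le> b * (L (Suc k) - L k)"
    and g: "0 < g" and b: "0 < b" and gb: "g * (b - 1)\<^sup>2 < 4 * b"
  shows "\<exists>k\<ge>K. g * (M (Suc (Suc k)) - L (Suc k)) \<le> L (Suc (Suc k))"
proof (rule ccontr)
  assume "\<not> ?thesis"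
  then have A: "L (Suc (Suc k)) < g * (M (Suc (Suc k)) - L (Suc k))" if "K \<le> k" for k
    using that by (meson not_le)
  define y where "y k = L (Suc k) / L k" for k
  have y0: "0 < y k" for k using L by (simp add: y_def)
  \<comment> \<open>By the inequality of arithmetic and geometric means \<open>y + g * b / y\<close>
    is at least \<open>2 * sqrt (g * b)\<close>, and \<open>gb\<close> says that this exceeds
    \<open>g * (b - 1)\<close>.\<close>
  define \<delta> where "\<delta> = 2 * sqrt (g * b) - g * (b - 1)"
  have "g * (b - 1) < 2 * sqrt (g * b)"
  proof -
    have "(g * (b - 1))\<^sup>2 < 4 * (g * b)"
      using mult_strict_left_mono[OF gb g] by (simp add: power2_eq_square algebra_simps)
    then have "sqrt ((g * (b - 1))\<^sup>2) < sqrt (4 * (g * b))" by (rule real_sqrt_less_mono)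
    then have "\<bar>g * (b - 1)\<bar> < 2 * sqrt (g * b)" by (simp only: real_sqrt_abs real_sqrt_mult[of 4]) simp
    then show ?thesis by linarith
  qed
  then have \<delta>: "0 < \<delta>" by (simp add: \<delta>_def)
  have step: "y (Suc k) \<le> y k - \<delta>" if "K \<le> k" for k
  proof -
    have "L (Suc (Suc k)) \<le> g * (b * (L (Suc k) - L k) - L (Suc k))"
      using A[OF that] M[of k] g by (smt (verit) mult_left_mono)
    then have "y (Suc k) \<le> g * (b * (L (Suc k) - L k) - L (Suc k)) / L (Suc k)"
      using L[of "Suc k"] unfolding y_def by (intro divide_right_mono) auto
    also have "\<dots> = g * (b - 1) - g * b / y k"
      using L[of k] L[of "Suc k"] by (simp add: y_def field_simps)
    finally have 1: "y (Suc k) \<le> g * (b - 1) - g * b / y k" .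
    have "2 * sqrt (g * b) \<le> y k + g * b / y k"
    proof -
      have "0 \<le> (sqrt (y k) - sqrt (g * b / y k))\<^sup>2" by simp
      also have "\<dots> = y k + g * b / y k - 2 * (sqrt (y k) * sqrt (g * b / y k))"
        using y0[of k] g b by (simp add: power2_diff)
      also have "sqrt (y k) * sqrt (g * b / y k) = sqrt (g * b)"
        using y0[of k] by (simp add: real_sqrt_mult[symmetric])
      finally show ?thesis by simp
    qed
    then show ?thesis using 1 by (simp add: \<delta>_def)
  qed
  have "y (K + n) \<le> y K - real n * \<delta>" for n
  proof (induction n)
    case (Suc n)
    then show ?case using step[of "K + n"] by (simp add: algebra_simps)
  qed simp
  moreover obtain n :: nat where "y K < real n * \<delta>" using reals_Archimedean3[OF \<delta>] by blast
  ultimately show False using y0[of "K + n"] by (smt (verit))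
qed

text \<open>A triple \<open>(v, d, l)\<close> is a free word \<open>v\<close> followed by a run of \<open>l\<close> digits \<open>d\<close>.\<close>

type_synonym decorated = "(nat list \<times> nat \<times> nat) list"

definition seg_word :: "nat list \<times> nat \<times> nat \<Rightarrow> nat list" where
  "seg_word = (\<lambda>(v, d, l). v @ replicate l d)"

definition dec_word :: "decorated \<Rightarrow> nat list" where
  "dec_word D = concat (map seg_word D)"

definition free_len :: "decorated \<Rightarrow> nat" where
  "free_len D = sum_list (map (\<lambda>(v, d, l). length v) D)"

definition run_total :: "decorated \<Rightarrow> nat" where
  "run_total D = sum_list (map (\<lambda>(v, d, l). l) D)"

definition dec_ok :: "decorated \<Rightarrow> bool" where
  "dec_ok D \<longleftrightarrow> (\<forall>(v, d, l)\<in>set D. 0 \<notin> set v \<and> 1 \<le> d \<and> 1 \<le> l)"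

lemma decorated_prefix:
  assumes x: "x \<in> {0..<1}" "x \<notin> \<rat>"
    and run: "\<And>k. is_run x (M k) (\<Lambda> k)" and disj: "\<And>k. M k + \<Lambda> k \<le> M (Suc k)"
    and pos: "\<And>k. 1 \<le> \<Lambda> k"
  obtains D where "dec_ok D" "length D = Suc k" "dec_word D = cf_prefix (M k + \<Lambda> k) x"
    "run_total D = (\<Sum>j\<le>k. \<Lambda> j)" "free_len D + run_total D = M k + \<Lambda> k"
proof -
  define E where "E k = (case k of 0 \<Rightarrow> 0 | Suc i \<Rightarrow> M i + \<Lambda> i)" for k
  have E0: "E 0 = 0" and ES: "E (Suc i) = M i + \<Lambda> i" for i by (simp_all add: E_def)
  have EM: "E k \<le> M k" for k using disj by (cases k) (auto simp: E0 ES)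
  let ?d = "\<lambda>i. cf_digit (Suc i) x"
  define t where "t j = (map ?d [E j..<M j], ?d (M j), \<Lambda> j)" for j
  define D where "D k = map t [0..<k]" for k
  have seg: "seg_word (t j) = map ?d [E j..<E (Suc j)]" for j
  proof -
    have "replicate (\<Lambda> j) (?d (M j)) = map ?d [M j..<M j + \<Lambda> j]"
    proof (rule nth_equalityI)
      fix i assume "i < length (replicate (\<Lambda> j) (?d (M j)))"
      then have i: "i < \<Lambda> j" by simp
      have "cf_digit (M j + Suc i) x = cf_digit (M j + 1) x"
        using i by (intro is_runD[OF run]) auto
      then show "replicate (\<Lambda> j) (?d (M j)) ! i = map ?d [M j..<M j + \<Lambda> j] ! i" using i by simp
    qed simp
    then show ?thesis
      using EM[of j] upt_add_eq_append[of "E j" "M j" "\<Lambda> j"] by (simp add: seg_word_def t_def ES)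
  qed
  have W: "dec_word (D k) = cf_prefix (E k) x \<and> run_total (D k) = (\<Sum>j<k. \<Lambda> j) \<and>
      free_len (D k) + run_total (D k) = E k" for k
  proof (induction k)
    case (Suc k)
    have le: "E k \<le> E (Suc k)" using EM[of k] by (simp add: ES)
    have D: "D (Suc k) = D k @ [t k]" by (simp add: D_def)
    have "dec_word (D (Suc k)) = dec_word (D k) @ seg_word (t k)"
      by (simp add: D dec_word_def)
    also have "\<dots> = map ?d ([0..<E k] @ [E k..<E (Suc k)])"
      using Suc by (simp add: seg cf_prefix_def)
    also have "[0..<E k] @ [E k..<E (Suc k)] = [0..<E (Suc k)]"
      using upt_add_eq_append[of 0 "E k" "E (Suc k) - E k"] le by simp
    finally have "dec_word (D (Suc k)) = cf_prefix (E (Suc k)) x" by (simp add: cf_prefix_def)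
    moreover have "free_len (D k) + run_total (D k) = E k" "run_total (D k) = (\<Sum>j<k. \<Lambda> j)"
      using Suc by auto
    ultimately show ?case using EM[of k] by (simp add: D run_total_def free_len_def t_def ES)
  qed (simp add: D_def E0 dec_word_def cf_prefix_def run_total_def free_len_def)
  have ok: "dec_ok (D k)" for k
  proof -
    have d: "1 \<le> ?d i" for i by (rule cf_digit_ge_1[OF x]) simp
    have "0 \<noteq> ?d i" for i using d[of i] by simp
    then have "0 \<notin> ?d ` A" for A by (simp add: image_iff)
    then show ?thesis using pos d by (simp add: dec_ok_def D_def t_def)
  qed
  have len: "length (D k) = k" for k by (simp add: D_def)
  show ?thesis using that[of "D (Suc k)"] W[of "Suc k"] ok len by (auto simp: ES lessThan_Suc_atMost)
qed

text \<open>The free letters are those before the last run minus the earlier runs, which is the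
  quantity in \<open>ratio_infinitely_often\<close>. The last inequality, for arbitrary
  \<open>w\<close>, later pays for the choice of the run patterns.\<close>

lemma exists_decorated:
  assumes x: "x \<in> {0..<1}" "x \<notin> \<rat>"
    and nc: "\<not> ev_const x" and R: "\<And>n. n0 \<le> n \<Longrightarrow> real n \<le> (1 + b) * real (run_length n x)"
    and b: "0 < b" and g: "0 < g" and gb: "g * (b - 1)\<^sup>2 < 4 * b"
  shows "\<exists>D. dec_ok D \<and> K \<le> length D \<and> (\<exists>n. cf_prefix n x = dec_word D) \<and>
    g * real (free_len D) \<le> real (run_total D) \<and> w * length D \<le> free_len D + run_total D"
proof -
  obtain M \<Lambda> where rr: "\<And>k. is_run x (M k) (\<Lambda> k)" "\<And>k. M k + \<Lambda> k \<le> M (Suc k)"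
    "\<And>k. real (M (Suc k)) \<le> b * real (\<Lambda> k)" "\<And>k. \<Lambda> k < \<Lambda> (Suc k)" "1 \<le> \<Lambda> 0"
    using record_runs[OF nc R b] by blast
  have \<Lambda>: "Suc k \<le> \<Lambda> k" for k
  proof (induction k)
    case (Suc k)
    then show ?case using rr(4)[of k] by simp
  qed (use rr(5) in simp)
  have \<Lambda>1: "1 \<le> \<Lambda> k" for k using \<Lambda>[of k] by simp
  define L where "L k = real (\<Sum>j\<le>k. \<Lambda> j)" for k
  have L0: "0 < L k" for k
  proof -
    have "\<Lambda> 0 \<le> (\<Sum>j\<le>k. \<Lambda> j)" by (rule member_le_sum) auto
    then show ?thesis using rr(5) by (simp add: L_def del: of_nat_sum)
  qed
  have M_le: "real (M (Suc (Suc k))) \<le> b * (L (Suc k) - L k)" for k using rr(3)[of "Suc k"] by (simp add: L_def)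
  obtain k where
    k: "K + 2 * w \<le> k" "g * (real (M (Suc (Suc k))) - L (Suc k)) \<le> L (Suc (Suc k))"
    using ratio_infinitely_often[where L = L and M = "\<lambda>k. real (M k)" and K = "K + 2 * w", OF L0 M_le g b gb] by blast
  obtain D where D: "dec_ok D" "length D = Suc (Suc (Suc k))"
    "dec_word D = cf_prefix (M (Suc (Suc k)) + \<Lambda> (Suc (Suc k))) x"
    "run_total D = (\<Sum>j\<le>Suc (Suc k). \<Lambda> j)" "free_len D + run_total D = M (Suc (Suc k)) + \<Lambda> (Suc (Suc k))"
    by (rule decorated_prefix[where M = M and \<Lambda> = \<Lambda> and k = "Suc (Suc k)", OF x rr(1,2) \<Lambda>1])
  have "real (free_len D) = real (M (Suc (Suc k))) - L (Suc k)"
    using D(4,5) by (simp add: L_def algebra_simps flip: of_nat_add of_nat_sum)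
  then have "g * real (free_len D) \<le> real (run_total D)" using k(2) D(4) by (simp add: L_def)
  moreover have "w * length D \<le> free_len D + run_total D"
  proof -
    \<comment> \<open>Strictly increasing run lengths have at least a triangular number as their
      sum, which outgrows \<open>w\<close> times the number of segments.\<close>
    define s where "s = (\<Sum>j\<le>Suc (Suc k). Suc j)"
    have "(\<Sum>j\<le>n. Suc j) * 2 = Suc n * (n + 2)" for n by (induction n) auto
    then have "s * 2 = length D * (Suc (Suc k) + 2)" using D(2) unfolding s_def by simp
    moreover have "length D * (2 * w) \<le> length D * (Suc (Suc k) + 2)" using k by (intro mult_left_mono) auto
    ultimately have "w * length D \<le> s" by (simp only: mult.commute mult.left_commute)
    also have "s \<le> run_total D" unfolding D(4) s_def using \<Lambda> by (rule sum_mono)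
    finally show ?thesis by simp
  qed
  moreover have "\<exists>n. cf_prefix n x = dec_word D" using D(3) by (intro exI) (rule sym)
  moreover have "K \<le> length D" using D(2) k by simp
  ultimately show ?thesis using D(1) by blast
qed

subsection \<open>Upper bound\<close>

text \<open>With \<open>L = g * f + t\<close> the claim reduces to \<open>r powr f * \<sigma> powr t
  \<le> \<eta> powr ((1 + 2 * g) * f + 2 * t)\<close>, which dictates the two conditions on \<eta>.
  Of the gain, \<open>\<eta> powr L\<close> makes the sum over run lengths converge and
  \<open>\<eta> powr (f + L)\<close> pays for the number of segments.\<close>

lemma key_weights:
  fixes \<sigma> g r f L :: real
  assumes \<sigma>: "0 < \<sigma>" "\<sigma> < 1" and r: "0 < r" "r < 1" and g: "0 < g"
    and \<eta>: "\<sigma> powr (1/2) \<le> \<eta>" "r powr (1 / (1 + 2 * g)) \<le> \<eta>"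
    and f: "0 \<le> f" "g * f \<le> L"
  shows "\<sigma> powr L \<le> (\<sigma> powr g / r) powr f * \<eta> powr L * \<eta> powr (f + L)"
proof -
  define t where "t = L - g * f"
  have t: "0 \<le> t" "L = g * f + t" using f by (auto simp: t_def)
  have \<eta>0: "0 < \<eta>" using \<eta>(1) \<sigma> by (smt (verit) powr_gt_zero)
  have 1: "\<sigma> powr t \<le> \<eta> powr (2 * t)"
  proof -
    have "\<sigma> powr t = (\<sigma> powr (1/2)) powr (2 * t)" by (simp add: powr_powr)
    also have "\<dots> \<le> \<eta> powr (2 * t)" using \<eta>(1) t by (intro powr_mono2) auto
    finally show ?thesis .
  qed
  have 2: "r powr f \<le> \<eta> powr ((1 + 2 * g) * f)"
  proof -
    have "r powr f = (r powr (1 / (1 + 2 * g))) powr ((1 + 2 * g) * f)" using g by (simp add: powr_powr)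
    also have "\<dots> \<le> \<eta> powr ((1 + 2 * g) * f)" using \<eta>(2) f g by (intro powr_mono2) auto
    finally show ?thesis .
  qed
  have "\<sigma> powr L = (\<sigma> powr g / r) powr f * (r powr f * \<sigma> powr t)"
    using r \<sigma> by (simp add: t(2) powr_add powr_divide powr_powr)
  also have "\<dots> \<le> (\<sigma> powr g / r) powr f * (\<eta> powr ((1 + 2 * g) * f) * \<eta> powr (2 * t))"
    using 1 2 by (intro mult_left_mono mult_mono) auto
  also have "\<eta> powr ((1 + 2 * g) * f) * \<eta> powr (2 * t) = \<eta> powr L * \<eta> powr (f + L)"
    unfolding powr_add[symmetric] t(2) by (simp add: algebra_simps)
  finally show ?thesis by (simp add: mult.assoc)
qed

text \<open>\<open>golden powr (4 * \<rho>)\<close> is the loss of two powers of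
  \<open>golden\<close> in \<open>qw_replicate_ge\<close>. The true decay along a run is left out:
  it has to be traded against free letters of the whole word, so \<open>dec_weight\<close> collects
  it for all runs together.\<close>

definition seg_weight :: "real \<Rightarrow> real \<Rightarrow> real \<Rightarrow> nat list \<times> nat \<times> nat \<Rightarrow> real" where
  "seg_weight \<rho> y \<eta> = (\<lambda>(v, d, l). qw v powr (- (2 * \<rho>)) * y ^ length v *
     (real d powr (- (2 * \<rho>)) * (golden powr (4 * \<rho>) * \<eta> ^ l)))"

lemma dec_word_pos: "dec_ok D \<Longrightarrow> 0 \<notin> set (dec_word D)"
  by (fastforce simp: dec_ok_def dec_word_def seg_word_def)

lemma dec_weight:
  assumes "dec_ok D" "0 < y" "0 < \<eta>" "0 < \<rho>"
  shows "qw (dec_word D) powr (- (2 * \<rho>)) * (y ^ free_len D * \<eta> ^ run_total D) \<le>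
    prod_list (map (seg_weight \<rho> y \<eta>) D) * (golden powr (- (2 * \<rho>))) ^ run_total D"
  using assms(1)
proof (induction D)
  case (Cons z D)
  obtain v d l where z: "z = (v, d, l)" by (cases z)
  have ok: "dec_ok D" "0 \<notin> set v" "1 \<le> d" "1 \<le> l" using Cons.prems by (auto simp: dec_ok_def z)
  have p: "0 < qw v" "0 < qw (dec_word D)" using cden_pos ok dec_word_pos by auto
  have w: "dec_word (z # D) = v @ (replicate l d @ dec_word D)" by (simp add: dec_word_def seg_word_def z)
  have "qw v * (real d * golden powr (real l - 2) * qw (dec_word D)) \<le> qw (dec_word (z # D))"
  proof -
    have "real d * golden powr (real l - 2) * qw (dec_word D) \<le> qw (replicate l d) * qw (dec_word D)"
      using qw_replicate_ge[OF ok(3,4)] p by (intro mult_right_mono) auto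
    also have "\<dots> \<le> qw (replicate l d @ dec_word D)"
      using ok dec_word_pos[OF ok(1)] by (intro qw_append) auto
    finally have "qw v * (real d * golden powr (real l - 2) * qw (dec_word D)) \<le> qw v * qw (replicate l d @ dec_word D)"
      using p by (intro mult_left_mono) auto
    also have "\<dots> \<le> qw (dec_word (z # D))"
      unfolding w using ok dec_word_pos[OF ok(1)] by (intro qw_append) auto
    finally show ?thesis .
  qed
  then have "qw (dec_word (z # D)) powr (- (2 * \<rho>)) \<le> (qw v * (real d * golden powr (real l - 2) * qw (dec_word D))) powr (- (2 * \<rho>))"
    using p ok assms golden_gt_1 by (intro powr_mono2') auto
  also have "\<dots> = qw v powr (- (2 * \<rho>)) * (real d powr (- (2 * \<rho>)) * (golden powr (4 * \<rho>) * (golden powr (- (2 * \<rho>))) ^ l)) * qw (dec_word D) powr (- (2 * \<rho>))"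
  proof -
    have "(golden powr (real l - 2)) powr (- (2 * \<rho>)) = golden powr (4 * \<rho>) * (golden powr (- (2 * \<rho>))) ^ l"
      using golden_gt_1 by (simp add: powr_powr powr_add[symmetric] algebra_simps flip: powr_realpow)
    then show ?thesis by (simp only: powr_mult mult.assoc)
  qed
  finally have "qw (dec_word (z # D)) powr (- (2 * \<rho>)) * (y ^ free_len (z # D) * \<eta> ^ run_total (z # D)) \<le>
     (qw v powr (- (2 * \<rho>)) * (real d powr (- (2 * \<rho>)) * (golden powr (4 * \<rho>) * (golden powr (- (2 * \<rho>))) ^ l)) * qw (dec_word D) powr (- (2 * \<rho>))) * (y ^ free_len (z # D) * \<eta> ^ run_total (z # D))"
    using assms by (intro mult_right_mono) auto
  also have "\<dots> = seg_weight \<rho> y \<eta> z * (golden powr (- (2 * \<rho>))) ^ l * (qw (dec_word D) powr (- (2 * \<rho>)) * (y ^ free_len D * \<eta> ^ run_total D))"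
    by (simp add: z seg_weight_def free_len_def run_total_def power_add mult_ac)
  also have "\<dots> \<le> seg_weight \<rho> y \<eta> z * (golden powr (- (2 * \<rho>))) ^ l * (prod_list (map (seg_weight \<rho> y \<eta>) D) * (golden powr (- (2 * \<rho>))) ^ run_total D)"
    using Cons.IH[OF ok(1)] assms by (intro mult_left_mono) (auto simp: seg_weight_def z)
  finally show ?case by (simp add: z run_total_def power_add mult_ac)
qed (simp add: dec_word_def free_len_def run_total_def)

text \<open>The cover consists of the cylinders of all decorated words with at least
  \<open>K\<close> segments that satisfy the two inequalities of \<open>exists_decorated\<close>. A
  prefix may arise from several decorations, which only enlarges the sum; the sum is of order
  \<open>(1 / 2) ^ K\<close>.\<close>

lemma hausdorff_measure_zero_long_runs:
  assumes \<rho>: "1 / 2 < \<rho>" and g: "0 < g" and n1: "1 \<le> n1" "Asum n1 g \<rho> < 1"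
    and b: "0 < b" and gb: "g * (b - 1)\<^sup>2 < 4 * b"
    and F: "\<And>x. x \<in> F \<Longrightarrow> x \<in> {0..<1} \<and> x \<notin> \<rat> \<and> \<not> ev_const x \<and>
      (\<exists>n0. \<forall>n\<ge>n0. real n \<le> (1 + b) * real (run_length n x))"
  shows "hausdorff_measure \<rho> F = 0"
proof -
  obtain C \<kappa> where C: "0 < C" "0 < \<kappa>" "\<kappa> < 1" "\<And>n. Asum n g \<rho> \<le> ennreal (C * \<kappa> ^ n)"
    using Asum_geometric[OF \<rho> n1] by blast
  \<comment> \<open>The decay \<kappa> is split into two equal factors: one makes the sum over free
    words converge, the other is the slack in \<open>key_weights\<close>.\<close>
  define r where "r = sqrt \<kappa>"
  have r: "0 < r" "r < 1" "r * r = \<kappa>" using C by (auto simp: r_def)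
  define \<sigma> where "\<sigma> = golden powr (- (2 * \<rho>))"
  have \<sigma>: "0 < \<sigma>" "\<sigma> < 1"
    using golden_gt_1 \<rho> powr_less_mono[of "- (2 * \<rho>)" 0 golden] by (auto simp: \<sigma>_def)
  define y where "y = \<sigma> powr g / r"
  have y: "0 < y" using \<sigma> r by (simp add: y_def)
  define \<eta> where "\<eta> = max (\<sigma> powr (1/2)) (r powr (1 / (1 + 2 * g)))"
  have \<eta>: "0 < \<eta>" "\<eta> < 1"
    using \<sigma> r g powr_less_mono2[of "1/2" \<sigma> 1] powr_less_mono2[of "1 / (1 + 2 * g)" r 1]
    by (auto simp: \<eta>_def less_max_iff_disj)
  define hh where "hh z = (case z of (v, d, l) \<Rightarrow> qweight \<rho> v * ennreal (y ^ length v) *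
      (ennreal (real d powr (- (2 * \<rho>))) * ennreal (golden powr (4 * \<rho>) * \<eta> ^ l)))" for z :: "nat list \<times> nat \<times> nat"
  define S where "S = (\<integral>\<^sup>+ z. hh z \<partial>count_space UNIV)"
  \<comment> \<open>The sum factors into sums over \<open>v\<close>, \<open>d\<close> and
    \<open>l\<close>; the one over the digit \<open>d\<close> of a run converges because \<rho>
    exceeds 1/2.\<close>
  have fin: "S < \<infinity>"
  proof -
    have V: "(\<integral>\<^sup>+ v. qweight \<rho> v * ennreal (y ^ length v) \<partial>count_space UNIV) < \<infinity>"
    proof -
      have "(\<integral>\<^sup>+ v. (if length v = n then qweight \<rho> v * ennreal (y ^ length v) else 0) \<partial>count_space UNIV) \<le> ennreal (C * r ^ n)" for n
      proof -
        have "(\<integral>\<^sup>+ v. (if length v = n then qweight \<rho> v * ennreal (y ^ length v) else 0) \<partial>count_space UNIV) =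
          (\<integral>\<^sup>+ v. (if length v = n then qweight \<rho> v else 0) * ennreal (y ^ n) \<partial>count_space UNIV)"
          by (intro nn_integral_cong) auto
        also have "\<dots> = Zsum n \<rho> * ennreal (y ^ n)" by (simp add: nn_integral_multc Zsum_def)
        also have "y ^ n = golden powr (- (2 * \<rho> * g * real n)) * (1 / r ^ n)"
          using \<sigma> golden_gt_1 by (simp add: y_def \<sigma>_def power_divide powr_powr flip: powr_realpow)
        also have "Zsum n \<rho> * ennreal \<dots> = Asum n g \<rho> * ennreal (1 / r ^ n)"
          using r by (subst ennreal_mult) (auto simp: Asum_def mult_ac)
        also have "\<dots> \<le> ennreal (C * \<kappa> ^ n) * ennreal (1 / r ^ n)"
          using C(4)[of n] by (intro mult_right_mono) auto
        also have "\<dots> = ennreal (C * r ^ n)"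
        proof -
          have "\<kappa> ^ n = r ^ n * r ^ n" unfolding r(3)[symmetric] by (rule power_mult_distrib)
          then show ?thesis using C(1,2) r(1) by (simp add: ennreal_mult[symmetric])
        qed
        finally show ?thesis .
      qed
      then have "(\<integral>\<^sup>+ v. qweight \<rho> v * ennreal (y ^ length v) \<partial>count_space UNIV) \<le> (\<Sum>n. ennreal (C * r ^ n))"
        by (subst nn_integral_lists_by_length) (intro suminf_le, auto)
      also have "\<dots> = ennreal (\<Sum>n. C * r ^ n)"
        using C r by (intro suminf_ennreal2 summable_mult summable_geometric) auto
      finally show ?thesis by (rule le_less_trans) simp
    qed
    have Dd: "(\<integral>\<^sup>+ d. ennreal (real d powr (- (2 * \<rho>))) \<partial>count_space UNIV) < \<infinity>"
    proof -
      have "summable (\<lambda>n. real n powr (- (2 * \<rho>)))" using \<rho> by (subst summable_real_powr_iff) simp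
      then show ?thesis unfolding nn_integral_count_space_nat by (subst suminf_ennreal2) auto
    qed
    have Ll: "(\<integral>\<^sup>+ l. ennreal (golden powr (4 * \<rho>) * \<eta> ^ l) \<partial>count_space UNIV) < \<infinity>"
    proof -
      have "summable (\<lambda>l. golden powr (4 * \<rho>) * \<eta> ^ l)" using \<eta> by (intro summable_mult summable_geometric) auto
      then show ?thesis unfolding nn_integral_count_space_nat using \<eta> by (subst suminf_ennreal2) auto
    qed
    have "S = (\<integral>\<^sup>+ v. \<integral>\<^sup>+ dl. hh (v, dl) \<partial>count_space UNIV \<partial>count_space UNIV)"
      unfolding S_def by (rule nn_integral_fst_count_space[symmetric])
    also have "\<dots> = (\<integral>\<^sup>+ v. \<integral>\<^sup>+ d. \<integral>\<^sup>+ l. hh (v, d, l) \<partial>count_space UNIV \<partial>count_space UNIV \<partial>count_space UNIV)"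
      by (intro nn_integral_cong nn_integral_fst_count_space[symmetric])
    also have "\<dots> = (\<integral>\<^sup>+ v. qweight \<rho> v * ennreal (y ^ length v) \<partial>count_space UNIV) *
       ((\<integral>\<^sup>+ d. ennreal (real d powr (- (2 * \<rho>))) \<partial>count_space UNIV) *
        (\<integral>\<^sup>+ l. ennreal (golden powr (4 * \<rho>) * \<eta> ^ l) \<partial>count_space UNIV))"
      by (simp add: hh_def nn_integral_cmult nn_integral_multc)
    also have "\<dots> < \<infinity>" using V Dd Ll by (simp add: ennreal_mult_less_top)
    finally show ?thesis .
  qed
  then obtain s0 where s0: "S = ennreal s0" "0 \<le> s0" by (cases S) auto
  have "(\<lambda>n. s0 * \<eta> ^ n) \<longlonglongrightarrow> s0 * 0" using \<eta> by (intro tendsto_intros LIMSEQ_power_zero) auto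
  then have "eventually (\<lambda>n. s0 * \<eta> ^ n < 1 / 4) sequentially" by (intro order_tendstoD(2)) auto
  then obtain w where w: "s0 * \<eta> ^ w < 1 / 4" by (auto simp: eventually_sequentially)
  \<comment> \<open>\<open>w\<close> letters per segment yield a factor \<open>\<eta> ^ w\<close>,
    which brings the sum over one segment below 1/4. The factor 2 is withheld from each segment in
    order to gain \<open>(1 / 2) ^ K\<close> in the end.\<close>
  define ww where "ww z = ennreal (2 * \<eta> ^ w) * hh z" for z
  have sumw: "(\<integral>\<^sup>+ z. ww z \<partial>count_space UNIV) \<le> ennreal (1 / 2)"
  proof -
    have "(\<integral>\<^sup>+ z. ww z \<partial>count_space UNIV) = ennreal (2 * \<eta> ^ w) * S"
      by (simp add: ww_def nn_integral_cmult S_def)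
    also have "\<dots> = ennreal (2 * (s0 * \<eta> ^ w))" using \<eta> s0 by (simp add: ennreal_mult[symmetric] mult_ac)
    also have "\<dots> \<le> ennreal (1 / 2)" using w by (intro ennreal_leI) simp
    finally show ?thesis .
  qed
  have prodw: "prod_list (map ww D) = ennreal (prod_list (map (seg_weight \<rho> y \<eta>) D) * (2 * \<eta> ^ w) ^ length D)
      \<and> 0 \<le> prod_list (map (seg_weight \<rho> y \<eta>) D)" if "dec_ok D" for D
    using that
  proof (induction D)
    case (Cons z D)
    obtain v d l where z: "z = (v, d, l)" by (cases z)
    have ok: "dec_ok D" "0 \<notin> set v" using Cons.prems by (auto simp: dec_ok_def z)
    have sw0: "0 \<le> seg_weight \<rho> y \<eta> z" using y \<eta> by (simp add: seg_weight_def z)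
    have "hh z = ennreal (seg_weight \<rho> y \<eta> z)"
      using ok y \<eta> by (simp add: hh_def z qweight_def seg_weight_def ennreal_mult)
    then have "ww z = ennreal (2 * \<eta> ^ w * seg_weight \<rho> y \<eta> z)" using \<eta> sw0 by (simp add: ww_def ennreal_mult)
    then have "prod_list (map ww (z # D)) = ennreal ((2 * \<eta> ^ w * seg_weight \<rho> y \<eta> z) * (prod_list (map (seg_weight \<rho> y \<eta>) D) * (2 * \<eta> ^ w) ^ length D))"
      using Cons.IH[OF ok(1)] \<eta> sw0 by (subst ennreal_mult) auto
    then show ?case using Cons.IH[OF ok(1)] sw0 by (simp add: mult_ac)
  qed simp
  define cond where "cond K D \<longleftrightarrow> dec_ok D \<and> K \<le> length D \<and> g * real (free_len D) \<le> real (run_total D) \<and>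
      w * length D \<le> free_len D + run_total D" for K D
  have bound: "ennreal (qw (dec_word D) powr (- (2 * \<rho>))) \<le> ennreal ((1 / 2) ^ K) * prod_list (map ww D)"
    if "cond K D" for K D
  proof -
    have D: "dec_ok D" "K \<le> length D" "g * real (free_len D) \<le> real (run_total D)"
      "w * length D \<le> free_len D + run_total D" using that by (auto simp: cond_def)
    define P where "P = prod_list (map (seg_weight \<rho> y \<eta>) D)"
    have P0: "0 \<le> P" using prodw[OF D(1)] by (simp add: P_def)
    let ?f = "free_len D" and ?L = "run_total D"
    have "0 < \<rho>" using \<rho> by simp
    note dw = dec_weight[OF D(1) y \<eta>(1) this]
    \<comment> \<open>The auxiliary factor \<open>y ^ ?f * \<eta> ^ ?L\<close> of
      \<open>dec_weight\<close> reappears here on the right and cancels, which leaves the gain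
      \<open>\<eta> ^ (?f + ?L)\<close>.\<close>
    have key: "\<sigma> ^ ?L \<le> y ^ ?f * \<eta> ^ ?L * \<eta> ^ (?f + ?L)"
      using key_weights[OF \<sigma> r(1,2) g, of \<eta> "real ?f" "real ?L"] D(3) \<sigma> y \<eta>
      by (simp add: \<eta>_def[symmetric] y_def[symmetric] powr_realpow flip: of_nat_add) (simp add: \<eta>_def powr_realpow)
    have "qw (dec_word D) powr (- (2 * \<rho>)) * (y ^ ?f * \<eta> ^ ?L) \<le> P * (y ^ ?f * \<eta> ^ ?L * \<eta> ^ (?f + ?L))"
      using order_trans[OF dw mult_left_mono[OF key P0, unfolded P_def \<sigma>_def]] by (simp only: P_def)
    also have "\<dots> = P * \<eta> ^ (?f + ?L) * (y ^ ?f * \<eta> ^ ?L)" by simp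
    finally have "qw (dec_word D) powr (- (2 * \<rho>)) \<le> P * \<eta> ^ (?f + ?L)"
      using y \<eta> by (subst (asm) mult_le_cancel_right_pos) auto
    also have "\<dots> \<le> P * \<eta> ^ (w * length D)"
      using P0 \<eta> D(4) by (intro mult_left_mono power_decreasing) auto
    also have "\<dots> = (1 / 2) ^ length D * (P * (2 * \<eta> ^ w) ^ length D)"
      by (simp add: power_mult_distrib power_mult[symmetric] power_one_over)
    also have "\<dots> \<le> (1 / 2) ^ K * (P * (2 * \<eta> ^ w) ^ length D)"
      using P0 \<eta> D(2) by (intro mult_right_mono power_decreasing) auto
    finally have "ennreal (qw (dec_word D) powr (- (2 * \<rho>))) \<le> ennreal ((1 / 2) ^ K * (P * (2 * \<eta> ^ w) ^ length D))"
      by (rule ennreal_leI)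
    also have "\<dots> = ennreal ((1 / 2) ^ K) * prod_list (map ww D)"
      using prodw[OF D(1)] P0 \<eta> by (subst ennreal_mult) (auto simp: P_def)
    finally show ?thesis .
  qed
  show ?thesis
  proof (rule hausdorff_measure_zeroI[where 'i = "(nat list \<times> nat \<times> nat) list"])
    show "0 < \<rho>" using \<rho> by simp
    fix e :: real assume e: "0 < e"
    then obtain K where K: "(1 / 2) ^ K < e / 2" using real_arch_pow_inv[of "e / 2" "1 / 2"] by auto
    let ?U = "\<lambda>D. {x \<in> {0..<1}. x \<notin> \<rat> \<and> (\<exists>n. cf_prefix n x = dec_word D)}"
    let ?B = "\<lambda>D. if cond K D then ?U D else {}"
    show "\<exists>B :: decorated \<Rightarrow> real set. F \<subseteq> (\<Union>i. B i) \<and> (\<forall>i. bounded (B i)) \<and>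
      (\<integral>\<^sup>+ i. hausdorff_gauge \<rho> (B i) \<partial>count_space UNIV) \<le> ennreal e"
    proof (intro exI[of _ ?B] conjI allI)
      show "F \<subseteq> (\<Union>D. ?B D)"
      proof
        fix x assume "x \<in> F"
        from F[OF this] obtain n0 where x: "x \<in> {0..<1}" "x \<notin> \<rat>" "\<not> ev_const x"
          "\<And>n. n0 \<le> n \<Longrightarrow> real n \<le> (1 + b) * real (run_length n x)" by blast
        from exists_decorated[where K = K and w = w, OF x b g gb] obtain D where
          "cond K D" "\<exists>n. cf_prefix n x = dec_word D" unfolding cond_def by blast
        then have "x \<in> ?B D" using x by auto
        then show "x \<in> (\<Union>D. ?B D)" by blast
      qed
      have "bounded {0..<1::real}" by simp
      then show "bounded (?B D)" for D by (rule bounded_subset) auto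
      have "hausdorff_gauge \<rho> (?B D) \<le> ennreal ((1 / 2) ^ K) * prod_list (map ww D)" for D
      proof (cases "cond K D \<and> ?U D \<noteq> {}")
        case True
        then have cD: "cond K D" and ne: "?U D \<noteq> {}" by auto
        have pos: "0 < qw (dec_word D)" using cD dec_word_pos cden_pos by (simp add: cond_def)
        have "diameter (?U D) \<le> 1 / qw (dec_word D) ^ 2"
        proof (rule diameter_le)
          fix x z assume A: "x \<in> ?U D" "z \<in> ?U D"
          then obtain n m where nm: "cf_prefix n x = dec_word D" "cf_prefix m z = dec_word D" by blast
          then have "n = m" by (metis length_cf_prefix)
          then show "norm (x - z) \<le> 1 / qw (dec_word D) ^ 2"
            using A nm cf_prefix_dist[of x z n "dec_word D"] by simp
        qed (use ne in simp)
        moreover have "0 \<le> diameter (?U D)"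
          by (intro diameter_ge_0) (rule bounded_subset[OF \<open>bounded {0..<1::real}\<close>], auto)
        ultimately have "diameter (?U D) powr \<rho> \<le> (1 / qw (dec_word D) ^ 2) powr \<rho>"
          using \<rho> by (intro powr_mono2) auto
        also have "\<dots> = qw (dec_word D) powr (- (2 * \<rho>))"
          using pos by (simp add: powr_divide powr_minus_divide powr_powr flip: powr_numeral)
        finally have "hausdorff_gauge \<rho> (?B D) \<le> ennreal (qw (dec_word D) powr (- (2 * \<rho>)))"
          using True \<rho> by (simp add: hausdorff_gauge_def ennreal_leI)
        then show ?thesis using bound[OF cD] by (rule order_trans)
      next
        case False
        then have "?B D = {}" by auto
        then show ?thesis by (simp only: hausdorff_gauge_empty) simp
      qed
      then have "(\<integral>\<^sup>+ D. hausdorff_gauge \<rho> (?B D) \<partial>count_space UNIV) \<le>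
          (\<integral>\<^sup>+ D. ennreal ((1 / 2) ^ K) * prod_list (map ww D) \<partial>count_space UNIV)"
        by (intro nn_integral_mono) auto
      also have "\<dots> = ennreal ((1 / 2) ^ K) * (\<integral>\<^sup>+ D. prod_list (map ww D) \<partial>count_space UNIV)"
        by (rule nn_integral_cmult) simp
      also have "\<dots> \<le> ennreal ((1 / 2) ^ K) * ennreal (1 / (1 - 1 / 2))"
        by (intro mult_left_mono nn_integral_prod_list sumw) auto
      also have "\<dots> = ennreal ((1 / 2) ^ K * 2)" by (subst ennreal_mult[symmetric]) auto
      also have "\<dots> \<le> ennreal e" using K by (intro ennreal_leI) simp
      finally show "(\<integral>\<^sup>+ D. hausdorff_gauge \<rho> (?B D) \<partial>count_space UNIV) \<le> ennreal e" .
    qed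
  qed
qed

section \<open>What the liminf condition says about the digits\<close>

lemma F_set_run_length:
  assumes "x \<in> F_set \<alpha>" "c < \<alpha>"
  shows "\<exists>n0. \<forall>n\<ge>n0. c * real n \<le> real (run_length n x)"
proof -
  have "ereal c < liminf (\<lambda>n. ereal (real (run_length n x) / real n))"
    using assms by (simp add: F_set_def)
  then have "eventually (\<lambda>n. ereal c < ereal (real (run_length n x) / real n)) sequentially"
    by (rule less_LiminfD)
  then obtain n0 where n0: "\<And>n. n \<ge> n0 \<Longrightarrow> c < real (run_length n x) / real n"
    by (auto simp: eventually_sequentially)
  have "c * real n \<le> real (run_length n x)" if "n \<ge> max n0 1" for n
    using n0[of n] that by (simp add: pos_less_divide_eq)
  then show ?thesis by blast
qed

text \<open>If the digits are constant from position \<open>m\<close> on, the run length is at least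
  \<open>n - m\<close>, and the liminf would exceed every number below 1.\<close>

lemma F_set_not_ev_const:
  assumes "x \<in> F_set \<alpha>" "\<alpha> < 1"
  shows "\<not> ev_const x"
proof
  assume "ev_const x"
  then obtain m where m: "\<And>i. m \<le> i \<Longrightarrow> cf_digit (Suc i) x = cf_digit i x" by (auto simp: ev_const_def)
  have c: "cf_digit (m + i) x = cf_digit m x" for i
  proof (induction i)
    case (Suc i)
    then show ?case using m[of "m + i"] by simp
  qed simp
  have run: "is_run x m l" for l unfolding is_run_def using c by metis
  define c' where "c' = (1 + \<alpha>) / 2"
  have c': "c' < 1" "\<alpha> < c'" using assms by (auto simp: c'_def)
  have "eventually (\<lambda>n. ereal c' \<le> ereal (real (run_length n x) / real n)) sequentially"
    using eventually_ge_at_top[of "max 1 (max m (nat \<lceil>real m / (1 - c')\<rceil>))"]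
  proof eventually_elim
    case (elim n)
    then have n: "1 \<le> n" "m \<le> n" "real m / (1 - c') \<le> real n" by (auto simp: nat_ceiling_le_eq)
    have "n - m \<le> run_length n x" using n by (intro run_length_ge[OF run]) auto
    then have "real n - real m \<le> real (run_length n x)" using n by linarith
    moreover have "real m \<le> real n * (1 - c')" using n c' by (simp add: pos_divide_le_eq)
    ultimately have "c' * real n \<le> real (run_length n x)" by (simp add: algebra_simps)
    then show ?case using n by (simp add: pos_le_divide_eq)
  qed
  then have "ereal c' \<le> liminf (\<lambda>n. ereal (real (run_length n x) / real n))" by (rule Liminf_bounded)
  also have "\<dots> = ereal \<alpha>" using assms by (simp add: F_set_def)
  finally show False using c' by simp
qed

lemma countable_ev_const: "countable {x \<in> {0..<1}. x \<notin> \<rat> \<and> ev_const x}" (is "countable ?A")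
proof -
  have "\<exists>m. \<forall>i\<ge>m. cf_digit (Suc i) x = cf_digit i x" if "x \<in> ?A" for x using that by (simp add: ev_const_def)
  then obtain m where m: "\<And>x i. x \<in> ?A \<Longrightarrow> m x \<le> i \<Longrightarrow> cf_digit (Suc i) x = cf_digit i x" by metis
  \<comment> \<open>The tail starts at \<open>Suc (m x)\<close> since \<open>m x\<close> may be 0
    and index 0 is not a digit. The prefix of that length then determines \<open>x\<close>.\<close>
  have tail: "cf_digit (Suc (m x) + i) x = cf_digit (Suc (m x)) x" if "x \<in> ?A" for x i
  proof (induction i)
    case (Suc i)
    then show ?case using m[OF that, of "Suc (m x) + i"] by simp
  qed simp
  have "inj_on (\<lambda>x. (m x, cf_prefix (Suc (m x)) x)) ?A"
  proof (rule inj_onI)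
    fix x z assume A: "x \<in> ?A" "z \<in> ?A" "(m x, cf_prefix (Suc (m x)) x) = (m z, cf_prefix (Suc (m z)) z)"
    then have e: "m x = m z" "cf_prefix (Suc (m x)) x = cf_prefix (Suc (m x)) z" by auto
    have small: "cf_digit (Suc i) x = cf_digit (Suc i) z" if "i \<le> m x" for i
      using nth_cf_prefix[of i "Suc (m x)" x] nth_cf_prefix[of i "Suc (m x)" z] e(2) that by simp
    show "x = z"
    proof (rule cf_digits_inj)
      fix n :: nat assume n: "1 \<le> n"
      show "cf_digit n x = cf_digit n z"
      proof (cases "n \<le> Suc (m x)")
        case True
        then show ?thesis using small[of "n - 1"] n by simp
      next
        case False
        then show ?thesis
          using tail[OF A(1), of "n - Suc (m x)"] tail[OF A(2), of "n - Suc (m x)"] small[of "m x"] e(1) by simp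
      qed
    qed (use A in auto)
  qed
  moreover have "countable ((\<lambda>x. (m x, cf_prefix (Suc (m x)) x)) ` ?A)" by simp
  ultimately show ?thesis by (rule countable_image_inj_on[rotated])
qed

lemma countable_F_set:
  assumes "1 / 2 < \<alpha>" "\<alpha> \<le> 1"
  shows "countable (F_set \<alpha>)"
proof (rule countable_subset[OF _ countable_ev_const], rule subsetI)
  fix x assume x: "x \<in> F_set \<alpha>"
  define c where "c = (1 / 2 + \<alpha>) / 2"
  have c: "1 / 2 < c" "c < \<alpha>" "c < 1" using assms by (auto simp: c_def)
  define b where "b = 1 / c - 1"
  have b: "0 < b" "b < 1" "c * (1 + b) = 1" using c by (auto simp: b_def field_simps)
  obtain n0 where n0: "\<And>n. n0 \<le> n \<Longrightarrow> c * real n \<le> real (run_length n x)"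
    using F_set_run_length[OF x c(2)] by blast
  have R: "real n \<le> (1 + b) * real (run_length n x)" if "n0 \<le> n" for n
  proof -
    have "(1 + b) * (c * real n) \<le> (1 + b) * real (run_length n x)"
      using n0[OF that] b by (intro mult_left_mono) auto
    moreover have "(1 + b) * (c * real n) = (c * (1 + b)) * real n" by (simp only: mult_ac)
    ultimately show ?thesis unfolding b(3) by simp
  qed
  have "ev_const x"
  proof (rule ccontr)
    assume "\<not> ev_const x"
    then obtain M \<Lambda> where rr: "\<And>k. M k + \<Lambda> k \<le> M (Suc k)" "\<And>k. real (M (Suc k)) \<le> b * real (\<Lambda> k)" "1 \<le> \<Lambda> (0::nat)"
      using record_runs[OF _ R b(1)] by metis
    have "real (\<Lambda> 0) \<le> b * real (\<Lambda> 0)" using rr(1)[of 0] rr(2)[of 0] by linarith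
    moreover have "b * real (\<Lambda> 0) < 1 * real (\<Lambda> 0)" using b rr(3) by (intro mult_strict_right_mono) auto
    ultimately show False by simp
  qed
  then show "x \<in> {x \<in> {0..<1}. x \<notin> \<rat> \<and> ev_const x}" using x by (simp add: F_set_def)
qed

subsection \<open>Cantor sets of blocks\<close>

text \<open>The marker \<open>[1, 2]\<close> cannot lie inside a run, hence free parts of fixed length create only
  bounded runs; the long runs are the blocks of ones that are inserted after a marker.\<close>

definition block :: "(nat \<Rightarrow> nat) \<Rightarrow> (nat \<Rightarrow> nat list) \<Rightarrow> nat \<Rightarrow> nat list" where
  "block r \<omega> i = \<omega> i @ ([1, 2] @ replicate (r i) 1)"

definition blocks :: "(nat \<Rightarrow> nat) \<Rightarrow> (nat \<Rightarrow> nat list) \<Rightarrow> nat \<Rightarrow> nat list" where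
  "blocks r \<omega> i = concat (map (block r \<omega>) [0..<i])"

lemma blocks_0 [simp]: "blocks r \<omega> 0 = []"
  and blocks_Suc: "blocks r \<omega> (Suc i) = blocks r \<omega> i @ block r \<omega> i"
  by (simp_all add: blocks_def)

lemma blocks_cong: "(\<And>j. j < i \<Longrightarrow> \<omega> j = \<omega>' j) \<Longrightarrow> blocks r \<omega> i = blocks r \<omega>' i"
  by (induction i) (simp_all add: blocks_Suc block_def)

lemma blocks_prefix: "i \<le> k \<Longrightarrow> take (length (blocks r \<omega> i)) (blocks r \<omega> k) = blocks r \<omega> i"
proof (induction k)
  case (Suc k)
  show ?case
  proof (cases "i = Suc k")
    case False
    then have IH: "take (length (blocks r \<omega> i)) (blocks r \<omega> k) = blocks r \<omega> i" using Suc by simp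
    then have "length (blocks r \<omega> i) \<le> length (blocks r \<omega> k)" by (metis length_take min.cobounded1 min_def)
    then show ?thesis using IH by (simp add: blocks_Suc)
  qed simp
qed simp

lemma length_blocks_ge: "i \<le> length (blocks r \<omega> i)"
  by (induction i) (auto simp: blocks_Suc block_def)

lemma block_pos: "0 \<notin> set (\<omega> i) \<Longrightarrow> 0 \<notin> set (block r \<omega> i)"
  by (auto simp: block_def)

lemma blocks_pos: "(\<And>i. 0 \<notin> set (\<omega> i)) \<Longrightarrow> 0 \<notin> set (blocks r \<omega> i)"
  by (induction i) (auto simp: blocks_Suc block_pos)

lemma exists_point:
  assumes "\<And>i. 0 \<notin> set (\<omega> i)"
  shows "\<exists>x. x \<in> {0..<1} \<and> x \<notin> \<rat> \<and> (\<forall>i. cf_prefix (length (blocks r \<omega> i)) x = blocks r \<omega> i)"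
proof -
  \<comment> \<open>Each block contains its marker, so \<open>n\<close> blocks have at least
    \<open>n\<close> letters and the index is in range.\<close>
  define a where "a n = blocks r \<omega> n ! (n - 1)" for n
  have a: "a (Suc n) = blocks r \<omega> i ! n" if "n < length (blocks r \<omega> i)" for n i
  proof (cases "Suc n \<le> i")
    case True
    have "n < length (blocks r \<omega> (Suc n))" using length_blocks_ge[of "Suc n" r \<omega>] by simp
    then show ?thesis using blocks_prefix[OF True, of r \<omega>] by (metis a_def diff_Suc_1 nth_take)
  next
    case False
    then have "i \<le> Suc n" by simp
    then show ?thesis using that blocks_prefix[of i "Suc n" r \<omega>] by (metis a_def diff_Suc_1 nth_take)
  qed
  have "a n \<ge> 1" if "n \<ge> 1" for n
  proof -
    have n: "n - 1 < length (blocks r \<omega> n)" using length_blocks_ge[of n r \<omega>] that by linarith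
    then have "a n \<in> set (blocks r \<omega> n)" by (simp add: a_def)
    moreover have "0 \<notin> set (blocks r \<omega> n)" using assms by (rule blocks_pos)
    ultimately have "a n \<noteq> 0" by metis
    then show ?thesis by simp
  qed
  then obtain x where x: "x \<in> {0..<1}" "x \<notin> \<rat>" "\<And>n. n \<ge> 1 \<Longrightarrow> cf_digit n x = a n"
    using cf_exists[of a] by blast
  have "cf_prefix (length (blocks r \<omega> i)) x = blocks r \<omega> i" for i
    by (rule nth_equalityI) (simp_all add: nth_cf_prefix x(3) a)
  then show ?thesis using x by blast
qed

text \<open>Two junctions cost a factor 2 each and \<open>qw [1, 2] = 3\<close>, hence 12.\<close>

lemma qw_block_le:
  assumes "0 \<notin> set (\<omega> i)"
  shows "qw (block r \<omega> i) \<le> 12 * qw (\<omega> i) * golden ^ r i"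
proof -
  have "qw (block r \<omega> i) \<le> 2 * qw (\<omega> i) * qw ([1, 2] @ replicate (r i) 1)"
    unfolding block_def using assms by (intro qw_append) auto
  also have "\<dots> \<le> 2 * qw (\<omega> i) * (2 * qw [1, 2] * qw (replicate (r i) 1))"
    using assms cden_pos[OF assms, of 0] by (intro mult_left_mono qw_append) auto
  also have "\<dots> \<le> 2 * qw (\<omega> i) * (2 * qw [1, 2] * golden ^ r i)"
    using assms cden_pos[OF assms, of 0] qw_ones_le[of "r i"] by (intro mult_left_mono) auto
  finally show ?thesis by simp
qed

text \<open>The inverse of submultiplicativity, at a fixed price per block: 12 from the block itself
  and 2 for attaching it, besides the growth along the inserted ones.\<close>

lemma prod_qw_le:
  assumes "\<And>i. 0 \<notin> set (\<omega> i)" "0 \<le> \<rho>"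
  shows "(\<Prod>j<i. qw (\<omega> j) powr (- (2 * \<rho>))) \<le>
    qw (blocks r \<omega> i) powr (- (2 * \<rho>)) * (\<Prod>j<i. 24 powr (2 * \<rho>) * golden powr (2 * \<rho> * real (r j)))"
proof (induction i)
  case (Suc i)
  have p: "0 < qw (\<omega> i)" "0 < qw (blocks r \<omega> i)" "0 < qw (blocks r \<omega> (Suc i))"
    using assms blocks_pos[of \<omega>] by (auto intro!: cden_pos)
  have "qw (blocks r \<omega> (Suc i)) \<le> 2 * qw (blocks r \<omega> i) * qw (block r \<omega> i)"
    unfolding blocks_Suc using assms blocks_pos[of \<omega>] block_pos[of \<omega>] by (intro qw_append) auto
  also have "\<dots> \<le> 2 * qw (blocks r \<omega> i) * (12 * qw (\<omega> i) * golden ^ r i)"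
    using qw_block_le[OF assms(1)] p by (intro mult_left_mono) auto
  also have "\<dots> = qw (blocks r \<omega> i) * (qw (\<omega> i) * (24 * golden ^ r i))" by simp
  finally have "(qw (blocks r \<omega> i) * (qw (\<omega> i) * (24 * golden ^ r i))) powr (- (2 * \<rho>)) \<le> qw (blocks r \<omega> (Suc i)) powr (- (2 * \<rho>))"
    using p assms by (intro powr_mono2') auto
  then have le: "qw (blocks r \<omega> i) powr (- (2 * \<rho>)) * qw (\<omega> i) powr (- (2 * \<rho>)) * (24 * golden ^ r i) powr (- (2 * \<rho>))
     \<le> qw (blocks r \<omega> (Suc i)) powr (- (2 * \<rho>))" by (simp only: powr_mult mult.assoc)
  have g: "(24 * golden ^ r i) powr (- (2 * \<rho>)) * (24 powr (2 * \<rho>) * golden powr (2 * \<rho> * real (r i))) = 1"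
  proof -
    have "24 powr (2 * \<rho>) * golden powr (2 * \<rho> * real (r i)) = (24 * golden ^ r i) powr (2 * \<rho>)"
      using golden_gt_1 by (simp add: powr_mult powr_powr mult_ac flip: powr_realpow)
    then show ?thesis using golden_gt_1 by (simp add: powr_minus)
  qed
  let ?P = "\<Prod>j<i. 24 powr (2 * \<rho>) * golden powr (2 * \<rho> * real (r j))"
  have P0: "0 \<le> ?P" by (intro prod_nonneg) auto
  have "(\<Prod>j<Suc i. qw (\<omega> j) powr (- (2 * \<rho>))) \<le> qw (blocks r \<omega> i) powr (- (2 * \<rho>)) * ?P * qw (\<omega> i) powr (- (2 * \<rho>))"
    using Suc by (simp add: mult_right_mono)
  also have "\<dots> = (qw (blocks r \<omega> i) powr (- (2 * \<rho>)) * qw (\<omega> i) powr (- (2 * \<rho>)) * (24 * golden ^ r i) powr (- (2 * \<rho>)))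
     * (?P * (24 powr (2 * \<rho>) * golden powr (2 * \<rho> * real (r i))))"
  proof -
    have "x * P * y = (x * y * u) * (P * v)" if "u * v = 1" for x y u v P :: real
      using that by (metis (no_types, lifting) mult.assoc mult.commute mult.right_neutral)
    then show ?thesis using g by blast
  qed
  also have "\<dots> \<le> qw (blocks r \<omega> (Suc i)) powr (- (2 * \<rho>)) * (?P * (24 powr (2 * \<rho>) * golden powr (2 * \<rho> * real (r i))))"
    using le P0 by (intro mult_right_mono) auto
  finally show ?case by simp
qed simp

text \<open>Distinct digits differ by at least 1, but tails in the unit interval could cancel this.
  A next digit of at most \<open>m\<close> keeps the tails above \<open>1 / (m + 1)\<close>, and
  that much of the gap survives.\<close>

lemma tail_separation:
  fixes a a' :: nat and z z' m :: real
  assumes "a \<noteq> a'" "1 \<le> a" "1 \<le> a'" "real a \<le> m" "real a' \<le> m"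
    and "1 / (m + 1) \<le> z" "z \<le> 1" "1 / (m + 1) \<le> z'" "z' \<le> 1"
  shows "1 / (m + 1) ^ 3 \<le> \<bar>1 / (real a + z) - 1 / (real a' + z')\<bar>"
proof -
  have m: "1 \<le> m" using assms by linarith
  then have m1: "0 < 1 / (m + 1)" by simp
  have z0: "0 < z" "0 < z'" using m1 assms by linarith+
  have d: "1 / (m + 1) \<le> \<bar>(real a' + z') - (real a + z)\<bar>"
  proof (cases "a < a'")
    case True
    then have "real a + 1 \<le> real a'" by linarith
    then show ?thesis using assms by linarith
  next
    case False
    then have "real a' + 1 \<le> real a" using assms(1) by linarith
    then show ?thesis using assms by linarith
  qed
  have "1 / (real a + z) - 1 / (real a' + z') = ((real a' + z') - (real a + z)) / ((real a + z) * (real a' + z'))"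
    using z0 by (simp add: divide_simps add_nonneg_pos add_nonneg_eq_0_iff)
  then have e: "\<bar>1 / (real a + z) - 1 / (real a' + z')\<bar> = \<bar>(real a' + z') - (real a + z)\<bar> / ((real a + z) * (real a' + z'))"
    using z0 by (simp add: abs_mult)
  have "1 / (m + 1) ^ 3 = (1 / (m + 1)) / ((m + 1) * (m + 1))" by (simp add: power3_eq_cube)
  also have "\<dots> \<le> \<bar>(real a' + z') - (real a + z)\<bar> / ((real a + z) * (real a' + z'))"
    using d assms z0 by (intro frac_le mult_mono mult_pos_pos) auto
  finally show ?thesis unfolding e .
qed

lemma cfm_tail_bounds:
  assumes "0 \<notin> set (b # e)" "real b \<le> m" "0 \<le> t" "t \<le> 1"
  shows "1 / (m + 1) \<le> cfm (b # e) t" "cfm (b # e) t \<le> 1"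
proof -
  have c: "0 \<le> cfm e t" "cfm e t \<le> 1" using cfm_nonneg cfm_le_1[of e t] assms by auto
  have b: "1 \<le> real b" using assms(1) by auto
  show "cfm (b # e) t \<le> 1" using b c by simp
  show "1 / (m + 1) \<le> cfm (b # e) t" using b c assms(2) by (simp add: frac_le)
qed

lemma prefix_split:
  assumes x: "x \<in> {0..<1}" "x \<notin> \<rat>" and p: "cf_prefix n x = u @ c @ a # b # e"
    and b: "real b \<le> m"
  obtains z where "x = cfm (u @ c) (1 / (real a + z))" "1 / (m + 1) \<le> z" "z \<le> 1"
proof -
  define t where "t = (gauss_map ^^ n) x"
  have t: "0 \<le> t" "t \<le> 1" using gauss_funpow_irrational[OF x, of n] by (auto simp: t_def)
  have pos: "0 \<notin> set (b # e)" using cf_prefix_pos[OF x, of n] unfolding p by auto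
  have "x = cfm (u @ c @ a # b # e) t" using cf_prefix_cfm[OF x, of n] unfolding p t_def .
  also have "\<dots> = cfm (u @ c) (1 / (real a + cfm (b # e) t))" by (simp only: cfm_append cfm_simps)
  finally show ?thesis using that cfm_tail_bounds[OF pos b t] by blast
qed

text \<open>Strip the common prefix up to the first difference. The 1 behind \<open>v\<close> and
  \<open>v'\<close> guarantees a bounded next digit even if they differ only in their last letter.
  The constant is 4 from \<open>cfm_diff_le\<close> times the square of the junction factor 2; the
  exponent is \<open>2 * N\<close> from the common part of \<open>v\<close> and \<open>v'\<close>
  plus 3 from \<open>tail_separation\<close>.\<close>

lemma digits_separate:
  assumes x: "x \<in> {0..<1}" "x \<notin> \<rat>" and x': "x' \<in> {0..<1}" "x' \<notin> \<rat>"
    and p: "cf_prefix n x = u @ v @ 1 # e" and p': "cf_prefix n' x' = u @ v' @ 1 # e'"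
    and v: "v \<noteq> v'" "length v = N" "length v' = N" "set v \<subseteq> {1..M}" "set v' \<subseteq> {1..M}"
    and u: "0 \<notin> set u"
  shows "1 / (16 * qw u ^ 2 * (real M + 1) ^ (2 * N + 3)) \<le> \<bar>x - x'\<bar>"
proof -
  obtain c a d a' d' where s: "a \<noteq> a'" "v = c @ [a] @ d" "v' = c @ [a'] @ d'"
    using same_length_different[OF v(1)] v(2,3) by auto
  have aM: "1 \<le> a" "a \<le> M" "1 \<le> a'" "a' \<le> M" using v(4,5) s by auto
  have hd: "\<exists>b f. d @ 1 # e = b # f \<and> b \<le> M" if "set d \<subseteq> {1..M}" for d e :: "nat list"
  proof (cases d)
    case Nil
    then show ?thesis using aM by (intro exI[of _ 1] exI[of _ e]) simp
  next
    case (Cons b g)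
    then show ?thesis using that by (intro exI[of _ b] exI[of _ "g @ 1 # e"]) simp
  qed
  have dd: "set d \<subseteq> {1..M}" "set d' \<subseteq> {1..M}" using v(4,5) unfolding s(2,3) by auto
  obtain b f where bf: "d @ 1 # e = b # f" "real b \<le> real M" using hd[OF dd(1), of e] by auto
  obtain b' f' where bf': "d' @ 1 # e' = b' # f'" "real b' \<le> real M" using hd[OF dd(2), of e'] by auto
  have P: "cf_prefix n x = u @ c @ a # b # f" "cf_prefix n' x' = u @ c @ a' # b' # f'"
    using p p' s bf bf' by auto
  obtain z where z: "x = cfm (u @ c) (1 / (real a + z))" "1 / (real M + 1) \<le> z" "z \<le> 1"
    using prefix_split[OF x P(1) bf(2)] by blast
  obtain z' where z': "x' = cfm (u @ c) (1 / (real a' + z'))" "1 / (real M + 1) \<le> z'" "z' \<le> 1"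
    using prefix_split[OF x' P(2) bf'(2)] by blast
  have z0: "0 \<le> z" "0 \<le> z'" using order_trans[OF _ z(2), of 0] order_trans[OF _ z'(2), of 0] by auto
  have c: "0 \<notin> set c" "length c \<le> N" "\<And>i. i \<in> set c \<Longrightarrow> i \<le> M" using v s by auto
  have uc: "0 \<notin> set (u @ c)" using u c by simp
  have q0: "0 < qw (u @ c)" "0 < qw u" using cden_pos uc u by auto
  have "qw (u @ c) \<le> 2 * qw u * qw c" using u c by (intro qw_append)
  also have "\<dots> \<le> 2 * qw u * (real M + 1) ^ N"
  proof (intro mult_left_mono)
    have "qw c \<le> (real M + 1) ^ length c" using c by (intro qw_le) auto
    also have "\<dots> \<le> (real M + 1) ^ N" using c by (intro power_increasing) auto
    finally show "qw c \<le> (real M + 1) ^ N" .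
  qed (use q0 in auto)
  finally have q: "qw (u @ c) \<le> 2 * qw u * (real M + 1) ^ N" .
  have "4 * qw (u @ c) ^ 2 \<le> 4 * (2 * qw u * (real M + 1) ^ N) ^ 2"
    using q q0 by (intro mult_left_mono power_mono) auto
  also have "\<dots> * (real M + 1) ^ 3 = 16 * qw u ^ 2 * (real M + 1) ^ (2 * N + 3)"
    by (simp add: power_mult_distrib power_add power_mult[symmetric] mult_ac)
  finally have den: "4 * qw (u @ c) ^ 2 * (real M + 1) ^ 3 \<le> 16 * qw u ^ 2 * (real M + 1) ^ (2 * N + 3)" 
    by simp
  have "1 / (16 * qw u ^ 2 * (real M + 1) ^ (2 * N + 3)) \<le> 1 / (4 * qw (u @ c) ^ 2 * (real M + 1) ^ 3)"
    using den q0 by (intro divide_left_mono) auto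
  also have "\<dots> = (1 / (real M + 1) ^ 3) / (4 * qw (u @ c) ^ 2)" by simp
  also have "\<dots> \<le> \<bar>1 / (real a + z) - 1 / (real a' + z')\<bar> / (4 * qw (u @ c) ^ 2)"
    using s(1) aM z z' by (intro divide_right_mono tail_separation) auto
  also have "\<dots> \<le> \<bar>x - x'\<bar>"
    unfolding z(1) z'(1) using uc z0 aM by (intro cfm_diff_le(2)) (auto simp: divide_le_eq)
  finally show ?thesis .
qed

text \<open>A free word gets mass proportional to \<open>qw v powr (- (2 * \<rho>))\<close>. Once
  the power of \<open>qw (blocks r \<omega> i)\<close> has been split off, \<open>cond\<close>
  compares the mass of a cylinder with the gap of \<open>digits_separate\<close> raised to
  \<rho>.\<close>

lemma hausdorff_measure_blocks_nonzero:
  fixes V :: "nat \<Rightarrow> nat list set" and Mx r :: "nat \<Rightarrow> nat"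
  assumes V: "\<And>i. finite (V i)" "\<And>i. V i \<noteq> {}" "\<And>i v. v \<in> V i \<Longrightarrow> length v = N \<and> set v \<subseteq> {1..Mx i}"
    and \<rho>: "0 < \<rho>" and C: "0 < C"
    and cond: "\<And>i. (\<Prod>j<i. 24 powr (2 * \<rho>) * golden powr (2 * \<rho> * real (r j)) / (\<Sum>v\<in>V j. qw v powr (- (2 * \<rho>)))) \<le>
      C * (real (Mx i) + 1) powr (- (real (2 * N + 3) * \<rho>))"
    and E: "\<And>x \<omega>. x \<in> {0..<1} \<Longrightarrow> x \<notin> \<rat> \<Longrightarrow> \<forall>i. \<omega> i \<in> V i \<Longrightarrow>
      \<forall>i. cf_prefix (length (blocks r \<omega> i)) x = blocks r \<omega> i \<Longrightarrow> x \<in> E"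
  shows "hausdorff_measure \<rho> E \<noteq> 0"
proof -
  define Z where "Z j = (\<Sum>v\<in>V j. qw v powr (- (2 * \<rho>)))" for j
  define p where "p j v = qw v powr (- (2 * \<rho>)) / Z j" for j v
  have vpos: "0 \<notin> set v" if "v \<in> V i" for v i using V(3)[OF that] by auto
  have Z0: "0 < Z j" for j
    unfolding Z_def using V(1,2) cden_pos[OF vpos] by (intro sum_pos) fastforce+
  define X where "X \<omega> = (SOME x. x \<in> {0..<1} \<and> x \<notin> \<rat> \<and> (\<forall>i. cf_prefix (length (blocks r \<omega> i)) x = blocks r \<omega> i))" for \<omega>
  have X: "X \<omega> \<in> {0..<1}" "X \<omega> \<notin> \<rat>" "\<forall>i. cf_prefix (length (blocks r \<omega> i)) (X \<omega>) = blocks r \<omega> i"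
    if "\<forall>i. \<omega> i \<in> V i" for \<omega>
  proof -
    have "\<exists>x. x \<in> {0..<1} \<and> x \<notin> \<rat> \<and> (\<forall>i. cf_prefix (length (blocks r \<omega> i)) x = blocks r \<omega> i)"
      using that vpos by (intro exists_point) auto
    from someI_ex[OF this] show "X \<omega> \<in> {0..<1}" "X \<omega> \<notin> \<rat>" "\<forall>i. cf_prefix (length (blocks r \<omega> i)) (X \<omega>) = blocks r \<omega> i"
      unfolding X_def by blast+
  qed
  have prod_le: "(\<Prod>j<i. p j (\<omega> j)) \<le> C * (qw (blocks r \<omega> i) powr (- (2 * \<rho>)) * (real (Mx i) + 1) powr (- (real (2 * N + 3) * \<rho>)))"
    if "\<forall>i. \<omega> i \<in> V i" for \<omega> i
  proof -
    have "(\<Prod>j<i. p j (\<omega> j)) = (\<Prod>j<i. qw (\<omega> j) powr (- (2 * \<rho>))) / (\<Prod>j<i. Z j)"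
      by (simp add: p_def prod_dividef)
    also have "\<dots> \<le> qw (blocks r \<omega> i) powr (- (2 * \<rho>)) * (\<Prod>j<i. 24 powr (2 * \<rho>) * golden powr (2 * \<rho> * real (r j))) / (\<Prod>j<i. Z j)"
      using Z0 that vpos \<rho> by (intro divide_right_mono prod_qw_le prod_nonneg) (auto intro: less_imp_le)
    also have "\<dots> = qw (blocks r \<omega> i) powr (- (2 * \<rho>)) * (\<Prod>j<i. 24 powr (2 * \<rho>) * golden powr (2 * \<rho> * real (r j)) / Z j)"
      by (simp add: prod_dividef)
    also have "\<dots> \<le> qw (blocks r \<omega> i) powr (- (2 * \<rho>)) * (C * (real (Mx i) + 1) powr (- (real (2 * N + 3) * \<rho>)))"
      using cond[of i] by (intro mult_left_mono) (auto simp: Z_def)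
    finally show ?thesis by (simp add: mult_ac)
  qed
  show ?thesis
  proof (rule mass_distribution[where W = V and p = p and X = X and C = "C * 16 powr \<rho>"])
    show "finite (V i)" for i by (rule V)
    show "0 < p i v" if "v \<in> V i" for i v using Z0[of i] cden_pos[OF vpos[OF that], of 0] by (simp add: p_def)
    show "(\<Sum>v\<in>V i. p i v) = 1" for i using Z0[of i] by (simp add: p_def Z_def sum_divide_distrib[symmetric])
    show "0 < C * 16 powr \<rho>" using C by simp
    show "0 < \<rho>" by (rule \<rho>)
    show "X \<omega> \<in> E" if "\<forall>i. \<omega> i \<in> V i" for \<omega> using X[OF that] that by (intro E) auto
    show "(\<lambda>i. \<Prod>j<i. p j (\<omega> j)) \<longlonglongrightarrow> 0" if w: "\<forall>i. \<omega> i \<in> V i" for \<omega>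
    proof (rule tendsto_sandwich[OF _ _ tendsto_const])
      have "0 \<le> p j (\<omega> j)" for j using Z0[of j] by (simp add: p_def)
      then show "eventually (\<lambda>i. 0 \<le> (\<Prod>j<i. p j (\<omega> j))) sequentially"
        by (intro always_eventually allI prod_nonneg) auto
      have "(\<Prod>j<i. p j (\<omega> j)) \<le> C * golden powr (2 * \<rho>) * (golden powr (- (2 * \<rho>))) ^ i" for i
      proof -
        have b0: "0 \<notin> set (blocks r \<omega> i)" using w vpos by (intro blocks_pos) auto
        have "golden powr (real i - 1) \<le> golden powr (real (length (blocks r \<omega> i)) - 1)"
          using golden_gt_1 length_blocks_ge[of i r \<omega>] by (intro powr_mono) auto
        also have "\<dots> \<le> qw (blocks r \<omega> i)" using b0 by (rule qw_ge_golden)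
        finally have "qw (blocks r \<omega> i) powr (- (2 * \<rho>)) \<le> (golden powr (real i - 1)) powr (- (2 * \<rho>))"
          using \<rho> golden_gt_1 by (intro powr_mono2') auto
        also have "\<dots> = golden powr (2 * \<rho>) * (golden powr (- (2 * \<rho>))) ^ i"
          using golden_gt_1 by (simp add: powr_powr powr_add[symmetric] algebra_simps flip: powr_realpow)
        finally have 1: "qw (blocks r \<omega> i) powr (- (2 * \<rho>)) \<le> golden powr (2 * \<rho>) * (golden powr (- (2 * \<rho>))) ^ i" .
        have 2: "(real (Mx i) + 1) powr (- (real (2 * N + 3) * \<rho>)) \<le> 1"
          using \<rho> powr_mono[of "- (real (2 * N + 3) * \<rho>)" 0 "real (Mx i) + 1"] by simp
        have "(\<Prod>j<i. p j (\<omega> j)) \<le> C * (qw (blocks r \<omega> i) powr (- (2 * \<rho>)) * (real (Mx i) + 1) powr (- (real (2 * N + 3) * \<rho>)))"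
          by (rule prod_le[OF w])
        also have "\<dots> \<le> C * ((golden powr (2 * \<rho>) * (golden powr (- (2 * \<rho>))) ^ i) * 1)"
          using C by (intro mult_left_mono mult_mono 1 2) auto
        finally show ?thesis by (simp add: mult.assoc)
      qed
      then show "eventually (\<lambda>i. (\<Prod>j<i. p j (\<omega> j)) \<le> C * golden powr (2 * \<rho>) * (golden powr (- (2 * \<rho>))) ^ i) sequentially"
        by (intro always_eventually allI)
      have "golden powr (- (2 * \<rho>)) < 1" using golden_gt_1 \<rho> powr_less_mono[of "- (2 * \<rho>)" 0 golden] by simp
      then show "(\<lambda>i. C * golden powr (2 * \<rho>) * (golden powr (- (2 * \<rho>))) ^ i) \<longlonglongrightarrow> 0"
        by (intro tendsto_mult_right_zero LIMSEQ_power_zero) simp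
    qed
    show "(\<Prod>j<i. p j (\<omega> j)) \<le> C * 16 powr \<rho> * \<bar>X \<omega> - X \<omega>'\<bar> powr \<rho>"
      if w: "\<forall>i. \<omega> i \<in> V i" "\<forall>i. \<omega>' i \<in> V i" and ag: "\<forall>j<i. \<omega> j = \<omega>' j" and ne: "\<omega> i \<noteq> \<omega>' i" for \<omega> \<omega>' i
    proof -
      have b: "blocks r \<omega>' i = blocks r \<omega> i" using ag by (intro blocks_cong) auto
      have u: "0 \<notin> set (blocks r \<omega> i)" using w vpos by (intro blocks_pos) auto
      have q0: "0 < qw (blocks r \<omega> i)" using u by (intro cden_pos) auto
      define D where "D = 1 / (16 * qw (blocks r \<omega> i) ^ 2 * (real (Mx i) + 1) ^ (2 * N + 3))"
      have "D \<le> \<bar>X \<omega> - X \<omega>'\<bar>"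
        unfolding D_def
      proof (rule digits_separate[OF X(1,2)[OF w(1)] X(1,2)[OF w(2)]])
        show "cf_prefix (length (blocks r \<omega> (Suc i))) (X \<omega>) = blocks r \<omega> i @ \<omega> i @ 1 # (2 # replicate (r i) 1)"
          by (rule trans[OF X(3)[OF w(1), rule_format]]) (simp add: blocks_Suc block_def)
        show "cf_prefix (length (blocks r \<omega>' (Suc i))) (X \<omega>') = blocks r \<omega> i @ \<omega>' i @ 1 # (2 # replicate (r i) 1)"
          by (rule trans[OF X(3)[OF w(2), rule_format]]) (simp add: blocks_Suc block_def b)
      qed (use ne w V(3) u in auto)
      then have "D powr \<rho> \<le> \<bar>X \<omega> - X \<omega>'\<bar> powr \<rho>"
        using \<rho> q0 by (intro powr_mono2) (auto simp: D_def)
      moreover have "16 powr \<rho> * D powr \<rho> = qw (blocks r \<omega> i) powr (- (2 * \<rho>)) * (real (Mx i) + 1) powr (- (real (2 * N + 3) * \<rho>))"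
      proof -
        have m: "0 < real (Mx i) + 1" by simp
        have "16 * D = qw (blocks r \<omega> i) powr (- 2) * (real (Mx i) + 1) powr (- real (2 * N + 3))"
          using q0 m unfolding D_def powr_minus powr_realpow[OF m] by (simp add: divide_simps flip: powr_numeral)
        then have "(16 * D) powr \<rho> = qw (blocks r \<omega> i) powr (- (2 * \<rho>)) * (real (Mx i) + 1) powr (- (real (2 * N + 3) * \<rho>))"
          by (simp only: powr_mult powr_powr) (simp add: algebra_simps)
        then show ?thesis by (simp only: powr_mult)
      qed
      ultimately have "qw (blocks r \<omega> i) powr (- (2 * \<rho>)) * (real (Mx i) + 1) powr (- (real (2 * N + 3) * \<rho>)) \<le> 16 powr \<rho> * \<bar>X \<omega> - X \<omega>'\<bar> powr \<rho>"
        by (metis mult_left_mono powr_ge_zero)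
      then have "C * (qw (blocks r \<omega> i) powr (- (2 * \<rho>)) * (real (Mx i) + 1) powr (- (real (2 * N + 3) * \<rho>))) \<le> C * (16 powr \<rho> * \<bar>X \<omega> - X \<omega>'\<bar> powr \<rho>)"
        using C by (intro mult_left_mono) auto
      then show ?thesis using prod_le[OF w(1), of i] by (simp only: mult.assoc)
    qed
  qed
qed

subsection \<open>Placing the runs\<close>

definition stage :: "(nat \<Rightarrow> nat) \<Rightarrow> nat \<Rightarrow> nat" where
  "stage T i = (LEAST k. i < T (Suc k))"

lemma stage_bounds:
  assumes "strict_mono T" "T 0 = 0"
  shows "T (stage T i) \<le> i" "i < T (Suc (stage T i))"
proof -
  have "i < T (Suc i)" using strict_mono_imp_increasing[OF assms(1), of "Suc i"] by simp
  then show u: "i < T (Suc (stage T i))" unfolding stage_def by (rule LeastI)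
  show "T (stage T i) \<le> i"
  proof (cases "stage T i")
    case (Suc k)
    then have "\<not> i < T (Suc k)" unfolding stage_def by (metis lessI not_less_Least)
    then show ?thesis using Suc by simp
  qed (use assms in simp)
qed

lemma stage_eq:
  assumes "strict_mono T" "T k \<le> i" "i < T (Suc k)"
  shows "stage T i = k"
  unfolding stage_def
proof (rule Least_equality)
  fix j assume "i < T (Suc j)"
  then have "T k < T (Suc j)" using assms by simp
  then show "k \<le> j" using strict_mono_less[OF assms(1)] by simp
qed (rule assms)

lemma stage_T: "strict_mono T \<Longrightarrow> stage T (T k) = k"
  by (rule stage_eq) (auto simp: strict_mono_less)

lemma stage_Suc:
  assumes "strict_mono T" "T 0 = 0"
  shows "stage T (Suc i) = stage T i \<or> (\<exists>q. stage T i = q \<and> Suc i = T (Suc q) \<and> stage T (Suc i) = Suc q)"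
proof (cases "Suc i < T (Suc (stage T i))")
  case True
  then show ?thesis using stage_bounds[OF assms, of i] by (intro disjI1 stage_eq assms) auto
next
  case False
  then have "Suc i = T (Suc (stage T i))" using stage_bounds(2)[OF assms, of i] by simp
  then show ?thesis using stage_T[OF assms(1), of "Suc (stage T i)"] by auto
qed

text \<open>Ones are inserted only behind the last block of a stage. \<Gamma> counts them
  cumulatively, so that their number before block \<open>i\<close> depends on the stage of
  \<open>i\<close> alone.\<close>

definition run_gap :: "(nat \<Rightarrow> nat) \<Rightarrow> (nat \<Rightarrow> nat) \<Rightarrow> nat \<Rightarrow> nat" where
  "run_gap T \<Gamma> i = \<Gamma> (stage T (Suc i)) - \<Gamma> (stage T i)"

lemma run_gap_sum:
  assumes T: "strict_mono T" "T 0 = 0" and \<Gamma>: "\<Gamma> 0 = 0" "\<And>k. \<Gamma> k \<le> \<Gamma> (Suc k)"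
  shows "(\<Sum>j<i. run_gap T \<Gamma> j) = \<Gamma> (stage T i)"
proof (induction i)
  case 0
  have "stage T 0 = 0" using stage_T[OF T(1), of 0] T(2) by simp
  then show ?case using \<Gamma> by simp
next
  case (Suc i)
  have "\<Gamma> (stage T i) \<le> \<Gamma> (stage T (Suc i))" using stage_Suc[OF T, of i] \<Gamma>(2) by auto
  then show ?case using Suc by (simp add: run_gap_def)
qed

lemma length_blocks:
  assumes "\<And>i. length (\<omega> i) = N"
  shows "length (blocks r \<omega> i) = (N + 2) * i + (\<Sum>j<i. r j)"
  by (induction i) (simp_all add: blocks_Suc block_def assms)

lemma block_marks:
  assumes len: "\<And>i. length (\<omega> i) = N"
    and x: "\<And>i. cf_prefix (length (blocks r \<omega> i)) x = blocks r \<omega> i"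
    and S: "S = (\<lambda>i. (N + 2) * i + (\<Sum>j<i. r j))"
  shows "cf_digit (S i + N + 1) x = 1" "cf_digit (S i + N + 2) x = 2" "is_run x (S i + N + 2) (r i)"
proof -
  have L: "length (blocks r \<omega> k) = S k" for k using length_blocks[of \<omega> N r k] len S by simp
  have SS: "S (Suc i) = S i + N + 2 + r i" by (simp add: S)
  have d: "cf_digit (Suc (S i + k)) x = block r \<omega> i ! k" if "k < N + 2 + r i" for k
    using nth_cf_prefix[of "S i + k" "S (Suc i)" x] x[of "Suc i"] that unfolding L
    by (simp add: SS blocks_Suc nth_append L)
  show "cf_digit (S i + N + 1) x = 1" using d[of N] by (simp add: block_def nth_append len)
  show "cf_digit (S i + N + 2) x = 2" using d[of "Suc N"] by (simp add: block_def nth_append len)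
  have one: "cf_digit (S i + N + 2 + k) x = 1" if "1 \<le> k" "k \<le> r i" for k
    using d[of "N + 1 + k"] that by (simp add: block_def nth_append len add.assoc)
  show "is_run x (S i + N + 2) (r i)"
    unfolding is_run_def
  proof
    fix k assume "k \<in> {1..r i}"
    then show "cf_digit (S i + N + 2 + k) x = cf_digit (S i + N + 2 + 1) x"
      using one[of k] one[of 1] by simp
  qed
qed

text \<open>No run contains both letters of a marker, so it lies between the 2 of one marker and the
  1 of the next. \<open>i\<close> is the first marker whose 1 does not precede the run.\<close>

lemma run_localize:
  assumes marks: "\<And>i. cf_digit (S i + N + 1) x \<noteq> cf_digit (S i + N + 2) x"
    and S: "\<And>i. i \<le> S i" and run: "is_run x j l"
  obtains i where "j \<le> S i + N" "j + l \<le> S i + N + 1" "i = 0 \<or> S (i - 1) + N < j"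
proof -
  define i where "i = (LEAST i. j \<le> S i + N)"
  have "j \<le> S j + N" using S[of j] by simp
  then have i: "j \<le> S i + N" unfolding i_def by (rule LeastI)
  have "j + l \<le> S i + N + 1"
  proof (rule ccontr)
    assume A: "\<not> j + l \<le> S i + N + 1"
    define t where "t = S i + N + 1 - j"
    have t: "1 \<le> t" "t + 1 \<le> l" "j + t = S i + N + 1" "j + (t + 1) = S i + N + 2" using A i by (auto simp: t_def)
    have "cf_digit (j + t) x = cf_digit (j + (t + 1)) x"
      using is_runD[OF run, of t] is_runD[OF run, of "t + 1"] t(1,2) by simp
    then show False using marks[of i] unfolding t(3,4) by simp
  qed
  moreover have "i = 0 \<or> S (i - 1) + N < j"
  proof (cases i)
    case (Suc k)
    then have "\<not> j \<le> S k + N" unfolding i_def by (metis lessI not_less_Least)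
    then show ?thesis using Suc by simp
  qed simp
  ultimately show ?thesis using i that by blast
qed

lemma strict_mono_bracket:
  fixes e :: "nat \<Rightarrow> nat"
  assumes e: "strict_mono e" "e K \<le> n"
  obtains k where "K \<le> k" "e k \<le> n" "n \<le> e (Suc k)"
proof -
  have ex: "n \<le> e (Suc n)" using strict_mono_imp_increasing[OF e(1), of "Suc n"] by simp
  define k where "k = (LEAST k. K \<le> k \<and> n \<le> e (Suc k))"
  have "K \<le> max K n \<and> n \<le> e (Suc (max K n))"
    using ex strict_mono_less_eq[OF e(1), of "Suc n" "Suc (max K n)"] by simp
  then have k: "K \<le> k \<and> n \<le> e (Suc k)" unfolding k_def by (rule LeastI)
  have "e k \<le> n"
  proof (cases "k = K")
    case False
    then obtain j where j: "k = Suc j" "K \<le> j" using k by (cases k) auto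
    then have "\<not> (K \<le> j \<and> n \<le> e (Suc j))" unfolding k_def by (metis lessI not_less_Least)
    then show ?thesis using j by simp
  qed (use e in simp)
  then show ?thesis using k that by blast
qed

text \<open>Run \<open>k\<close> starts after \<open>m k\<close> digits, has length
  \<open>l k\<close> and ends at \<open>e k\<close>. The quotient is smallest when the next run
  draws level with it, at \<open>n = m (Suc k) + l k\<close>; there it is \<open>l k / n\<close> up
  to a bounded error in the numerator. Division by \<open>\<Gamma> (Suc k)\<close> turns this into
  the formula for \<alpha>.\<close>

lemma stage_liminf:
  assumes T: "strict_mono T" "T 0 = 0" and \<Gamma>: "\<Gamma> 0 = 0" "\<And>k. 2 * \<Gamma> k \<le> \<Gamma> (Suc k)"
    and inf: "filterlim (\<lambda>k. real (\<Gamma> k)) at_top sequentially"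
    and a: "(\<lambda>k. real (\<Gamma> k) / real (\<Gamma> (Suc k))) \<longlonglongrightarrow> a"
    and B: "(\<lambda>k. real (T (Suc k)) / real (\<Gamma> k)) \<longlonglongrightarrow> B"
    and \<alpha>: "\<alpha> = (1 - a) / (real (N + 2) * B + 2 - a)"
    and x: "x \<in> {0..<1}" "x \<notin> \<rat>" and len: "\<And>i. length (\<omega> i) = N"
    and pre: "\<And>i. cf_prefix (length (blocks (run_gap T \<Gamma>) \<omega> i)) x = blocks (run_gap T \<Gamma>) \<omega> i"
  shows "x \<in> F_set \<alpha>"
proof -
  define N' where "N' = N + 2"
  define r where "r = run_gap T \<Gamma>"
  define S where "S = (\<lambda>i. N' * i + \<Gamma> (stage T i))"
  define m where "m k = N' * T (Suc k) + \<Gamma> k" for k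
  define l where "l k = \<Gamma> (Suc k) - \<Gamma> k" for k
  define e where "e k = m k + l k" for k
  have \<Gamma>m: "\<Gamma> k \<le> \<Gamma> (Suc k)" for k using \<Gamma>(2)[of k] by simp
  have \<Gamma>mono: "\<Gamma> j \<le> \<Gamma> k" if "j \<le> k" for j k using that \<Gamma>m by (rule lift_Suc_mono_le[rotated])
  \<comment> \<open>The doubling condition makes the inserted lengths nondecreasing, so earlier runs
    cannot beat run \<open>k\<close>.\<close>
  have lmono: "l j \<le> l k" if "j \<le> k" for j k
  proof (rule lift_Suc_mono_le[OF _ that])
    show "l n \<le> l (Suc n)" for n using \<Gamma>(2)[of "Suc n"] by (simp add: l_def)
  qed
  have e_eq: "e k = N' * T (Suc k) + \<Gamma> (Suc k)" for k using \<Gamma>m[of k] by (simp add: e_def m_def l_def)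
  have S_sum: "S = (\<lambda>i. (N + 2) * i + (\<Sum>j<i. r j))"
    using run_gap_sum[OF T \<Gamma>(1) \<Gamma>m] by (simp add: S_def N'_def r_def)
  have Smono: "S i \<le> S j" if "i \<le> j" for i j
    using that unfolding S_sum by (intro add_mono mult_left_mono sum_mono2) auto
  have Sge: "i \<le> S i" for i by (simp add: S_def N'_def)
  note marks = block_marks[OF len pre S_sum[unfolded r_def]]
  have r_eq: "r (T (Suc k) - 1) = l k" "S (T (Suc k) - 1) + N' = m k" for k
  proof -
    have 1: "T k < T (Suc k)" using T(1) by (simp add: strict_mono_less)
    then obtain t where t: "T (Suc k) = Suc t" by (cases "T (Suc k)") auto
    have st: "stage T t = k" "stage T (Suc t) = Suc k"
      using 1 t stage_T[OF T(1), of "Suc k"] by (auto intro!: stage_eq T(1))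
    show "r (T (Suc k) - 1) = l k" "S (T (Suc k) - 1) + N' = m k"
      by (simp_all add: t st r_def run_gap_def l_def S_def m_def)
  qed
  have run: "is_run x (m k) (l k)" for k
    using marks(3)[of "T (Suc k) - 1"] r_eq[of k] by (simp add: N'_def r_def add.assoc)
  have N'm: "N' * i < N' * j" if "i < j" for i j
    by (rule mult_less_mono2[OF that]) (simp add: N'_def)
  have strict: "strict_mono e"
    unfolding strict_mono_Suc_iff
  proof
    fix n
    have "T (Suc n) < T (Suc (Suc n))" using T(1) by (simp add: strict_mono_less)
    then show "e n < e (Suc n)" unfolding e_eq using \<Gamma>m[of "Suc n"]
      by (intro add_less_le_mono N'm) auto
  qed
  let ?R = "\<lambda>n. run_length n x"
  \<comment> \<open>Until the new run draws level, run \<open>k\<close> bounds the maximum from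
    below. Afterwards the new run has \<open>n - m (Suc k)\<close> digits so far, and
    \<open>(n - m) / n\<close> increases with \<open>n\<close>.\<close>
  have lower: "real (l k) * real n \<le> real (?R n) * real (m (Suc k) + l k)" if n: "e k \<le> n" "n \<le> e (Suc k)" "1 \<le> n" for k n
  proof (cases "n \<le> m (Suc k) + l k")
    case True
    have "l k \<le> ?R n" using n by (intro run_length_ge[OF run]) (auto simp: e_def)
    then show ?thesis using True by (intro mult_mono) auto
  next
    case False
    have "is_run x (m (Suc k)) (n - m (Suc k))"
      using n False by (intro is_run_sub[OF run[of "Suc k"]]) (auto simp: e_def)
    then have "n - m (Suc k) \<le> ?R n" using n False by (intro run_length_ge) auto
    then have "real n - real (m (Suc k)) \<le> real (?R n)" using False by linarith
    then have "(real n - real (m (Suc k))) * real (m (Suc k) + l k) \<le> real (?R n) * real (m (Suc k) + l k)"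
      by (intro mult_right_mono) auto
    moreover have "0 \<le> real (m (Suc k)) * (real n - real (m (Suc k)) - real (l k))"
      using False by (intro mult_nonneg_nonneg) auto
    ultimately show ?thesis by (simp add: algebra_simps)
  qed
  have upper: "?R (m (Suc k) + l k) \<le> l k + N'" for k
  proof -
    let ?n = "m (Suc k) + l k"
    have "1 \<le> ?n"
    proof -
      have "T 0 < T (Suc (Suc k))" using T(1) by (simp add: strict_mono_less)
      then show ?thesis by (simp add: m_def N'_def)
    qed
    then obtain j where j: "j + ?R ?n \<le> ?n" "is_run x j (?R ?n)" by (rule run_length_attained)
    have mk: "cf_digit (S i + N + 1) x \<noteq> cf_digit (S i + N + 2) x" for i
      using marks(1)[of i] marks(2)[of i] by simp
    obtain i where i: "j \<le> S i + N" "j + ?R ?n \<le> S i + N + 1" "i = 0 \<or> S (i - 1) + N < j"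
      by (rule run_localize[OF mk Sge j(2)])
    show ?thesis
    proof (cases i)
      case 0
      have "S 0 = 0" unfolding S_sum by simp
      then show ?thesis using i 0 by (simp add: N'_def)
    next
      case (Suc q)
      then have q: "S q + N < j" using i(3) by simp
      have Sq: "S (Suc q) = S q + N' + r q" unfolding S_sum by (simp add: N'_def)
      \<comment> \<open>A run between two markers has at most \<open>N'\<close> digits besides the
        inserted ones. Before the new run these are at most \<open>l k\<close>; from there on, the
        position \<open>n\<close> itself cuts the run off.\<close>
      have le: "?R ?n \<le> N' + r q" using i(2) q Suc Sq by simp
      show ?thesis
      proof (cases "Suc q < T (Suc (Suc k))")
        case True
        have "r q \<le> l k"
          using stage_Suc[OF T, of q]
        proof (elim disjE exE conjE)
          assume "stage T (Suc q) = stage T q"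
          then show ?thesis by (simp add: r_def run_gap_def)
        next
          fix p assume p: "stage T q = p" "Suc q = T (Suc p)" "stage T (Suc q) = Suc p"
          have "T (Suc p) < T (Suc (Suc k))" using True p(2) by simp
          then have "p \<le> k" using strict_mono_less[OF T(1)] by simp
          then have "l p \<le> l k" by (rule lmono)
          then show ?thesis using p by (simp add: r_def run_gap_def l_def)
        qed
        then show ?thesis using le by simp
      next
        case False
        then have "S (T (Suc (Suc k)) - 1) \<le> S q" by (intro Smono) simp
        then have "m (Suc k) \<le> S q + N'" using r_eq(2)[of "Suc k"] by simp
        then show ?thesis using q j(1) by (simp add: N'_def)
      qed
    qed
  qed
  have ev\<Gamma>: "eventually (\<lambda>k. 0 < real (\<Gamma> (Suc k))) sequentially"
    using filterlim_at_top_dense[THEN iffD1, OF filterlim_compose[OF inf filterlim_Suc]] by blast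
  have aB: "a \<le> 1 / 2" "0 \<le> B"
  proof -
    have "real (\<Gamma> k) / real (\<Gamma> (Suc k)) \<le> 1 / 2" for k
    proof (cases "\<Gamma> (Suc k) = 0")
      case False
      have "2 * real (\<Gamma> k) \<le> real (\<Gamma> (Suc k))" using \<Gamma>(2)[of k] by linarith
      then show ?thesis using False by (simp add: divide_le_eq)
    qed simp
    then show "a \<le> 1 / 2" by (intro LIMSEQ_le_const2[OF a]) auto
    show "0 \<le> B" by (intro LIMSEQ_le_const[OF B]) auto
  qed
  have den0: "0 < real (N + 2) * B + 2 - a"
  proof -
    have "0 \<le> real (N + 2) * B" using aB(2) by (intro mult_nonneg_nonneg) auto
    then show ?thesis using aB(1) by linarith
  qed
  have lim_l: "(\<lambda>k. 1 - real (\<Gamma> k) / real (\<Gamma> (Suc k))) \<longlonglongrightarrow> 1 - a" by (intro tendsto_intros a)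
  have lim_den: "(\<lambda>k. real N' * (real (T (Suc (Suc k))) / real (\<Gamma> (Suc k))) + 1 + (1 - real (\<Gamma> k) / real (\<Gamma> (Suc k))))
      \<longlonglongrightarrow> real N' * B + 1 + (1 - a)" by (intro tendsto_intros a LIMSEQ_Suc[OF B])
  have lim_c: "(\<lambda>k. (1 - real (\<Gamma> k) / real (\<Gamma> (Suc k)) + c / real (\<Gamma> (Suc k))) /
     (real N' * (real (T (Suc (Suc k))) / real (\<Gamma> (Suc k))) + 1 + (1 - real (\<Gamma> k) / real (\<Gamma> (Suc k))))) \<longlonglongrightarrow> \<alpha>" for c
  proof -
    have "(\<lambda>k. c / real (\<Gamma> (Suc k))) \<longlonglongrightarrow> 0"
      by (rule tendsto_divide_0[OF tendsto_const filterlim_at_top_imp_at_infinity[OF filterlim_compose[OF inf filterlim_Suc]]])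
    from tendsto_divide[OF tendsto_add[OF lim_l this] lim_den] show ?thesis
      using den0 by (simp add: \<alpha> N'_def algebra_simps)
  qed
  have lim_v: "(\<lambda>k. (real (l k) + c) / real (m (Suc k) + l k)) \<longlonglongrightarrow> \<alpha>" for c
  proof (rule Lim_transform_eventually[OF lim_c[of c]])
    show "eventually (\<lambda>k. (1 - real (\<Gamma> k) / real (\<Gamma> (Suc k)) + c / real (\<Gamma> (Suc k))) /
     (real N' * (real (T (Suc (Suc k))) / real (\<Gamma> (Suc k))) + 1 + (1 - real (\<Gamma> k) / real (\<Gamma> (Suc k)))) =
      (real (l k) + c) / real (m (Suc k) + l k)) sequentially"
      using ev\<Gamma>
    proof eventually_elim
      case (elim k)
      define G where "G = real (\<Gamma> (Suc k))"
      have G: "0 < G" using elim by (simp add: G_def)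
      have lk: "real (l k) = G - real (\<Gamma> k)" using \<Gamma>m[of k] by (simp add: l_def G_def of_nat_diff)
      have num: "1 - real (\<Gamma> k) / G + c / G = (real (l k) + c) / G"
        using G by (simp add: lk field_simps)
      have den: "real N' * (real (T (Suc (Suc k))) / G) + 1 + (1 - real (\<Gamma> k) / G) = real (m (Suc k) + l k) / G"
        using G by (simp add: lk m_def G_def[symmetric] field_simps)
      show ?case unfolding G_def[symmetric] num den using G by simp
    qed
  qed
  let ?f = "\<lambda>n. ereal (real (?R n) / real n)"
  have "ereal \<alpha> \<le> liminf ?f"
  proof (rule ccontr)
    assume "\<not> ereal \<alpha> \<le> liminf ?f"
    then obtain c where c: "liminf ?f < ereal c" "ereal c < ereal \<alpha>"
      using ereal_dense2[of "liminf ?f" "ereal \<alpha>"] by (auto simp: not_le)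
    have "eventually (\<lambda>k. c < (real (l k) + 0) / real (m (Suc k) + l k)) sequentially"
      using order_tendstoD(1)[OF lim_v[of 0], of c] c by simp
    then obtain K where K: "\<And>k. K \<le> k \<Longrightarrow> c < real (l k) / real (m (Suc k) + l k)"
      by (auto simp: eventually_sequentially)
    have "eventually (\<lambda>n. ereal c \<le> ?f n) sequentially"
      using eventually_ge_at_top[of "max 1 (e K)"]
    proof eventually_elim
      case (elim n)
      then have n: "1 \<le> n" "e K \<le> n" by auto
      obtain k where k: "K \<le> k" "e k \<le> n" "n \<le> e (Suc k)" using strict_mono_bracket[OF strict n(2)] by blast
      have "T 0 < T (Suc (Suc k))" using T(1) by (simp add: strict_mono_less)
      then have "0 < m (Suc k) + l k" by (simp add: m_def N'_def)
      then have mp: "0 < real (m (Suc k) + l k)" by (simp only: of_nat_0_less_iff)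
      have "c \<le> real (l k) / real (m (Suc k) + l k)" using K[OF k(1)] by simp
      also have "\<dots> \<le> real (?R n) / real n"
        using lower[OF k(2,3) n(1)] mp n(1) by (simp add: divide_le_eq le_divide_eq mult_ac)
      finally show ?case by simp
    qed
    then have "ereal c \<le> liminf ?f" by (rule Liminf_bounded)
    then show False using c by simp
  qed
  moreover have "liminf ?f \<le> ereal \<alpha>"
  proof -
    define s where "s k = m (Suc k) + l k" for k
    have "strict_mono s"
      unfolding strict_mono_Suc_iff
    proof
      fix n
      have "T (Suc (Suc n)) < T (Suc (Suc (Suc n)))" using T(1) by (simp add: strict_mono_less)
      then have "m (Suc n) < m (Suc (Suc n))" unfolding m_def using \<Gamma>m[of "Suc n"]
        by (intro add_less_le_mono N'm) auto
      then show "s n < s (Suc n)" using lmono[of n "Suc n"] by (simp add: s_def)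
    qed
    then have "liminf ?f \<le> liminf (?f \<circ> s)" by (rule liminf_subseq_mono)
    also have "\<dots> \<le> liminf (\<lambda>k. ereal ((real (l k) + real N') / real (m (Suc k) + l k)))"
    proof (rule Liminf_mono, rule always_eventually, rule allI)
      fix k
      have "real (?R (s k)) \<le> real (l k) + real N'" using upper[of k] unfolding s_def by linarith
      then show "(?f \<circ> s) k \<le> ereal ((real (l k) + real N') / real (m (Suc k) + l k))"
        unfolding s_def by (simp add: divide_right_mono)
    qed
    also have "\<dots> = ereal \<alpha>"
      using lim_v[of "real N'"] by (intro lim_imp_Liminf) auto
    finally show ?thesis .
  qed
  ultimately have "liminf ?f = ereal \<alpha>" by (rule antisym[rotated])
  then show ?thesis using x by (simp add: F_set_def)
qed

text \<open>For \<alpha> = 0 no ones are inserted, so \<Gamma> does not tend to infinity as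
  \<open>stage_liminf\<close> requires. The markers alone bound all runs.\<close>

lemma no_runs_F_set_0:
  assumes x: "x \<in> {0..<1}" "x \<notin> \<rat>" and len: "\<And>i. length (\<omega> i) = N"
    and pre: "\<And>i. cf_prefix (length (blocks (\<lambda>_. 0) \<omega> i)) x = blocks (\<lambda>_. 0) \<omega> i"
  shows "x \<in> F_set 0"
proof -
  let ?R = "\<lambda>n. run_length n x"
  define S where "S = (\<lambda>i. (N + 2) * i + (\<Sum>j<i. (0::nat)))"
  have mk: "cf_digit (S i + N + 1) x \<noteq> cf_digit (S i + N + 2) x" for i
    using block_marks(1,2)[OF len pre S_def, of i] by simp
  have Sge: "i \<le> S i" for i by (simp add: S_def)
  have R: "?R n \<le> N + 2" if n: "1 \<le> n" for n
  proof -
    obtain j where j: "j + ?R n \<le> n" "is_run x j (?R n)" using n by (rule run_length_attained)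
    obtain i where i: "j \<le> S i + N" "j + ?R n \<le> S i + N + 1" "i = 0 \<or> S (i - 1) + N < j"
      by (rule run_localize[OF mk Sge j(2)])
    then show ?thesis by (cases i) (auto simp: S_def)
  qed
  have "(\<lambda>n. real (?R n) / real n) \<longlonglongrightarrow> 0"
  proof (rule tendsto_sandwich[OF _ _ tendsto_const])
    show "eventually (\<lambda>n. real (?R n) / real n \<le> real (N + 2) / real n) sequentially"
      using eventually_ge_at_top[of 1]
    proof eventually_elim
      case (elim n)
      then show ?case using R[of n] by (intro divide_right_mono) auto
    qed
    show "(\<lambda>n. real (N + 2) / real n) \<longlonglongrightarrow> 0" by (rule lim_const_over_n)
  qed simp
  then have "liminf (\<lambda>n. ereal (real (?R n) / real n)) = ereal 0"
    by (intro lim_imp_Liminf) auto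
  then show ?thesis using x by (simp add: F_set_def)
qed

subsection \<open>Lower bound\<close>

text \<open>A strict lower bound survives truncation to finitely many words, and the mass
  distribution needs finite sets and a bounded alphabet.\<close>

lemma finite_words_sum:
  assumes "ennreal K < Zsum N \<rho>" "0 \<le> K"
  obtains V M where "finite V" "V \<noteq> {}" "\<And>v. v \<in> V \<Longrightarrow> length v = N \<and> set v \<subseteq> {1..M}"
    "K < (\<Sum>v\<in>V. qw v powr (- (2 * \<rho>)))"
proof -
  let ?h = "\<lambda>w. if length w = N then qweight \<rho> w else 0"
  have "Zsum N \<rho> = infsum ?h UNIV" by (simp add: Zsum_def infsum_ennreal_eq_nn_integral)
  also have "\<dots> = (SUP F\<in>{F. finite F \<and> F \<subseteq> UNIV}. sum ?h F)" by (rule nonneg_infsum_complete) simp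
  finally obtain F where F: "finite F" "ennreal K < sum ?h F" using assms(1) by (auto simp: less_SUP_iff)
  define V where "V = {v \<in> F. length v = N \<and> 0 \<notin> set v}"
  have V: "finite V" using F by (simp add: V_def)
  have "sum ?h F = (\<Sum>v\<in>V. ennreal (qw v powr (- (2 * \<rho>))))"
    by (rule sum.mono_neutral_cong_right[OF F(1)]) (auto simp: V_def qweight_def)
  also have "\<dots> = ennreal (\<Sum>v\<in>V. qw v powr (- (2 * \<rho>)))" by (rule sum_ennreal) simp
  finally have K: "K < (\<Sum>v\<in>V. qw v powr (- (2 * \<rho>)))" using F(2) assms(2) by (simp add: ennreal_less_iff)
  then have ne: "V \<noteq> {}" using assms(2) by auto
  define M where "M = Max (insert 1 (\<Union>v\<in>V. set v))"
  have fin: "finite (insert 1 (\<Union>v\<in>V. set v))" using V by simp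
  have "length v = N \<and> set v \<subseteq> {1..M}" if v: "v \<in> V" for v
  proof -
    have "a \<in> {1..M}" if a: "a \<in> set v" for a
    proof -
      have "a \<noteq> 0" using a v by (metis (mono_tags, lifting) V_def mem_Collect_eq)
      moreover have "a \<le> M" unfolding M_def using a v by (intro Max_ge[OF fin]) auto
      ultimately show ?thesis by simp
    qed
    then show ?thesis using v by (auto simp: V_def)
  qed
  then show ?thesis using that[OF V ne _ K] by blast
qed

text \<open>Only the cumulative number of ones enters the product. Hence \<open>Z\<close> has to pay
  for \<open>g'\<close> ones per block on average, although they come in few long runs.\<close>

lemma constant_blocks_prod:
  assumes Z: "24 powr (2 * \<rho>) * golden powr (2 * \<rho> * g') \<le> Z" and \<rho>: "0 \<le> \<rho>"
    and r: "real (\<Sum>j<i. r j) \<le> g' * real i"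
  shows "(\<Prod>j<i. 24 powr (2 * \<rho>) * golden powr (2 * \<rho> * real (r j)) / Z) \<le> 1"
proof -
  have Z0: "0 < Z" using Z golden_gt_1 by (smt (verit) mult_pos_pos powr_gt_zero)
  have "(\<Prod>j<i. 24 powr (2 * \<rho>) * golden powr (2 * \<rho> * real (r j)) / Z) =
      (24 powr (2 * \<rho>) / Z) ^ i * golden powr (2 * \<rho> * real (\<Sum>j<i. r j))"
    using golden_gt_1 by (induction i) (simp_all add: powr_add ring_distribs)
  also have "\<dots> \<le> (24 powr (2 * \<rho>) / Z) ^ i * golden powr (2 * \<rho> * (g' * real i))"
    using Z0 golden_gt_1 \<rho> r by (intro mult_left_mono powr_mono) auto
  also have "golden powr (2 * \<rho> * (g' * real i)) = (golden powr (2 * \<rho> * g')) ^ i"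
    using golden_gt_1 by (simp add: powr_powr mult_ac flip: powr_realpow)
  also have "(24 powr (2 * \<rho>) / Z) ^ i * (golden powr (2 * \<rho> * g')) ^ i = (24 powr (2 * \<rho>) * golden powr (2 * \<rho> * g') / Z) ^ i"
    by (simp add: power_mult_distrib power_divide)
  also have "\<dots> \<le> 1" using Z Z0 by (intro power_le_one) (auto simp: divide_le_eq)
  finally show ?thesis .
qed

text \<open>Integer versions of \<open>X ^ k\<close> and \<open>c * X ^ k\<close>. Subtracting 1
  achieves \<open>T 0 = 0\<close>, and a ratio above 2 gives the doubling condition.\<close>

lemma floor_stages:
  fixes X c :: real and T \<Gamma> :: "nat \<Rightarrow> nat"
  assumes X: "2 < X" and c: "0 < c"
    and T_def: "T = (\<lambda>k. nat \<lfloor>X ^ k\<rfloor> - 1)"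
    and \<Gamma>_def: "\<Gamma> = (\<lambda>k. nat \<lfloor>c * real (nat \<lfloor>X ^ k\<rfloor> - 1)\<rfloor>)"
  shows "strict_mono T" "T 0 = 0" "\<Gamma> 0 = 0" "2 * \<Gamma> k \<le> \<Gamma> (Suc k)" "real (\<Gamma> k) \<le> c * real (T k)"
    "filterlim (\<lambda>k. real (\<Gamma> k)) at_top sequentially"
    "(\<lambda>k. real (\<Gamma> k) / real (\<Gamma> (Suc k))) \<longlonglongrightarrow> 1 / X"
    "(\<lambda>k. real (T (Suc k)) / real (\<Gamma> k)) \<longlonglongrightarrow> X / c"
proof -
  define t where "t k = nat \<lfloor>X ^ k\<rfloor>" for k
  have Xk: "1 \<le> X ^ k" for k using X by (intro one_le_power) simp
  have t1: "1 \<le> t k" for k using Xk[of k] by (simp add: t_def le_nat_iff le_floor_iff)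
  have tX: "real (t k) \<le> X ^ k" "X ^ k < real (t k) + 1" for k
    using Xk[of k] unfolding t_def by linarith+
  have t2: "2 * t k \<le> t (Suc k)" for k
  proof -
    have "2 * X ^ k \<le> X * X ^ k" using X by (intro mult_right_mono) auto
    then have "real (2 * t k) \<le> X ^ Suc k" using tX(1)[of k] by simp
    then show ?thesis unfolding t_def[of "Suc k"] by (rule le_nat_floor)
  qed
  have Tt: "T k = t k - 1" for k by (simp add: T_def t_def)
  show "strict_mono T" unfolding strict_mono_Suc_iff Tt
  proof
    fix n show "t n - 1 < t (Suc n) - 1" using t1[of n] t2[of n] by linarith
  qed
  show "T 0 = 0" by (simp add: T_def)
  then show "\<Gamma> 0 = 0" by (simp add: \<Gamma>_def)
  have G: "\<Gamma> k = nat \<lfloor>c * real (T k)\<rfloor>" for k by (simp add: \<Gamma>_def T_def)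
  have c0: "0 \<le> c * real (T k)" for k using c by simp
  have GT: "real (\<Gamma> k) \<le> c * real (T k)" "c * real (T k) < real (\<Gamma> k) + 1" for k
    using c0[of k] unfolding G by linarith+
  then show "real (\<Gamma> k) \<le> c * real (T k)" by blast
  show "2 * \<Gamma> k \<le> \<Gamma> (Suc k)"
  proof -
    have "2 * T k \<le> T (Suc k)" using t1[of k] t2[of k] unfolding Tt by linarith
    then have "2 * real (T k) \<le> real (T (Suc k))" by linarith
    then have "c * (2 * real (T k)) \<le> c * real (T (Suc k))" using c by (intro mult_left_mono) auto
    then have "real (2 * \<Gamma> k) \<le> c * real (T (Suc k))" using GT(1)[of k] by simp
    then show ?thesis unfolding G[of "Suc k"] by (rule le_nat_floor)
  qed
  have Xinf: "filterlim (\<lambda>k. X ^ k) at_top sequentially" 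
  proof (rule filterlim_at_infinity_imp_filterlim_at_top)
    show "filterlim (\<lambda>k. X ^ k) at_infinity sequentially"
      using X by (intro filterlim_realpow_sequentially_gt1) simp
  qed (use X in simp)
  have small: "(\<lambda>k. d / X ^ k) \<longlonglongrightarrow> 0" for d
    by (rule tendsto_divide_0[OF tendsto_const filterlim_at_top_imp_at_infinity[OF Xinf]])
  have limT: "(\<lambda>k. real (T k) / X ^ k) \<longlonglongrightarrow> 1"
  proof (rule tendsto_sandwich[OF _ _ _ tendsto_const])
    show "eventually (\<lambda>k. 1 - 2 / X ^ k \<le> real (T k) / X ^ k) sequentially"
    proof (intro always_eventually allI)
      fix k
      have "X ^ k - 2 \<le> real (T k)" using tX(2)[of k] t1[of k] by (simp add: Tt of_nat_diff)
      then have "(X ^ k - 2) / X ^ k \<le> real (T k) / X ^ k" using X by (intro divide_right_mono) auto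
      then show "1 - 2 / X ^ k \<le> real (T k) / X ^ k" using X by (simp add: diff_divide_distrib)
    qed
    show "eventually (\<lambda>k. real (T k) / X ^ k \<le> 1) sequentially"
    proof (intro always_eventually allI)
      fix k
      have "real (T k) \<le> X ^ k" using tX(1)[of k] by (simp add: Tt)
      then show "real (T k) / X ^ k \<le> 1" using X by (simp add: divide_le_eq_1)
    qed
    show "(\<lambda>k. 1 - 2 / X ^ k) \<longlonglongrightarrow> 1" using tendsto_diff[OF tendsto_const small, of 1 2] by simp
  qed
  have limG: "(\<lambda>k. real (\<Gamma> k) / X ^ k) \<longlonglongrightarrow> c"
  proof (rule tendsto_sandwich)
    show "eventually (\<lambda>k. c * (real (T k) / X ^ k) - 1 / X ^ k \<le> real (\<Gamma> k) / X ^ k) sequentially"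
    proof (intro always_eventually allI)
      fix k
      have "(c * real (T k) - 1) / X ^ k \<le> real (\<Gamma> k) / X ^ k"
        using X GT(2)[of k] by (intro divide_right_mono) auto
      then show "c * (real (T k) / X ^ k) - 1 / X ^ k \<le> real (\<Gamma> k) / X ^ k" by (simp add: diff_divide_distrib)
    qed
    show "eventually (\<lambda>k. real (\<Gamma> k) / X ^ k \<le> c * (real (T k) / X ^ k)) sequentially"
    proof (intro always_eventually allI)
      fix k
      have "real (\<Gamma> k) / X ^ k \<le> c * real (T k) / X ^ k"
        using X GT(1)[of k] by (intro divide_right_mono) auto
      then show "real (\<Gamma> k) / X ^ k \<le> c * (real (T k) / X ^ k)" by simp
    qed
    show "(\<lambda>k. c * (real (T k) / X ^ k)) \<longlonglongrightarrow> c" using tendsto_mult[OF tendsto_const limT, of c] by simp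
    show "(\<lambda>k. c * (real (T k) / X ^ k) - 1 / X ^ k) \<longlonglongrightarrow> c"
      using tendsto_diff[OF tendsto_mult[OF tendsto_const limT, of c] small[of 1]] by simp
  qed
  have "filterlim (\<lambda>k. real (\<Gamma> k) / X ^ k * X ^ k) at_top sequentially"
    by (rule filterlim_tendsto_pos_mult_at_top[OF limG c Xinf])
  moreover have "(\<lambda>k. real (\<Gamma> k) / X ^ k * X ^ k) = (\<lambda>k. real (\<Gamma> k))" using X by (intro ext) simp
  ultimately show "filterlim (\<lambda>k. real (\<Gamma> k)) at_top sequentially" by (simp only:)
  have "(\<lambda>k. (real (\<Gamma> k) / X ^ k) / (real (\<Gamma> (Suc k)) / X ^ Suc k) * (1 / X)) \<longlonglongrightarrow> c / c * (1 / X)"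
    using c by (intro tendsto_intros limG LIMSEQ_Suc[OF limG]) auto
  moreover have "(real (\<Gamma> k) / X ^ k) / (real (\<Gamma> (Suc k)) / X ^ Suc k) * (1 / X) = real (\<Gamma> k) / real (\<Gamma> (Suc k))" for k
    using X by simp
  ultimately show "(\<lambda>k. real (\<Gamma> k) / real (\<Gamma> (Suc k))) \<longlonglongrightarrow> 1 / X" using c by simp
  have "(\<lambda>k. (real (T (Suc k)) / X ^ Suc k) / (real (\<Gamma> k) / X ^ k) * X) \<longlonglongrightarrow> 1 / c * X"
    using c by (intro tendsto_intros limG LIMSEQ_Suc[OF limT]) auto
  moreover have "(\<lambda>k. (real (T (Suc k)) / X ^ Suc k) / (real (\<Gamma> k) / X ^ k) * X) = (\<lambda>k. real (T (Suc k)) / real (\<Gamma> k))"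
    using X by (intro ext) simp
  moreover have "1 / c * X = X / c" by simp
  ultimately show "(\<lambda>k. real (T (Suc k)) / real (\<Gamma> k)) \<longlonglongrightarrow> X / c" by (simp only:)
qed

lemma golden_powr_times_nat: "golden powr (- (2 * d * real n)) = (golden powr (- (2 * d))) ^ n"
  using golden_gt_1 by (simp add: powr_powr flip: powr_realpow)

text \<open>The growth rate \<open>X = 2 (1 - \<alpha>) / (1 - 2 \<alpha>)\<close> of the stages is the double root of
  \<open>X\<^sup>2 - g (\<beta> - 1) X + g \<beta>\<close> with \<open>\<beta> = (1 - \<alpha>) / \<alpha>\<close>.\<close>

lemma hausdorff_measure_F_set_below_half:
  assumes \<alpha>: "0 \<le> \<alpha>" "\<alpha> < 1 / 2" and g: "g = 4 * \<alpha> * (1 - \<alpha>) / (1 - 2 * \<alpha>)\<^sup>2"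
    and \<rho>: "0 < \<rho>" "\<rho> < \<rho>'" and c: "0 < c" and A: "\<And>n. 1 \<le> n \<Longrightarrow> ennreal c \<le> Asum n g \<rho>'"
  shows "hausdorff_measure \<rho> (F_set \<alpha>) \<noteq> 0"
proof -
  have g0: "0 \<le> g" using \<alpha> by (simp add: g)
  \<comment> \<open>The loss per block, independent of \<open>N\<close>: junctions account for 24,
    and \<open>4 * \<rho> * g\<close> is the price of the \<open>2 * g\<close> ones that go with the
    two marker letters.\<close>
  define h where "h = 24 powr (2 * \<rho>) * golden powr (4 * \<rho> * g)"
  have h0: "0 < h" using golden_gt_1 by (simp add: h_def)
  have "golden powr (- (2 * (\<rho>' - \<rho>))) < 1"
    using golden_gt_1 \<rho> powr_less_mono[of "- (2 * (\<rho>' - \<rho>))" 0 golden] by simp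
  then have "(\<lambda>n. (golden powr (- (2 * (\<rho>' - \<rho>)))) ^ n * h) \<longlonglongrightarrow> 0 * h"
    by (intro tendsto_intros LIMSEQ_power_zero) simp
  then have "eventually (\<lambda>n. (golden powr (- (2 * (\<rho>' - \<rho>)))) ^ n * h < c) sequentially"
    using c by (intro order_tendstoD(2)) auto
  then obtain n where n: "(golden powr (- (2 * (\<rho>' - \<rho>)))) ^ n * h < c" by (auto simp: eventually_sequentially)
  define N where "N = Suc n"
  define N' where "N' = N + 2"
  define K where "K = 24 powr (2 * \<rho>) * golden powr (2 * \<rho> * (g * N'))"
  have K0: "0 < K" using golden_gt_1 by (simp add: K_def)
  \<comment> \<open>Otherwise \<open>Asum_decay\<close> between \<rho> and \<rho>' would bound
    \<open>c\<close> by \<open>h\<close> times a power that is already too small for this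
    \<open>N\<close>.\<close>
  have "ennreal K < Zsum N \<rho>"
  proof (rule ccontr)
    assume "\<not> ennreal K < Zsum N \<rho>"
    then have le: "Zsum N \<rho> \<le> ennreal K" by simp
    let ?d = "golden powr (- (2 * (\<rho>' - \<rho>) * ((real N - 1) + g * N)))"
    have "ennreal c \<le> Asum N g \<rho>'" by (rule A) (simp add: N_def)
    also have "\<dots> \<le> ennreal ?d * Asum N g \<rho>" using \<rho> g0 by (intro Asum_decay) (auto simp: N_def)
    also have "\<dots> \<le> ennreal ?d * (ennreal (golden powr (- (2 * \<rho> * g * real N))) * ennreal K)"
      unfolding Asum_def using le by (intro mult_left_mono) auto
    also have "\<dots> = ennreal (?d * (golden powr (- (2 * \<rho> * g * real N)) * K))"
      using K0 by (simp add: ennreal_mult)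
    finally have "c \<le> ?d * (golden powr (- (2 * \<rho> * g * real N)) * K)" using K0 by (simp add: ennreal_le_iff)
    also have "golden powr (- (2 * \<rho> * g * real N)) * K = h"
    proof -
      have "golden powr (- (2 * \<rho> * g * real N)) * golden powr (2 * \<rho> * (g * N')) = golden powr (4 * \<rho> * g)"
        unfolding powr_add[symmetric] N'_def by (simp add: algebra_simps)
      then show ?thesis unfolding K_def h_def by (metis mult.left_commute)
    qed
    also have "?d \<le> (golden powr (- (2 * (\<rho>' - \<rho>)))) ^ n"
    proof -
      have "?d \<le> golden powr (- (2 * (\<rho>' - \<rho>) * real n))"
        using golden_gt_1 \<rho> g0 by (intro powr_mono le_imp_neg_le mult_left_mono) (auto simp: N_def)
      also have "golden powr (- (2 * (\<rho>' - \<rho>) * real n)) = (golden powr (- (2 * (\<rho>' - \<rho>)))) ^ n"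
        by (rule golden_powr_times_nat)
      finally show ?thesis .
    qed
    finally show False using n h0 by (simp add: mult_right_mono)
  qed
  then obtain V M where V: "finite V" "V \<noteq> {}" "\<And>v. v \<in> V \<Longrightarrow> length v = N \<and> set v \<subseteq> {1..M}"
    and KV: "K < (\<Sum>v\<in>V. qw v powr (- (2 * \<rho>)))"
    using finite_words_sum[of K N \<rho>] K0 by (metis less_imp_le)
  have core: "hausdorff_measure \<rho> (F_set \<alpha>) \<noteq> 0"
    if r: "\<And>i. real (\<Sum>j<i. r j) \<le> (g * N') * real i"
      and E: "\<And>x \<omega>. x \<in> {0..<1} \<Longrightarrow> x \<notin> \<rat> \<Longrightarrow> \<forall>i. length (\<omega> i) = N \<Longrightarrow>
      \<forall>i. cf_prefix (length (blocks r \<omega> i)) x = blocks r \<omega> i \<Longrightarrow> x \<in> F_set \<alpha>" for r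
  \<comment> \<open>All blocks use the same alphabet, so the factor depending on \<open>M\<close> is
    a constant and \<open>C\<close> cancels it.\<close>
  proof (rule hausdorff_measure_blocks_nonzero[where V = "\<lambda>_. V" and Mx = "\<lambda>_. M" and N = N and r = r and C = "(real M + 1) powr (real (2 * N + 3) * \<rho>)"])
    fix i
    have "(\<Prod>j<i. 24 powr (2 * \<rho>) * golden powr (2 * \<rho> * real (r j)) / (\<Sum>v\<in>V. qw v powr (- (2 * \<rho>)))) \<le> 1"
      using KV \<rho> by (intro constant_blocks_prod[OF _ _ r]) (auto simp: K_def)
    also have "1 = (real M + 1) powr (real (2 * N + 3) * \<rho>) * (real M + 1) powr (- (real (2 * N + 3) * \<rho>))"
      unfolding powr_add[symmetric] by simp
    finally show "(\<Prod>j<i. 24 powr (2 * \<rho>) * golden powr (2 * \<rho> * real (r j)) / (\<Sum>v\<in>V. qw v powr (- (2 * \<rho>)))) \<le>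
      (real M + 1) powr (real (2 * N + 3) * \<rho>) * (real M + 1) powr (- (real (2 * N + 3) * \<rho>))" .
  next
    fix x \<omega> assume "x \<in> {0..<1}" "x \<notin> \<rat>" "\<forall>i. \<omega> i \<in> V" "\<forall>i. cf_prefix (length (blocks r \<omega> i)) x = blocks r \<omega> i"
    then show "x \<in> F_set \<alpha>" using V(3) by (intro E) auto
  qed (use V \<rho> in auto)
  show ?thesis
  proof (cases "\<alpha> = 0")
    case True
    show ?thesis
    proof (rule core[of "\<lambda>_. 0"])
      fix x \<omega> assume "x \<in> {0..<1}" "x \<notin> \<rat>" "\<forall>i. length (\<omega> i) = N"
        "\<forall>i. cf_prefix (length (blocks (\<lambda>_. 0) \<omega> i)) x = blocks (\<lambda>_. 0) \<omega> i"
      then show "x \<in> F_set \<alpha>" unfolding True by (intro no_runs_F_set_0[where \<omega> = \<omega> and N = N]) auto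
    qed (use g0 in simp)
  next
    case False
    then have \<alpha>0: "0 < \<alpha>" using \<alpha> by simp
    then have g1: "0 < g" using \<alpha> by (simp add: g)
    define X where "X = 2 * (1 - \<alpha>) / (1 - 2 * \<alpha>)"
    have X: "2 < X" using \<alpha> \<alpha>0 by (simp add: X_def less_divide_eq)
    have cc: "0 < g * N'" using g1 by (simp add: N'_def)
    define T where "T = (\<lambda>k. nat \<lfloor>X ^ k\<rfloor> - 1)"
    define \<Gamma> where "\<Gamma> = (\<lambda>k. nat \<lfloor>g * N' * real (nat \<lfloor>X ^ k\<rfloor> - 1)\<rfloor>)"
    note st = floor_stages[OF X cc T_def \<Gamma>_def]
    have mono: "\<Gamma> k \<le> \<Gamma> (Suc k)" for k using st(4)[of k] by simp
    show ?thesis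
    proof (rule core[of "run_gap T \<Gamma>"])
      fix i
      have "real (\<Sum>j<i. run_gap T \<Gamma> j) = real (\<Gamma> (stage T i))"
        using run_gap_sum[OF st(1-3) mono] by simp
      also have "\<dots> \<le> g * N' * real (T (stage T i))" by (rule st(5))
      also have "\<dots> \<le> g * N' * real i"
        using stage_bounds(1)[OF st(1,2), of i] cc by (intro mult_left_mono) auto
      finally show "real (\<Sum>j<i. run_gap T \<Gamma> j) \<le> g * N' * real i" .
    next
      fix x \<omega> assume x: "x \<in> {0..<1}" "x \<notin> \<rat>" "\<forall>i. length (\<omega> i) = N"
        "\<forall>i. cf_prefix (length (blocks (run_gap T \<Gamma>) \<omega> i)) x = blocks (run_gap T \<Gamma>) \<omega> i"
      have "1 - 2 * \<alpha> \<noteq> 0" "1 - \<alpha> \<noteq> 0" "\<alpha> \<noteq> 0" using \<alpha> \<alpha>0 by auto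
      have 1: "1 / X = (1 - 2 * \<alpha>) / (2 * (1 - \<alpha>))" by (simp add: X_def)
      have 2: "real (N + 2) * (X / (g * N')) = (1 - 2 * \<alpha>) / (2 * \<alpha>)"
      proof -
        have "real (N + 2) * (X / (g * N')) = X / g" by (simp add: N'_def)
        also have "\<dots> = (1 - 2 * \<alpha>) / (2 * \<alpha>)"
          using \<open>1 - 2 * \<alpha> \<noteq> 0\<close> \<open>1 - \<alpha> \<noteq> 0\<close> \<open>\<alpha> \<noteq> 0\<close>
          by (simp add: X_def g power2_eq_square frac_eq_eq)
        finally show ?thesis .
      qed
      have c1: "1 - 1 / X = 1 / (2 * (1 - \<alpha>))"
        unfolding 1 using \<open>1 - \<alpha> \<noteq> 0\<close> by (simp add: field_simps)
      have c2: "real (N + 2) * (X / (g * N')) + 2 - 1 / X = 1 / (2 * \<alpha> * (1 - \<alpha>))"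
        unfolding 1 2 using \<open>1 - \<alpha> \<noteq> 0\<close> \<open>\<alpha> \<noteq> 0\<close> by (simp add: field_simps)
      have \<alpha>eq: "\<alpha> = (1 - 1 / X) / (real (N + 2) * (X / (g * N')) + 2 - 1 / X)"
        unfolding c1 c2 using \<open>1 - \<alpha> \<noteq> 0\<close> \<open>\<alpha> \<noteq> 0\<close> by (simp add: divide_simps)
      show "x \<in> F_set \<alpha>"
        using x by (intro stage_liminf[where \<omega> = \<omega>, OF st(1,2,3,4,6,7,8) \<alpha>eq]) auto
    qed
  qed
qed

text \<open>For \<alpha> = 1/2 both limits in \<open>stage_liminf\<close> have to vanish, so
  \<open>\<Gamma> k\<close> must dominate \<open>T (Suc k)\<close>, which is about
  \<open>k * T k\<close>. On the other hand it must stay below small multiples of the square of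
  \<open>T k\<close>. The choice \<open>\<Gamma> k = (k + 1) * (k + 2) * T k\<close> lies in
  between.\<close>

lemma factorial_stages:
  fixes T \<Gamma> :: "nat \<Rightarrow> nat"
  assumes T_def: "T = (\<lambda>k. k * fact k)" and \<Gamma>_def: "\<Gamma> = (\<lambda>k. k * ((k + 1) * (k + 2) * fact k))"
  shows "strict_mono T" "T 0 = 0" "\<Gamma> 0 = 0" "2 * \<Gamma> k \<le> \<Gamma> (Suc k)"
    "filterlim (\<lambda>k. real (\<Gamma> k)) at_top sequentially"
    "(\<lambda>k. real (\<Gamma> k) / real (\<Gamma> (Suc k))) \<longlonglongrightarrow> 0"
    "(\<lambda>k. real (T (Suc k)) / real (\<Gamma> k)) \<longlonglongrightarrow> 0"
    "0 < e \<Longrightarrow> \<exists>K. \<forall>k\<ge>K. real (\<Gamma> k) \<le> e * (real (T k))\<^sup>2"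
proof -
  show "strict_mono T" unfolding strict_mono_Suc_iff
  proof
    fix n
    have "n * fact n < Suc n * fact n" by (intro mult_strict_right_mono) auto
    also have "\<dots> \<le> Suc n * fact (Suc n)" by (intro mult_left_mono fact_mono) auto
    finally show "T n < T (Suc n)" by (simp add: T_def)
  qed
  show "T 0 = 0" "\<Gamma> 0 = 0" by (simp_all add: T_def \<Gamma>_def)
  have GS: "\<Gamma> (Suc k) = ((k + 1) * (k + 3)) * ((k + 1) * (k + 2) * fact k)" for k
    by (simp add: \<Gamma>_def algebra_simps)
  show "2 * \<Gamma> k \<le> \<Gamma> (Suc k)"
  proof -
    have "2 * k \<le> (k + 1) * (k + 3)" by (simp add: algebra_simps)
    then have "(2 * k) * ((k + 1) * (k + 2) * fact k) \<le> ((k + 1) * (k + 3)) * ((k + 1) * (k + 2) * fact k)"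
      by (rule mult_le_mono1)
    then show ?thesis unfolding GS by (simp only: \<Gamma>_def mult.assoc)
  qed
  have "real k \<le> real (\<Gamma> k)" for k
  proof -
    have "k * 1 \<le> k * ((k + 1) * (k + 2) * fact k)" by (intro mult_le_mono2) (simp add: Suc_le_eq)
    then show ?thesis by (simp only: \<Gamma>_def of_nat_le_iff mult_1_right)
  qed
  then show "filterlim (\<lambda>k. real (\<Gamma> k)) at_top sequentially"
    by (intro filterlim_at_top_mono[OF filterlim_real_sequentially]) (auto intro: always_eventually)
  have f0: "0 < real ((k + 1) * (k + 2) * fact k)" for k by (simp only: of_nat_0_less_iff) simp
  have inv: "(\<lambda>n. 1 / real n) \<longlonglongrightarrow> 0" by (rule lim_1_over_n)
  show "(\<lambda>k. real (\<Gamma> k) / real (\<Gamma> (Suc k))) \<longlonglongrightarrow> 0"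
  proof (rule tendsto_sandwich[OF _ _ tendsto_const inv])
    show "eventually (\<lambda>k. real (\<Gamma> k) / real (\<Gamma> (Suc k)) \<le> 1 / real k) sequentially"
      using eventually_gt_at_top[of 0]
    proof eventually_elim
      case (elim k)
      have "real (\<Gamma> k) / real (\<Gamma> (Suc k)) = real k / real ((k + 1) * (k + 3))"
        unfolding GS using f0[of k] by (simp only: \<Gamma>_def of_nat_mult[of k] of_nat_mult[of "(k + 1) * (k + 3)"]) simp
      also have "\<dots> \<le> 1 / real k"
      proof -
        have "k * k \<le> (k + 1) * (k + 3)" by (simp add: algebra_simps)
        then have "real k * real k \<le> real ((k + 1) * (k + 3))" by (simp only: of_nat_le_iff flip: of_nat_mult)
        then have "real k \<le> 1 / real k * real ((k + 1) * (k + 3))"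
          using elim by (simp add: pos_le_divide_eq del: of_nat_mult of_nat_add)
        moreover have "0 < real ((k + 1) * (k + 3))" by (simp only: of_nat_0_less_iff) simp
        ultimately show ?thesis by (simp only: pos_divide_le_eq)
      qed
      finally show ?case .
    qed
  qed simp
  show "(\<lambda>k. real (T (Suc k)) / real (\<Gamma> k)) \<longlonglongrightarrow> 0"
  proof (rule tendsto_sandwich[OF _ _ tendsto_const inv])
    show "eventually (\<lambda>k. real (T (Suc k)) / real (\<Gamma> k) \<le> 1 / real k) sequentially"
      using eventually_gt_at_top[of 0]
    proof eventually_elim
      case (elim k)
      have "T (Suc k) * k \<le> \<Gamma> k"
      proof -
        have "(k + 1) * ((k + 1) * fact k) * k \<le> (k + 2) * ((k + 1) * fact k) * k" by (intro mult_le_mono1) simp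
        then show ?thesis by (simp add: T_def \<Gamma>_def algebra_simps)
      qed
      then have "real (T (Suc k)) * real k \<le> real (\<Gamma> k)" by (simp only: of_nat_le_iff flip: of_nat_mult)
      moreover have "0 < \<Gamma> k" using elim by (simp add: \<Gamma>_def)
      ultimately show ?case using elim by (simp add: field_simps)
    qed
  qed simp
  show "\<exists>K. \<forall>k\<ge>K. real (\<Gamma> k) \<le> e * (real (T k))\<^sup>2" if e: "0 < e"
  proof (intro exI allI impI)
    fix k assume k: "max 2 (nat \<lceil>1 + 3 / e\<rceil>) \<le> k"
    then have k2: "2 \<le> k" "1 + 3 / e \<le> real k" by (auto simp: nat_ceiling_le_eq)
    have ek: "3 \<le> e * (real k - 1)" using k2(2) e by (simp add: field_simps)
    have kk: "(real k + 1) * (real k + 2) \<le> 3 * real k ^ 2"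
    proof -
      have "2 * real k \<le> real k * real k" using k2 by (intro mult_right_mono) auto
      moreover have "2 \<le> real k" using k2 by simp
      moreover have "(real k + 1) * (real k + 2) = real k * real k + 3 * real k + 2" by (simp add: algebra_simps)
      ultimately show ?thesis unfolding power2_eq_square by linarith
    qed
    obtain j where j: "k = Suc (Suc j)" using k2 by (metis Suc_le_D numeral_2_eq_2 Suc_le_mono)
    have "real k * (real k - 1) * 1 \<le> real k * (real k - 1) * fact j"
      using fact_ge_1[of j, where 'a = real] by (intro mult_left_mono) (auto simp: j)
    also have "\<dots> = fact k" by (simp add: j algebra_simps)
    finally have fk: "real k * (real k - 1) \<le> fact k" by simp
    have "real (\<Gamma> k) = real k * ((real k + 1) * (real k + 2)) * fact k" by (simp add: \<Gamma>_def algebra_simps)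
    also have "\<dots> \<le> real k * (3 * real k ^ 2) * fact k"
      using kk by (intro mult_right_mono mult_left_mono) auto
    also have "\<dots> \<le> real k * (e * (real k - 1) * real k ^ 2) * fact k"
      using ek by (intro mult_right_mono mult_left_mono) auto
    also have "\<dots> = e * real k ^ 2 * (real k * (real k - 1)) * fact k" by (simp add: power2_eq_square)
    also have "\<dots> \<le> e * real k ^ 2 * fact k * fact k"
      using fk e by (intro mult_right_mono mult_left_mono) auto
    also have "\<dots> = e * (real (T k))\<^sup>2" by (simp add: T_def power2_eq_square)
    finally show "real (\<Gamma> k) \<le> e * (real (T k))\<^sup>2" .
  qed
qed

lemma eventually_le_imp_bounded:
  fixes f :: "nat \<Rightarrow> real"
  assumes "\<And>i. n \<le> i \<Longrightarrow> f i \<le> b"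
  shows "\<exists>B. \<forall>i. f i \<le> B"
proof (intro exI allI)
  fix i
  show "f i \<le> max b (\<Sum>j<n. \<bar>f j\<bar>)"
  proof (cases "n \<le> i")
    case False
    then have "\<bar>f i\<bar> \<le> (\<Sum>j<n. \<bar>f j\<bar>)" by (intro member_le_sum) auto
    then show ?thesis by linarith
  qed (use assms[of i] in simp)
qed

text \<open>Block \<open>i\<close> has one free letter, from an alphabet of size
  \<open>2 ^ Suc i\<close>. As \<open>2 * \<rho> < 1\<close>, its sum is at least
  \<open>2 powr (\<theta> * Suc i)\<close>, and the accumulated gain is quadratic in the exponent.
  It beats the ones, which number at most a small multiple of the square of \<open>i\<close>, and
  the linear cost of junctions and of the growing alphabet.\<close>

lemma hausdorff_measure_F_set_half:
  assumes \<rho>: "0 < \<rho>" "\<rho> < 1 / 2"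
  shows "hausdorff_measure \<rho> (F_set (1 / 2)) \<noteq> 0"
proof -
  define T :: "nat \<Rightarrow> nat" where "T = (\<lambda>k. k * fact k)"
  define \<Gamma> :: "nat \<Rightarrow> nat" where "\<Gamma> = (\<lambda>k. k * ((k + 1) * (k + 2) * fact k))"
  note st = factorial_stages[OF T_def \<Gamma>_def]
  have mono: "\<Gamma> k \<le> \<Gamma> (Suc k)" for k using st(4)[of k] by simp
  define r where "r = run_gap T \<Gamma>"
  have rs: "(\<Sum>j<i. r j) = \<Gamma> (stage T i)" for i unfolding r_def by (rule run_gap_sum[OF st(1-3) mono])
  define \<theta> where "\<theta> = 1 - 2 * \<rho>"
  have \<theta>: "0 < \<theta>" using \<rho> by (simp add: \<theta>_def)
  define V where "V i = (\<lambda>a. [a]) ` {1..2 ^ Suc i :: nat}" for i :: nat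
  define Z where "Z i = (\<Sum>v\<in>V i. qw v powr (- (2 * \<rho>)))" for i
  have Z: "2 powr (\<theta> * real (Suc i)) \<le> Z i" for i
  proof -
    let ?M = "2 ^ Suc i :: nat"
    have "Z i = (\<Sum>a=1..?M. real a powr (- (2 * \<rho>)))"
      unfolding Z_def V_def by (subst sum.reindex) (auto simp: inj_on_def)
    moreover have "(\<Sum>a=1..?M. real ?M powr (- (2 * \<rho>))) \<le> (\<Sum>a=1..?M. real a powr (- (2 * \<rho>)))"
    proof (intro sum_mono powr_mono2')
      fix a assume "a \<in> {1..?M}"
      then show "0 < real a" "real a \<le> real ?M" by (simp_all only: of_nat_le_iff atLeastAtMost_iff) simp
    qed (use \<rho> in simp)
    moreover have "(\<Sum>a=1..?M. real ?M powr (- (2 * \<rho>))) = 2 powr (\<theta> * real (Suc i))"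
    proof -
      have M: "real ?M = 2 powr real (Suc i)" by (simp add: powr_realpow[symmetric] del: power_Suc of_nat_Suc)
      have "(\<Sum>a=1..?M. real ?M powr (- (2 * \<rho>))) = real ?M * real ?M powr (- (2 * \<rho>))" by simp
      also have "\<dots> = 2 powr (\<theta> * real (Suc i))"
        unfolding M by (simp add: powr_powr powr_add[symmetric] \<theta>_def algebra_simps)
      finally show ?thesis .
    qed
    ultimately show ?thesis by simp
  qed
  \<comment> \<open>A bound for the binary logarithm of the product: 24 is at most
    \<open>2 ^ 5\<close>, \<open>golden\<close> is at most 2, and the sum of \<open>Suc j\<close>
    over \<open>j < i\<close> is at least half the square of \<open>i\<close>.\<close>
  define ex where "ex i = 10 * \<rho> * real i + 2 * \<rho> * real (\<Sum>j<i. r j) - \<theta> * (real i)\<^sup>2 / 2" for i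
  have golden2: "golden \<le> 2"
  proof -
    have "sqrt 5 \<le> sqrt (3\<^sup>2)" by (subst real_sqrt_le_iff) simp
    then show ?thesis by (simp add: golden_def)
  qed
  have prod: "(\<Prod>j<i. 24 powr (2 * \<rho>) * golden powr (2 * \<rho> * real (r j)) / Z j) \<le> 2 powr ex i" for i
  proof (induction i)
    case (Suc i)
    have "24 powr (2 * \<rho>) \<le> 2 powr (10 * \<rho>)"
    proof -
      have "24 powr (2 * \<rho>) \<le> (2 powr 5) powr (2 * \<rho>)" using \<rho> by (intro powr_mono2) auto
      also have "\<dots> = 2 powr (10 * \<rho>)" by (simp only: powr_powr) simp
      finally show ?thesis .
    qed
    moreover have "golden powr (2 * \<rho> * real (r i)) \<le> 2 powr (2 * \<rho> * real (r i))"
      using golden_gt_1 golden2 \<rho> by (intro powr_mono2) auto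
    ultimately have "24 powr (2 * \<rho>) * golden powr (2 * \<rho> * real (r i)) / Z i \<le>
        2 powr (10 * \<rho>) * 2 powr (2 * \<rho> * real (r i)) / 2 powr (\<theta> * real (Suc i))"
      using Z[of i] by (intro frac_le mult_mono) auto
    also have "\<dots> = 2 powr (10 * \<rho> + 2 * \<rho> * real (r i) - \<theta> * real (Suc i))"
      by (simp add: powr_add powr_diff)
    finally have f: "24 powr (2 * \<rho>) * golden powr (2 * \<rho> * real (r i)) / Z i \<le>
        2 powr (10 * \<rho> + 2 * \<rho> * real (r i) - \<theta> * real (Suc i))" .
    have Z0: "0 < Z i" using Z[of i] by (smt (verit) powr_gt_zero)
    have "(\<Prod>j<Suc i. 24 powr (2 * \<rho>) * golden powr (2 * \<rho> * real (r j)) / Z j) \<le>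
        2 powr ex i * 2 powr (10 * \<rho> + 2 * \<rho> * real (r i) - \<theta> * real (Suc i))"
      unfolding prod.lessThan_Suc using Suc f Z0 by (intro mult_mono) auto
    also have "\<dots> = 2 powr (ex i + (10 * \<rho> + 2 * \<rho> * real (r i) - \<theta> * real (Suc i)))"
      by (rule powr_add[symmetric])
    also have "\<dots> \<le> 2 powr ex (Suc i)"
      using \<theta> by (intro powr_mono) (auto simp: ex_def power2_eq_square algebra_simps add_divide_distrib)
    finally show ?case .
  qed (simp add: ex_def)
  have "\<exists>B. \<forall>i. ex i + 5 * \<rho> * (real i + 2) \<le> B"
  proof -
    obtain K where K: "\<And>k. K \<le> k \<Longrightarrow> real (\<Gamma> k) \<le> \<theta> / (8 * \<rho>) * (real (T k))\<^sup>2"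
      using st(8)[of "\<theta> / (8 * \<rho>)"] \<theta> \<rho> by auto
    \<comment> \<open>The gain is split into two halves: one covers the ones, by the choice of the
      multiple \<open>\<theta> / (8 * \<rho>)\<close>, and the other covers the linear term
      \<open>15 * \<rho> * i\<close> once \<open>i\<close> is at least
      \<open>60 * \<rho> / \<theta>\<close>. The constant part \<open>10 * \<rho>\<close>
      remains.\<close>
    show ?thesis
    proof (rule eventually_le_imp_bounded[of "max (T K) (nat \<lceil>60 * \<rho> / \<theta>\<rceil>)" _ "10 * \<rho>"])
      fix i assume "max (T K) (nat \<lceil>60 * \<rho> / \<theta>\<rceil>) \<le> i"
      then have i: "T K \<le> i" "60 * \<rho> / \<theta> \<le> real i" by (auto simp: nat_ceiling_le_eq)
      have "T K < T (Suc (stage T i))" using i(1) stage_bounds(2)[OF st(1,2), of i] by simp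
      then have "K \<le> stage T i" using strict_mono_less[OF st(1)] by simp
      then have "real (\<Gamma> (stage T i)) \<le> \<theta> / (8 * \<rho>) * (real (T (stage T i)))\<^sup>2" by (rule K)
      also have "\<dots> \<le> \<theta> / (8 * \<rho>) * (real i)\<^sup>2"
        using stage_bounds(1)[OF st(1,2), of i] \<theta> \<rho> by (intro mult_left_mono power_mono) auto
      finally have 1: "2 * \<rho> * real (\<Sum>j<i. r j) \<le> \<theta> * (real i)\<^sup>2 / 4"
        using \<rho> unfolding rs by (simp add: field_simps)
      have "60 * \<rho> \<le> \<theta> * real i" using i(2) \<theta> by (simp add: field_simps)
      then have "60 * \<rho> * real i \<le> \<theta> * real i * real i" by (rule mult_right_mono) simp
      then have "15 * \<rho> * real i \<le> \<theta> * (real i)\<^sup>2 / 4" by (simp add: power2_eq_square)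
      then show "ex i + 5 * \<rho> * (real i + 2) \<le> 10 * \<rho>" using 1 by (simp add: ex_def algebra_simps)
    qed
  qed
  then obtain B where B: "\<And>i. ex i + 5 * \<rho> * (real i + 2) \<le> B" by blast
  show ?thesis
  proof (rule hausdorff_measure_blocks_nonzero[where V = V and Mx = "\<lambda>i. 2 ^ Suc i" and N = 1 and r = r and C = "2 powr B"])
    fix i
    have "2 powr ex i \<le> 2 powr (B - 5 * \<rho> * (real i + 2))" using B[of i] by (intro powr_mono) auto
    also have "\<dots> = 2 powr B * (2 powr (real i + 2)) powr (- (5 * \<rho>))"
      by (simp add: powr_powr powr_add[symmetric] algebra_simps)
    also have "\<dots> \<le> 2 powr B * (real (2 ^ Suc i) + 1) powr (- (5 * \<rho>))"
    proof (intro mult_left_mono powr_mono2')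
      have "(1::real) \<le> 2 * 2 ^ i" using one_le_power[of "2::real" i] by linarith
      then have "real (2 ^ Suc i) + 1 \<le> 2 ^ (i + 2)" by simp
      also have "\<dots> = 2 powr (real i + 2)" using powr_realpow[of 2 "i + 2"] by (simp add: add.commute)
      finally show "real (2 ^ Suc i) + 1 \<le> 2 powr (real i + 2)" .
      show "0 < real (2 ^ Suc i) + 1" by (rule add_nonneg_pos) auto
    qed (use \<rho> in auto)
    finally show "(\<Prod>j<i. 24 powr (2 * \<rho>) * golden powr (2 * \<rho> * real (r j)) / (\<Sum>v\<in>V j. qw v powr (- (2 * \<rho>)))) \<le>
      2 powr B * (real (2 ^ Suc i) + 1) powr (- (real (2 * 1 + 3) * \<rho>))"
      using prod[of i] unfolding Z_def by (simp del: power_Suc)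
  next
    fix x \<omega> assume x: "x \<in> {0..<1}" "x \<notin> \<rat>" "\<forall>i. \<omega> i \<in> V i"
      "\<forall>i. cf_prefix (length (blocks r \<omega> i)) x = blocks r \<omega> i"
    have len: "length (\<omega> i) = 1" for i using x(3)[rule_format, of i] by (auto simp: V_def)
    have h: "(1 / 2 :: real) = (1 - 0) / (real (1 + 2) * 0 + 2 - 0)" by simp
    show "x \<in> F_set (1 / 2)"
      using x(4) unfolding r_def by (intro stage_liminf[where \<omega> = \<omega>, OF st(1-7) h x(1,2) len]) auto
  qed (use \<rho> in \<open>auto simp: V_def\<close>)
qed

text \<open>The cylinders of level \<open>n\<close> cover the irrationals of the unit interval, so
  their lengths sum to at least 1. Each is enclosed in an interval of radius
  \<open>1 / qw w ^ 2\<close>, which costs the factor 2. This is the input for \<alpha> = 0, where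
  \<open>g = 0\<close> and the exponent is 1.\<close>

lemma Zsum_at_1_ge_half: "ennreal (1 / 2) \<le> Zsum n 1"
proof -
  let ?J = "\<lambda>w. if length w = n \<and> 0 \<notin> set w then {cfm w 0 - 1 / qw w ^ 2 .. cfm w 0 + 1 / qw w ^ 2} else {}"
  let ?K = "\<lambda>i. if i \<in> range (to_nat :: nat list \<Rightarrow> nat) then ?J (from_nat i) else {}"
  have cover: "{0..<1} - \<rat> \<subseteq> (\<Union>i. ?K i)"
  proof
    fix x :: real assume "x \<in> {0..<1} - \<rat>"
    then have x: "x \<in> {0..<1}" "x \<notin> \<rat>" by auto
    define w where "w = cf_prefix n x"
    have w: "length w = n" "0 \<notin> set w" using cf_prefix_pos[OF x] by (auto simp: w_def)
    have "\<bar>cfm w ((gauss_map ^^ n) x) - cfm w 0\<bar> \<le> 1 / qw w ^ 2"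
      using gauss_funpow_irrational[OF x, of n] w by (intro cfm_diff_le) auto
    then have "\<bar>x - cfm w 0\<bar> \<le> 1 / qw w ^ 2" using cf_prefix_cfm[OF x, of n] by (simp add: w_def)
    then have "x \<in> ?J w" using w by (auto simp: abs_le_iff)
    then have "x \<in> ?K (to_nat w)" by (simp only: rangeI if_True from_nat_to_nat)
    then show "x \<in> (\<Union>i. ?K i)" by blast
  qed
  have Q: "countable (\<rat> :: real set)" by (rule countable_rat)
  have Qs: "(\<rat> :: real set) \<in> sets borel" by (rule sets.countable[OF _ Q]) auto
  have "emeasure lborel {0..<1::real} \<le> emeasure lborel (({0..<1} - \<rat>) \<union> \<rat> :: real set)"
    using Qs by (intro emeasure_mono) auto
  also have "\<dots> = emeasure lborel ({0..<1} - \<rat> :: real set)"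
    using Qs countable_imp_null_set_lborel[OF Q] by (intro emeasure_Un_null_set) auto
  also have "\<dots> \<le> emeasure lborel (\<Union>i. ?K i)"
    using cover by (intro emeasure_mono) auto
  also have "\<dots> \<le> (\<Sum>i. emeasure lborel (?K i))"
    by (intro emeasure_subadditive_countably) auto
  also have "\<dots> = (\<Sum>i. if i \<in> range (to_nat :: nat list \<Rightarrow> nat) then emeasure lborel (?J (from_nat i)) else 0)"
    by (intro suminf_cong) auto
  also have "\<dots> = (\<integral>\<^sup>+ w. emeasure lborel (?J w) \<partial>count_space UNIV)"
    by (rule nn_integral_count_space_countable[symmetric])
  also have "\<dots> = (\<integral>\<^sup>+ w. 2 * (if length w = n then qweight 1 w else 0) \<partial>count_space UNIV)"
  proof (intro nn_integral_cong)
    fix w :: "nat list"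
    show "emeasure lborel (?J w) = 2 * (if length w = n then qweight 1 w else 0)"
    proof (cases "length w = n \<and> 0 \<notin> set w")
      case True
      then have p: "0 < qw w" by (intro cden_pos) auto
      have e: "1 / qw w ^ 2 = qw w powr (- (2 * 1))"
        using p by (simp add: powr_minus_divide powr_realpow flip: powr_numeral)
      have "emeasure lborel (?J w) = ennreal (2 * (1 / qw w ^ 2))" using True p by simp
      then have "emeasure lborel (?J w) = ennreal (2 * qw w powr (- (2 * 1)))" by (simp only: e)
      also have "ennreal (2 * qw w powr (- (2 * 1))) = ennreal 2 * ennreal (qw w powr (- (2 * 1)))"
        by (rule ennreal_mult) auto
      also have "\<dots> = 2 * (if length w = n then qweight 1 w else 0)"
        using True by (simp add: qweight_def)
      finally show ?thesis .
    qed (auto simp: qweight_def)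
  qed
  also have "\<dots> = 2 * Zsum n 1" by (simp add: nn_integral_cmult Zsum_def)
  finally have "1 \<le> 2 * Zsum n 1" by simp
  then have "ennreal (1 / 2) * 1 \<le> ennreal (1 / 2) * (2 * Zsum n 1)" by (rule mult_left_mono) simp
  also have "\<dots> = (ennreal (1 / 2) * ennreal 2) * Zsum n 1" by (simp add: mult.assoc)
  also have "ennreal (1 / 2) * ennreal 2 = 1" by (subst ennreal_mult[symmetric]) auto
  finally show ?thesis by simp
qed

section \<open>The dimension for each range of \<alpha>\<close>

lemma hausdorff_dim_geI:
  assumes "0 < d" "\<And>s. 0 < s \<Longrightarrow> s < d \<Longrightarrow> hausdorff_measure s A \<noteq> 0"
  shows "ereal d \<le> hausdorff_dim A"
proof (rule ccontr)
  assume "\<not> ereal d \<le> hausdorff_dim A"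
  then obtain c where c: "hausdorff_dim A < ereal c" "ereal c < ereal d"
    using ereal_dense2[of "hausdorff_dim A" "ereal d"] by (auto simp: not_le)
  define s where "s = max c (d / 2)"
  have s: "0 < s" "s < d" "c \<le> s" using c assms(1) by (auto simp: s_def)
  then have "ereal s \<le> hausdorff_dim A" using assms(2) by (intro hausdorff_dim_ge) auto
  then show False using c s by (metis ereal_less_eq(3) leD less_le_trans)
qed

lemma hausdorff_measure_F_set_zero:
  assumes \<rho>: "1 / 2 < \<rho>" and g: "0 < g" and n: "1 \<le> n" "Asum n g \<rho> < 1"
    and b: "0 < b" "g * (b - 1)\<^sup>2 < 4 * b" and \<alpha>: "1 / (1 + b) < \<alpha>" "\<alpha> < 1"
  shows "hausdorff_measure \<rho> (F_set \<alpha>) = 0"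
proof (rule hausdorff_measure_zero_long_runs[OF \<rho> g n b])
  fix x assume x: "x \<in> F_set \<alpha>"
  obtain n0 where n0: "\<And>n. n0 \<le> n \<Longrightarrow> 1 / (1 + b) * real n \<le> real (run_length n x)"
    using F_set_run_length[OF x \<alpha>(1)] by blast
  have "real n \<le> (1 + b) * real (run_length n x)" if "n0 \<le> n" for n
    using n0[OF that] b by (simp add: field_simps)
  then show "x \<in> {0..<1} \<and> x \<notin> \<rat> \<and> \<not> ev_const x \<and> (\<exists>n0. \<forall>n\<ge>n0. real n \<le> (1 + b) * real (run_length n x))"
    using x F_set_not_ev_const[OF x \<alpha>(2)] by (auto simp: F_set_def)
qed

lemma dim_F_set_between:
  assumes \<alpha>: "0 < \<alpha>" "\<alpha> < 1 / 2"
  shows "hausdorff_dim (F_set \<alpha>) = ereal (s_dim (4 * \<alpha> * (1 - \<alpha>)) golden)"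
proof -
  define \<gamma> where "\<gamma> = 4 * \<alpha> * (1 - \<alpha>)"
  define g where "g = 4 * \<alpha> * (1 - \<alpha>) / (1 - 2 * \<alpha>)\<^sup>2"
  have sq: "1 - \<gamma> = (1 - 2 * \<alpha>)\<^sup>2" by (simp add: \<gamma>_def power2_eq_square algebra_simps)
  have \<gamma>: "0 < \<gamma>" using \<alpha> by (simp add: \<gamma>_def)
  moreover have "0 < 1 - \<gamma>" unfolding sq using \<alpha> by simp
  ultimately have \<gamma>1: "0 < \<gamma>" "\<gamma> < 1" by auto
  have g\<gamma>: "g = \<gamma> / (1 - \<gamma>)" by (simp only: sq g_def) (simp only: \<gamma>_def)
  have g0: "0 < g" using \<gamma>1 by (simp add: g\<gamma>)
  obtain \<sigma> where \<sigma>: "(\<lambda>n. s_pre n \<gamma> golden) \<longlonglongrightarrow> \<sigma>" "1 / 2 \<le> \<sigma>"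
    "\<And>\<rho>. \<sigma> < \<rho> \<Longrightarrow> \<exists>n\<ge>1. Asum n g \<rho> < 1"
    "\<And>\<rho> n. 0 \<le> \<rho> \<Longrightarrow> \<rho> < \<sigma> \<Longrightarrow> 1 \<le> n \<Longrightarrow> 1 \<le> Asum n g \<rho>"
    using s_pre_limit[OF \<gamma>1 g\<gamma>] by blast
  have s: "s_dim \<gamma> golden = \<sigma>" using \<gamma>1 limI[OF \<sigma>(1)] by (simp add: s_dim_def)
  define \<beta> where "\<beta> = (1 - \<alpha>) / \<alpha>"
  have \<beta>: "1 < \<beta>" "1 / (1 + \<beta>) = \<alpha>" using \<alpha> by (auto simp: \<beta>_def field_simps)
  have gb: "g * (\<beta> - 1)\<^sup>2 = 4 * \<beta>"
  proof -
    have "\<beta> - 1 = (1 - 2 * \<alpha>) / \<alpha>" using \<alpha> by (simp add: \<beta>_def field_simps)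
    moreover have "1 - 2 * \<alpha> \<noteq> 0" using \<alpha> by simp
    ultimately show ?thesis using \<alpha> by (simp add: g_def \<beta>_def power_divide) (simp add: power2_eq_square)
  qed
  have "hausdorff_measure \<rho> (F_set \<alpha>) = 0" if \<rho>: "\<sigma> < \<rho>" for \<rho>
  proof -
    have h: "1 / 2 < \<rho>" using \<sigma>(2) \<rho> by simp
    obtain n where n: "1 \<le> n" "Asum n g \<rho> < 1" using \<sigma>(3)[OF \<rho>] by blast
    obtain z where z: "Zsum n \<rho> = ennreal z" "0 \<le> z" using Zsum_finite[OF h, of n] by (cases "Zsum n \<rho>") auto
    have As: "Asum n u \<rho> = ennreal (golden powr (- (2 * \<rho> * u * real n)) * z)" for u
      using z by (simp add: Asum_def ennreal_mult)
    \<comment> \<open>At \<open>g\<close> and \<beta> the discriminant vanishes. For fixed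
      \<open>n\<close> the sum is continuous in \<open>g\<close>, so \<open>g\<close> can be lowered
      to \<open>u\<close> with the sum still below 1; the discriminant condition is then strict and
      leaves room for some \<open>b\<close> above \<beta>.\<close>
    have "((\<lambda>u. golden powr (- (2 * \<rho> * u * real n)) * z) \<longlongrightarrow> golden powr (- (2 * \<rho> * g * real n)) * z) (at_left g)"
      using golden_gt_1 by (intro tendsto_intros) auto
    moreover have "golden powr (- (2 * \<rho> * g * real n)) * z < 1"
      using n(2) z(2) unfolding As by (simp add: ennreal_less_one_iff)
    ultimately have e1: "eventually (\<lambda>u. golden powr (- (2 * \<rho> * u * real n)) * z < 1) (at_left g)"
      by (rule order_tendstoD)
    have e2: "eventually (\<lambda>u. u \<in> {0<..<g}) (at_left g)" using g0 by (rule eventually_at_left_real)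
    obtain u where u: "golden powr (- (2 * \<rho> * u * real n)) * z < 1" "0 < u" "u < g"
      using eventually_happens'[OF _ eventually_conj[OF e1 e2]] by auto
    have An: "Asum n u \<rho> < 1" using u z unfolding As by (simp add: ennreal_less_one_iff)
    have "u * (\<beta> - 1)\<^sup>2 < 4 * \<beta>"
      unfolding gb[symmetric] using u \<beta> by (intro mult_strict_right_mono) auto
    moreover have "((\<lambda>b. 4 * b - u * (b - 1)\<^sup>2) \<longlongrightarrow> 4 * \<beta> - u * (\<beta> - 1)\<^sup>2) (at_right \<beta>)"
      by (intro tendsto_intros)
    ultimately have f1: "eventually (\<lambda>b. 0 < 4 * b - u * (b - 1)\<^sup>2) (at_right \<beta>)"
      by (intro order_tendstoD) auto
    have f2: "eventually (\<lambda>b. b \<in> {\<beta><..<\<beta> + 1}) (at_right \<beta>)" by (rule eventually_at_right_real) simp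
    obtain b where b: "0 < 4 * b - u * (b - 1)\<^sup>2" "\<beta> < b"
      using eventually_happens'[OF _ eventually_conj[OF f1 f2]] by auto
    show ?thesis
    proof (rule hausdorff_measure_F_set_zero[OF h u(2) n(1) An])
      show "1 / (1 + b) < \<alpha>" unfolding \<beta>(2)[symmetric] using b \<beta> by (intro divide_strict_left_mono) auto
    qed (use b \<beta> \<alpha> in auto)
  qed
  then have "hausdorff_dim (F_set \<alpha>) \<le> ereal \<sigma>" using \<sigma>(2) by (intro hausdorff_dim_le_eps) auto
  moreover have "ereal \<sigma> \<le> hausdorff_dim (F_set \<alpha>)"
  proof (rule hausdorff_dim_geI)
    show "0 < \<sigma>" using \<sigma>(2) by simp
    fix \<rho> assume \<rho>: "0 < \<rho>" "\<rho> < \<sigma>"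
    then obtain \<rho>' where \<rho>': "\<rho> < \<rho>'" "\<rho>' < \<sigma>" using dense by blast
    show "hausdorff_measure \<rho> (F_set \<alpha>) \<noteq> 0"
      using \<alpha> \<rho> \<rho>' \<sigma>(4)[of \<rho>'] by (intro hausdorff_measure_F_set_below_half[of \<alpha> g \<rho> \<rho>' 1]) (auto simp: g_def)
  qed
  ultimately show ?thesis using s by (simp add: \<gamma>_def)
qed

lemma dim_F_set_0: "hausdorff_dim (F_set 0) = 1"
proof (rule antisym)
  show "hausdorff_dim (F_set 0) \<le> 1" by (rule hausdorff_dim_unit_interval) (auto simp: F_set_def)
  have "ereal 1 \<le> hausdorff_dim (F_set 0)"
  proof (rule hausdorff_dim_geI)
    fix s :: real assume "0 < s" "s < 1"
    moreover have "Asum n 0 1 = Zsum n 1" for n using golden_gt_1 by (simp add: Asum_def)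
    ultimately show "hausdorff_measure s (F_set 0) \<noteq> 0"
      using Zsum_at_1_ge_half by (intro hausdorff_measure_F_set_below_half[of 0 0 s 1 "1 / 2"]) auto
  qed simp
  then show "1 \<le> hausdorff_dim (F_set 0)" by (simp add: one_ereal_def)
qed

lemma dim_F_set_half: "hausdorff_dim (F_set (1 / 2)) = ereal (1 / 2)"
proof (rule antisym)
  have "hausdorff_measure \<rho> (F_set (1 / 2)) = 0" if \<rho>: "1 / 2 < \<rho>" for \<rho>
  proof -
    obtain z where z: "Zsum 1 \<rho> = ennreal z" "0 \<le> z" using Zsum_finite[OF \<rho>, of 1] by (cases "Zsum 1 \<rho>") auto
    have "golden powr (- (2 * \<rho>)) < 1" using golden_gt_1 \<rho> powr_less_mono[of "- (2 * \<rho>)" 0 golden] by simp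
    then have "(\<lambda>n. (golden powr (- (2 * \<rho>))) ^ n * z) \<longlonglongrightarrow> 0 * z"
      by (intro tendsto_intros LIMSEQ_power_zero) simp
    then have "eventually (\<lambda>n. (golden powr (- (2 * \<rho>))) ^ n * z < 1) sequentially"
      by (intro order_tendstoD(2)) auto
    then have "eventually (\<lambda>n. (golden powr (- (2 * \<rho>))) ^ n * z < 1 \<and> 0 < n) sequentially"
      using eventually_gt_at_top[of 0] by (rule eventually_conj)
    then obtain n where n: "(golden powr (- (2 * \<rho>))) ^ n * z < 1" "0 < n"
      using eventually_happens'[OF sequentially_bot] by blast
    \<comment> \<open>For \<alpha> = 1/2 the critical \<open>b\<close> is 1, where the discriminant
      condition holds for every positive \<open>g\<close>. So \<open>g\<close> is chosen first,
      large enough for the sum over single letters to drop below 1, and \<open>b\<close> is then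
      taken close enough to 1.\<close>
    define g where "g = real n"
    have g0: "0 < g" using n by (simp add: g_def)
    have "golden powr (- (2 * \<rho> * g * real 1)) = (golden powr (- (2 * \<rho>))) ^ n"
      using golden_gt_1 by (simp add: g_def powr_powr flip: powr_realpow)
    then have An: "Asum 1 g \<rho> < 1"
      using n(1) z unfolding Asum_def by (simp add: ennreal_mult[symmetric] ennreal_less_one_iff)
    define b where "b = 1 + 1 / (1 + g)"
    have "g * (b - 1)\<^sup>2 < 4 * b"
    proof -
      have "g * (b - 1)\<^sup>2 = g / (1 + g) * (1 / (1 + g))" by (simp add: b_def power2_eq_square)
      also have "\<dots> \<le> 1 * 1" using g0 by (intro mult_mono) auto
      also have "\<dots> < 4 * b" using g0 by (simp add: b_def add_pos_nonneg)
      finally show ?thesis .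
    qed
    moreover have "1 < b" using g0 by (simp add: b_def)
    moreover have "1 / (1 + b) < 1 / 2" using \<open>1 < b\<close> by (simp add: field_simps)
    ultimately show ?thesis by (intro hausdorff_measure_F_set_zero[OF \<rho> g0 _ An]) auto
  qed
  then show "hausdorff_dim (F_set (1 / 2)) \<le> ereal (1 / 2)" by (intro hausdorff_dim_le_eps) auto
  show "ereal (1 / 2) \<le> hausdorff_dim (F_set (1 / 2))" by (rule hausdorff_dim_geI[OF _ hausdorff_measure_F_set_half]) simp_all
qed

theorem theorem1p6:
  fixes \<alpha> :: real
  assumes "0 \<le> \<alpha>" and "\<alpha> \<le> 1"
  shows "hausdorff_dim (F_set \<alpha>) =
    (if \<alpha> \<le> 1 / 2 then ereal (s_dim (4 * \<alpha> * (1 - \<alpha>)) ((sqrt 5 + 1) / 2)) else 0)"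
proof -
  consider "\<alpha> = 0" | "0 < \<alpha>" "\<alpha> < 1 / 2" | "\<alpha> = 1 / 2" | "1 / 2 < \<alpha>" using assms by linarith
  then show ?thesis
  proof cases
    case 1
    then show ?thesis using dim_F_set_0 by (simp add: s_dim_def one_ereal_def)
  next
    case 2
    then show ?thesis using dim_F_set_between[OF 2] by (simp add: golden_def)
  next
    case 3
    show ?thesis unfolding 3 using dim_F_set_half by (simp add: s_dim_def)
  next
    case 4
    then show ?thesis using hausdorff_dim_countable[OF countable_F_set] assms by simp
  qed
qed

end
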